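(* Let $f_\oplus$ be a probability density on $\mathbb{R}$ with finite second moment, support $D_\oplus$ an interval, cdf $F_\oplus$, and Wasserstein tangent space $\mathcal{T}_{f_\oplus}$. Let $\beta\in\mathbb{R}$ and let $\{\epsilon_t\}_{t\in\mathbb{Z}}$ be random elements of $\mathcal{T}_{f_\oplus}$ with covariance kernel $C_\epsilon(u,v)=\operatorname{Cov}(\epsilon_t(u),\epsilon_t(v))$, and assume: (A1) $|\beta|<1$; (A2) the $\epsilon_t$ are i.i.d., $\mathbb{E}[\epsilon_t(u)]=0$ for all $u\in D_\oplus$, and $\int_{\mathbb{R}}C_\epsilon(u,u)f_\oplus(u)\,du<\infty$; (A3) with $V_t=\sum_{i=0}^\infty\beta^i\epsilon_{t-i}$, almost surely $V_t$ is differentiable and $V_t'(u)>-1$ for all $u\in D_\oplus$; (A4) $\int_{\mathbb{R}}\mathbb{E}[\epsilon_t^4(u)]f_\oplus(u)\,du<\infty$. Let $f_t$ be the density of $\operatorname{Exp}_{f_\oplus}(V_t)$, so that with $T_t=Q_t\circ F_\oplus$ ($Q_t$ the quantile function of $f_t$) the WAR(1) model $T_t-\mathrm{id}=\beta(T_{t-1}-\mathrm{id})+\epsilon_t$ holds. Given $f_1,\dots,f_n$, define $\widehat F_\oplus=(n^{-1}\sum_{t=1}^nQ_t)^{-1}$, $\hat f_\oplus=\widehat F_\oplus'$, $\widehat T_t=Q_t\circ\widehat F_\oplus$, $$\hat\eta_h(u)=\frac1n\sum_{t=1}^{n-h}\{\widehat T_t(u)-u\}\{\widehat T_{t+h}(u)-u\},\qquad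 \hat\beta=\hat\rho_1=\frac{\int_{\mathbb{R}}\hat\eta_1(u)\hat f_\oplus(u)\,du}{\int_{\mathbb{R}}\hat\eta_0(u)\hat f_\oplus(u)\,du}.$$ Then $$n^{1/2}(\hat\beta-\beta)\xrightarrow{D}N\big(0,\sigma_\epsilon^2(1-\beta^2)\big),\qquad \sigma_\epsilon^2=\frac{\int_{\mathbb{R}^2}C_\epsilon^2(u,v)f_\oplus(u)f_\oplus(v)\,du\,dv}{\left[\int_{\mathbb{R}}C_\epsilon(u,u)f_\oplus(u)\,du\right]^2},$$ and $\sigma_\epsilon^2$ is finite.
   Context: $\mathcal{W}_2$ is the set of Borel probability measures on $\mathbb{R}$ with finite second moment. For $\mu\in\mathcal{W}_2$, the tangent space $\mathcal{T}_\mu$ is the closure in $L^2(\mathbb{R},d\mu)$ of $\{\lambda(T-\mathrm{id}):T$ the optimal (i.e. nondecreasing, quantile-composed) transport map from $\mu$ to some $\nu\in\mathcal{W}_2,\ \lambda>0\}$; for $\mu$ with density $f$ it is written $\mathcal{T}_f$. The exponential map is $\operatorname{Exp}_f(V)=(V+\mathrm{id})_\#\mu_f$ (pushforward of the measure $\mu_f$ with density $f$ under $V+\mathrm{id}$). For a distribution with cdf $F$, $F^{-1}$ denotes its quantile function; $(\cdot)^{-1}$ applied to the averaged quantile function denotes its inverse (a cdf). *)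

theory Defs
  imports "HOL-Probability.Probability"
begin

definition W2 :: "real measure set" where
  "W2 = {\<nu>. prob_space \<nu> \<and> sets \<nu> = sets borel \<and> integrable \<nu> (\<lambda>x. x\<^sup>2)}"

definition quantile :: "(real \<Rightarrow> real) \<Rightarrow> real \<Rightarrow> real" where
  "quantile F p = Inf {x. p \<le> F x}"

definition cdf_of_quantile :: "(real \<Rightarrow> real) \<Rightarrow> real \<Rightarrow> real" where
  "cdf_of_quantile Q x = Sup ({0} \<union> {p \<in> {0<..<1}. Q p \<le> x})"

definition opt_map :: "real measure \<Rightarrow> real measure \<Rightarrow> real \<Rightarrow> real" where
  "opt_map \<mu> \<nu> = (\<lambda>x. quantile (cdf \<nu>) (cdf \<mu> x))"

definition tangent_space :: "real measure \<Rightarrow> (real \<Rightarrow> real) set" where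
  "tangent_space \<mu> = {g. g \<in> borel_measurable borel \<and> (\<integral>\<^sup>+x. ennreal ((g x)\<^sup>2) \<partial>\<mu>) < \<infinity> \<and>
      (\<forall>e>0. \<exists>l>0. \<exists>\<nu>\<in>W2.
         (\<integral>\<^sup>+x. ennreal ((g x - l * (opt_map \<mu> \<nu> x - x))\<^sup>2) \<partial>\<mu>) < ennreal e)}"

definition measure_support :: "real measure \<Rightarrow> real set" where
  "measure_support \<mu> = {x. \<forall>e>0. emeasure \<mu> (ball x e) > 0}"

definition Exp_map :: "real measure \<Rightarrow> (real \<Rightarrow> real) \<Rightarrow> real measure" where
  "Exp_map \<mu> V = distr \<mu> borel (\<lambda>u. V u + u)"

definition Vproc :: "real \<Rightarrow> (int \<Rightarrow> 'a \<Rightarrow> real \<Rightarrow> real) \<Rightarrow> int \<Rightarrow> 'a \<Rightarrow> real \<Rightarrow> real" where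
  "Vproc \<beta> \<epsilon> t \<omega> u = (\<Sum>i. \<beta> ^ i * \<epsilon> (t - int i) \<omega> u)"

definition Qobs :: "(real \<Rightarrow> real) \<Rightarrow> real \<Rightarrow> (int \<Rightarrow> 'a \<Rightarrow> real \<Rightarrow> real) \<Rightarrow> int \<Rightarrow> 'a \<Rightarrow> real \<Rightarrow> real" where
  "Qobs f \<beta> \<epsilon> t \<omega> = quantile (cdf (Exp_map (density lborel f) (Vproc \<beta> \<epsilon> t \<omega>)))"

definition Fhat :: "(int \<Rightarrow> real \<Rightarrow> real) \<Rightarrow> nat \<Rightarrow> real \<Rightarrow> real" where
  "Fhat Q n = cdf_of_quantile (\<lambda>p. (1 / real n) * (\<Sum>t\<in>{1..int n}. Q t p))"

definition fhat :: "(int \<Rightarrow> real \<Rightarrow> real) \<Rightarrow> nat \<Rightarrow> real \<Rightarrow> real" where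
  "fhat Q n u = deriv (Fhat Q n) u"

definition That :: "(int \<Rightarrow> real \<Rightarrow> real) \<Rightarrow> nat \<Rightarrow> int \<Rightarrow> real \<Rightarrow> real" where
  "That Q n t u = Q t (Fhat Q n u)"

definition etahat :: "(int \<Rightarrow> real \<Rightarrow> real) \<Rightarrow> nat \<Rightarrow> nat \<Rightarrow> real \<Rightarrow> real" where
  "etahat Q n h u = (1 / real n) *
     (\<Sum>t\<in>{1..int n - int h}. (That Q n t u - u) * (That Q n (t + int h) u - u))"

definition betahat :: "(int \<Rightarrow> real \<Rightarrow> real) \<Rightarrow> nat \<Rightarrow> real" where
  "betahat Q n = (\<integral>u. etahat Q n 1 u * fhat Q n u \<partial>lborel) / (\<integral>u. etahat Q n 0 u * fhat Q n u \<partial>lborel)"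

text \<open>Covariance kernel of eps_t (identically distributed, so take t = 0).\<close>
definition cov_kernel :: "'a measure \<Rightarrow> (int \<Rightarrow> 'a \<Rightarrow> real \<Rightarrow> real) \<Rightarrow> real \<Rightarrow> real \<Rightarrow> real" where
  "cov_kernel M \<epsilon> u v = (\<integral>\<omega>. \<epsilon> 0 \<omega> u * \<epsilon> 0 \<omega> v \<partial>M) - (\<integral>\<omega>. \<epsilon> 0 \<omega> u \<partial>M) * (\<integral>\<omega>. \<epsilon> 0 \<omega> v \<partial>M)"

definition sigma_eps_sq :: "'a measure \<Rightarrow> (int \<Rightarrow> 'a \<Rightarrow> real \<Rightarrow> real) \<Rightarrow> (real \<Rightarrow> real) \<Rightarrow> real" where
  "sigma_eps_sq M \<epsilon> f =
     (\<integral>uv. (cov_kernel M \<epsilon> (fst uv) (snd uv))\<^sup>2 * f (fst uv) * f (snd uv) \<partial>(lborel \<Otimes>\<^sub>M lborel))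
     / (\<integral>u. cov_kernel M \<epsilon> u u * f u \<partial>lborel)\<^sup>2"

end

theory Submission
  imports Defs "HOL-Probability.Probability"
begin

text \<open>
  Write \<open>\<mu>\<close> for the measure with density \<open>f\<close>. Almost surely every \<open>T\<^sub>t = V\<^sub>t + id\<close> is strictly increasing on the
  support, so \<open>Q\<^sub>t = T\<^sub>t \<circ> Q\<close> with \<open>Q\<close> the quantile function of \<open>\<mu>\<close>, and the estimated cdf is that of the
  image of \<open>\<mu>\<close> under the mean map. This image is absolutely continuous, so by Lebesgue differentiation
  the derivative of the estimated cdf is its density, and pulling back to \<open>\<mu>\<close> turns the estimator into
  the ratio of \<open>\<Sum> \<langle>V\<^sub>t - V', V\<^sub>t\<^sub>+\<^sub>1 - V'\<rangle>\<close> and \<open>\<Sum> \<parallel>V\<^sub>t - V'\<parallel>\<^sup>2\<close> in \<open>L\<^sup>2(\<mu>)\<close>, \<open>V'\<close> being the sample mean.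

  Up to remainders that stay bounded in mean, numerator minus \<open>\<beta>\<close> times denominator is the sum of
  \<open>X\<^sub>t = \<langle>V\<^sub>t\<^sub>-\<^sub>1, \<epsilon>\<^sub>t\<rangle>\<close>, and \<open>(1 - \<beta>\<^sup>2)\<close> times the denominator is the sum of \<open>\<parallel>\<epsilon>\<^sub>t\<parallel>\<^sup>2\<close> plus \<open>2 \<beta>\<close> times the
  sum of \<open>X\<^sub>t\<close>. The \<open>X\<^sub>t\<close> are orthogonal to the past, and the recursion \<open>V\<^sub>t = \<beta> V\<^sub>t\<^sub>-\<^sub>1 + \<epsilon>\<^sub>t\<close> makes the deviation of
  the conditional variance of \<open>X\<^sub>t\<close> from its limit contract by \<open>\<beta>\<^sup>2\<close> per step; this is enough to follow the
  characteristic function of the partial sums step by step down to the Gaussian one.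
\<close>

section \<open>Characteristic functions of sums with contracting conditional variance\<close>

text \<open>Write C for the covariance kernel, C2 for the double integral of C^2 and kappa for the
  integral of C(u,u). The conditional second moment of \<open>X t\<close> given the past is the
  double integral of V(u) V(v) C(u,v) with V = \<open>V (t - 1)\<close>. It is random, and its
  limiting value is the fixed point of tau = \<beta>^2 tau + C2. Divided by n, the denominator tends
  to kappa / (1 - \<beta>^2); hence the normalised error behaves like (1 - \<beta>^2) / kappa times
  the sum of \<open>X\<close> over sqrt n, with variance (1 - \<beta>^2)^2 / kappa^2 * C2 / (1 -
  \<beta>^2). Independence is given for random functions seen through their coordinates, and an
  inner product need not be measurable for that product sigma-algebra. Independence is therefore
  applied at fixed points u, v, under a double integral and after Fubini. A second difficulty is
  that \<open>Inf\<close>, \<open>Sup\<close> and \<open>deriv\<close> return default values where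
  they are ill-posed: the estimator has to be measurable on all of the sample space, including the
  null event on which the almost sure picture fails.\<close>

lemma abs_cube_le_one_plus_pow4: "\<bar>x::real\<bar> ^ 3 \<le> 1 + x ^ 4"
proof (cases "\<bar>x\<bar> \<le> 1")
  case True
  then have "\<bar>x\<bar> ^ 3 \<le> 1" by (simp add: power_le_one)
  then show ?thesis by (smt (verit) zero_le_even_power even_numeral)
next
  case False
  then have "\<bar>x\<bar> ^ 3 \<le> \<bar>x\<bar> ^ 4" by (intro power_increasing) auto
  then show ?thesis by simp
qed

lemma square_le_one_plus_pow4: "(x::real) ^ 2 \<le> 1 + x ^ 4"
proof -
  have "0 \<le> (x ^ 2 - 1) ^ 2" by simp
  then have "2 * x ^ 2 \<le> 1 + x ^ 4" by (simp add: power2_diff flip: power_mult)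
  then show ?thesis by (smt (verit) zero_le_power2)
qed

lemma abs_le_one_plus_pow4: "\<bar>x::real\<bar> \<le> 1 + x ^ 4"
proof -
  have "0 \<le> (\<bar>x\<bar> - 1) ^ 2" by simp
  then have "2 * \<bar>x\<bar> \<le> 1 + x ^ 2" by (simp add: power2_diff)
  then show ?thesis
    using square_le_one_plus_pow4[of x] by (smt (verit) zero_le_even_power even_numeral)
qed

text \<open>Young's inequality for |x| and y^2. It serves the cross term |X_k| X_(k+1)^2 that arises
  when the weight moves on by one step.\<close>

lemma abs_mult_square_le_pow4: "\<bar>x::real\<bar> * y ^ 2 \<le> 1 + x ^ 4 + y ^ 4"
proof -
  have "0 \<le> (\<bar>x\<bar> - y ^ 2) ^ 2" by simp
  then have "2 * (\<bar>x\<bar> * y ^ 2) \<le> x ^ 2 + y ^ 4" by (simp add: power2_diff flip: power_mult)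
  moreover have "0 \<le> \<bar>x\<bar> * y ^ 2" by simp
  ultimately show ?thesis using square_le_one_plus_pow4[of x] by linarith
qed

lemma iexp_approx_second_order: "cmod (iexp x - 1 - \<i> * x + x\<^sup>2 / 2) \<le> \<bar>x\<bar> ^ 3"
proof -
  have "(\<Sum>k\<le>2. (\<i> * complex_of_real x)^k / fact k) = 1 + \<i> * x - x\<^sup>2 / 2"
    by (simp add: numeral_2_eq_2 power_mult_distrib fact_reduce)
  then have "cmod (iexp x - (1 + \<i> * x - x\<^sup>2 / 2)) \<le> \<bar>x\<bar> ^ 3 / fact 3"
    using iexp_approx1[of x 2] by (simp add: numeral_3_eq_3 numeral_2_eq_2)
  also have "\<dots> \<le> \<bar>x\<bar> ^ 3" by (simp add: fact_numeral)
  finally show ?thesis by (simp add: algebra_simps)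
qed

lemma iexp_approx_first_order: "cmod (iexp x - 1) \<le> \<bar>x\<bar>"
  using iexp_approx1[of x 0] by simp

lemma norm_integral_le_integral:
  fixes f :: "'a \<Rightarrow> 'b::{banach, second_countable_topology}" and g :: "'a \<Rightarrow> real"
  assumes f: "f \<in> borel_measurable M" and g: "integrable M g"
    and le: "\<And>x. x \<in> space M \<Longrightarrow> norm (f x) \<le> g x"
  shows "norm (\<integral>x. f x \<partial>M) \<le> (\<integral>x. g x \<partial>M)"
proof -
  have "integrable M f"
    by (rule Bochner_Integration.integrable_bound[OF g f])
      (use le in \<open>auto intro!: AE_I2 intro: order_trans[OF _ abs_ge_self]\<close>)
  have "norm (\<integral>x. f x \<partial>M) \<le> (\<integral>x. norm (f x) \<partial>M)" by (rule integral_norm_bound)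
  also have "\<dots> \<le> (\<integral>x. g x \<partial>M)"
    by (intro integral_mono integrable_norm \<open>integrable M f\<close> g le)
  finally show ?thesis .
qed

context prob_space
begin

lemma integrable_bounded_mult_complex:
  fixes W :: "'a \<Rightarrow> complex" and Y :: "'a \<Rightarrow> complex"
  assumes [measurable]: "W \<in> borel_measurable M" and "\<And>\<omega>. cmod (W \<omega>) \<le> 1" and Y: "integrable M Y"
  shows "integrable M (\<lambda>\<omega>. W \<omega> * Y \<omega>)"
proof (rule Bochner_Integration.integrable_bound[OF Y])
  have [measurable]: "Y \<in> borel_measurable M" using Y by auto
  show "(\<lambda>\<omega>. W \<omega> * Y \<omega>) \<in> borel_measurable M" by measurable
  show "AE \<omega> in M. norm (W \<omega> * Y \<omega>) \<le> norm (Y \<omega>)"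
    using assms(2) by (auto simp: norm_mult intro!: mult_left_le_one_le)
qed

lemma integrable_lower_powers:
  fixes X :: "'a \<Rightarrow> real"
  assumes [measurable]: "X \<in> borel_measurable M" and X: "integrable M (\<lambda>\<omega>. X \<omega> ^ 4)"
  shows "integrable M X" "integrable M (\<lambda>\<omega>. (X \<omega>)\<^sup>2)"
proof -
  have *: "integrable M (\<lambda>\<omega>. 1 + X \<omega> ^ 4)" using X by simp
  show "integrable M X"
    by (rule Bochner_Integration.integrable_bound[OF *])
      (use abs_le_one_plus_pow4 in \<open>auto intro!: AE_I2 simp: order_trans[OF _ abs_ge_self]\<close>)
  show "integrable M (\<lambda>\<omega>. (X \<omega>)\<^sup>2)"
    by (rule Bochner_Integration.integrable_bound[OF *])
      (use square_le_one_plus_pow4 in \<open>auto intro!: AE_I2 simp: order_trans[OF _ abs_ge_self]\<close>)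
qed

text \<open>With \<open>\<phi>\<^sub>k = E \<psi>\<^sub>k\<close> and \<open>D\<^sub>k = E (\<psi>\<^sub>k (X\<^sub>k\<^sup>2 - \<tau>))\<close>, a step costs \<open>\<bar>\<phi>\<^sub>k - a\<^sup>k\<bar>\<close> about \<open>\<theta>\<^sup>2 \<bar>D\<^sub>k\<bar> / 2\<close>, while \<open>\<bar>D\<^sub>k\<bar>\<close>
  shrinks by the factor \<open>\<rho>\<close>; so \<open>\<bar>\<phi>\<^sub>k - a\<^sup>k\<bar> + \<gamma> \<bar>D\<^sub>k\<bar>\<close> grows only by \<open>O(\<bar>\<theta>\<bar>\<^sup>3)\<close> per step. No law of large
  numbers for the conditional variances is needed.\<close>

lemma char_partial_sum_bound:
  fixes X :: "nat \<Rightarrow> 'a \<Rightarrow> real" and \<tau> \<rho> K \<theta> :: real and \<psi> :: "nat \<Rightarrow> 'a \<Rightarrow> complex"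
  defines "\<psi> \<equiv> \<lambda>k \<omega>. iexp (\<theta> * (\<Sum>j<k. X j \<omega>))"
  assumes [measurable]: "\<And>k. X k \<in> borel_measurable M"
    and int4: "\<And>k. integrable M (\<lambda>\<omega>. X k \<omega> ^ 4)"
    and K: "\<And>k. expectation (\<lambda>\<omega>. X k \<omega> ^ 4) \<le> K"
    and \<rho>: "0 \<le> \<rho>" "\<rho> < 1" and \<tau>: "0 \<le> \<tau>" and small: "\<theta>\<^sup>2 * \<tau> \<le> 2"
    and orth: "\<And>k. (CLINT \<omega>|M. \<psi> k \<omega> * X k \<omega>) = 0"
    and contr: "\<And>k. (CLINT \<omega>|M. \<psi> k \<omega> * ((X (Suc k) \<omega>)\<^sup>2 - \<tau>))
                  = \<rho> * (CLINT \<omega>|M. \<psi> k \<omega> * ((X k \<omega>)\<^sup>2 - \<tau>))"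
  shows "cmod ((CLINT \<omega>|M. \<psi> n \<omega>) - (1 - \<theta>\<^sup>2 * \<tau> / 2) ^ n)
     \<le> \<theta>\<^sup>2 / (2 * (1 - \<rho>)) * (1 + 2 * K + \<tau> * (1 + K))
        + n * (\<bar>\<theta>\<bar> ^ 3 * ((1 + 2 * K + \<tau> * (1 + K)) / (2 * (1 - \<rho>)) + (1 + K)))"
proof -
  define a where "a = 1 - \<theta>\<^sup>2 * \<tau> / 2"
  define L where "L = 1 + 2 * K + \<tau> * (1 + K)"
  \<comment> \<open>The weight solves
    \<open>\<theta>\<^sup>2 / 2 + \<gamma> * \<rho> = \<gamma>\<close>: what a step adds to the
    error of \<phi> is exactly what the contraction takes from \<gamma> times |D|.\<close>
  define \<gamma> where "\<gamma> = \<theta>\<^sup>2 / (2 * (1 - \<rho>))"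
  define \<phi> where "\<phi> k = (CLINT \<omega>|M. \<psi> k \<omega>)" for k
  define D where "D k = (CLINT \<omega>|M. \<psi> k \<omega> * ((X k \<omega>)\<^sup>2 - \<tau>))" for k
  have a: "0 \<le> a" "a \<le> 1" using small \<tau> by (auto simp: a_def)
  have K0: "0 \<le> K" by (rule order_trans[OF _ K[of 0]]) (simp add: zero_le_even_power)
  have \<gamma>0: "0 \<le> \<gamma>" using \<rho> by (simp add: \<gamma>_def)
  have [measurable]: "\<psi> k \<in> borel_measurable M" for k unfolding \<psi>_def by measurable
  have \<psi>1: "cmod (\<psi> k \<omega>) = 1" for k \<omega> unfolding \<psi>_def by (simp only: norm_exp_i_times)
  have \<psi>_Suc: "\<psi> (Suc k) \<omega> = \<psi> k \<omega> * iexp (\<theta> * X k \<omega>)" for k \<omega>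
    by (simp add: \<psi>_def exp_add[symmetric] algebra_simps)
  have i1: "integrable M (\<lambda>\<omega>. X k \<omega>)" and i2: "integrable M (\<lambda>\<omega>. (X k \<omega>)\<^sup>2)" for k
    using integrable_lower_powers[OF _ int4] by auto
  have i\<psi>: "integrable M (\<psi> k)" for k
    using integrable_bounded_mult_complex[of "\<psi> k" "\<lambda>_. 1"] \<psi>1 by simp
  have iX: "integrable M (\<lambda>\<omega>. \<psi> k \<omega> * complex_of_real (X j \<omega>))" for k j
    by (intro integrable_bounded_mult_complex) (use i1 \<psi>1 in auto)
  have iX2: "integrable M (\<lambda>\<omega>. \<psi> k \<omega> * complex_of_real ((X j \<omega>)\<^sup>2 - \<tau>))" for k j
    by (intro integrable_bounded_mult_complex integrable_of_real) (use i2 \<psi>1 in auto)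

  have step1: "cmod (\<phi> (Suc k) - a * \<phi> k) \<le> \<theta>\<^sup>2 / 2 * cmod (D k) + \<bar>\<theta>\<bar> ^ 3 * (1 + K)" for k
  proof -
    \<comment> \<open>Third-order Taylor remainder of the new factor. In the regrouping below, the
      square of X is split as \<tau> plus a deviation: \<tau> goes into the factor \<open>a\<close>,
      the deviation becomes \<open>D k\<close>, and the linear term is removed by
      \<open>orth\<close>.\<close>
    define R where "R \<omega> = \<psi> k \<omega> * (iexp (\<theta> * X k \<omega>) - 1 - \<i> * (\<theta> * X k \<omega>) + (\<theta> * X k \<omega>)\<^sup>2 / 2)" for \<omega>
    have R: "R \<omega> = \<psi> (Suc k) \<omega> - a * \<psi> k \<omega> - \<i> * \<theta> * (\<psi> k \<omega> * X k \<omega>)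
        + \<theta>\<^sup>2 / 2 * (\<psi> k \<omega> * ((X k \<omega>)\<^sup>2 - \<tau>))" for \<omega>
      by (simp add: R_def \<psi>_Suc a_def field_simps power2_eq_square)
    have "(CLINT \<omega>|M. R \<omega>) = \<phi> (Suc k) - a * \<phi> k - \<i> * \<theta> * (CLINT \<omega>|M. \<psi> k \<omega> * X k \<omega>) + \<theta>\<^sup>2 / 2 * D k"
      unfolding R \<phi>_def D_def using i\<psi> iX iX2
      by (subst Bochner_Integration.integral_add Bochner_Integration.integral_diff
           Bochner_Integration.integrable_diff integral_mult_right_zero; (auto; fail)?)+
    then have eq: "\<phi> (Suc k) - a * \<phi> k = (CLINT \<omega>|M. R \<omega>) - \<theta>\<^sup>2 / 2 * D k"
      by (simp add: orth)
    have Rb: "cmod (R \<omega>) \<le> \<bar>\<theta>\<bar> ^ 3 * (1 + X k \<omega> ^ 4)" for \<omega>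
    proof -
      have "cmod (R \<omega>) \<le> \<bar>\<theta> * X k \<omega>\<bar> ^ 3"
        unfolding R_def using iexp_approx_second_order[of "\<theta> * X k \<omega>"] by (simp add: norm_mult \<psi>1)
      also have "\<dots> \<le> \<bar>\<theta>\<bar> ^ 3 * (1 + X k \<omega> ^ 4)"
        unfolding abs_mult power_mult_distrib by (intro mult_left_mono abs_cube_le_one_plus_pow4) auto
      finally show ?thesis .
    qed
    have "cmod (CLINT \<omega>|M. R \<omega>) \<le> (\<integral>\<omega>. \<bar>\<theta>\<bar> ^ 3 * (1 + X k \<omega> ^ 4) \<partial>M)"
      by (intro norm_integral_le_integral Rb) (use int4 in \<open>auto simp: R_def\<close>)
    also have "\<dots> \<le> \<bar>\<theta>\<bar> ^ 3 * (1 + K)"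
      using K[of k] int4[of k] by (simp add: mult_left_mono prob_space)
    finally have "cmod (CLINT \<omega>|M. R \<omega>) \<le> \<bar>\<theta>\<bar> ^ 3 * (1 + K)" .
    moreover have "cmod (\<theta>\<^sup>2 / 2 * D k) = \<theta>\<^sup>2 / 2 * cmod (D k)" by (simp add: norm_mult norm_divide norm_power)
    ultimately show ?thesis unfolding eq by (smt (verit) norm_triangle_ineq4)
  qed

  have step2: "cmod (D (Suc k)) \<le> \<rho> * cmod (D k) + \<bar>\<theta>\<bar> * L" for k
  proof -
    \<comment> \<open>\<open>contr\<close> speaks of the weight \<open>\<psi> k\<close>, while
      \<open>D (Suc k)\<close> carries \<open>\<psi> (Suc k)\<close>; exchanging the weights costs
      at most |\<theta> X_k|, since iexp is 1-Lipschitz.\<close>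
    define R where "R \<omega> = (\<psi> (Suc k) \<omega> - \<psi> k \<omega>) * ((X (Suc k) \<omega>)\<^sup>2 - \<tau>)" for \<omega>
    have "D (Suc k) = (CLINT \<omega>|M. R \<omega>) + (CLINT \<omega>|M. \<psi> k \<omega> * ((X (Suc k) \<omega>)\<^sup>2 - \<tau>))"
      unfolding R_def D_def left_diff_distrib using iX2 by (subst Bochner_Integration.integral_diff) auto
    then have eq: "D (Suc k) = (CLINT \<omega>|M. R \<omega>) + \<rho> * D k" unfolding contr D_def .
    define B where "B \<omega> = \<bar>\<theta>\<bar> * ((1 + X k \<omega> ^ 4 + X (Suc k) \<omega> ^ 4) + \<tau> * (1 + X k \<omega> ^ 4))" for \<omega>
    have Rb: "cmod (R \<omega>) \<le> B \<omega>" for \<omega>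
    proof -
      have "cmod (R \<omega>) = cmod (\<psi> k \<omega> * (iexp (\<theta> * X k \<omega>) - 1)) * \<bar>(X (Suc k) \<omega>)\<^sup>2 - \<tau>\<bar>"
      proof -
        have "R \<omega> = (\<psi> k \<omega> * (iexp (\<theta> * X k \<omega>) - 1)) * complex_of_real ((X (Suc k) \<omega>)\<^sup>2 - \<tau>)"
          by (simp add: R_def \<psi>_Suc algebra_simps)
        then show ?thesis by (simp only: norm_mult norm_of_real)
      qed
      also have "\<dots> \<le> \<bar>\<theta> * X k \<omega>\<bar> * ((X (Suc k) \<omega>)\<^sup>2 + \<tau>)"
        using iexp_approx_first_order[of "\<theta> * X k \<omega>"] \<tau>
        by (intro mult_mono) (auto simp: norm_mult \<psi>1 abs_le_iff)
      also have "\<dots> = \<bar>\<theta>\<bar> * (\<bar>X k \<omega>\<bar> * (X (Suc k) \<omega>)\<^sup>2 + \<tau> * \<bar>X k \<omega>\<bar>)"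
        by (simp add: abs_mult algebra_simps)
      also have "\<dots> \<le> B \<omega>" unfolding B_def
        by (intro mult_left_mono add_mono abs_mult_square_le_pow4 abs_le_one_plus_pow4 \<tau>) auto
      finally show ?thesis .
    qed
    have iB: "integrable M B" unfolding B_def using int4 by auto
    have "cmod (CLINT \<omega>|M. R \<omega>) \<le> (\<integral>\<omega>. B \<omega> \<partial>M)"
      by (intro norm_integral_le_integral iB Rb) (auto simp: R_def)
    also have "\<dots> = \<bar>\<theta>\<bar> * ((1 + expectation (\<lambda>\<omega>. X k \<omega> ^ 4) + expectation (\<lambda>\<omega>. X (Suc k) \<omega> ^ 4))
        + \<tau> * (1 + expectation (\<lambda>\<omega>. X k \<omega> ^ 4)))"
      unfolding B_def using int4 by (simp add: prob_space)
    also have "\<dots> \<le> \<bar>\<theta>\<bar> * ((1 + K + K) + \<tau> * (1 + K))"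
      using K \<tau> by (intro mult_left_mono add_mono) auto
    finally have "cmod (CLINT \<omega>|M. R \<omega>) \<le> \<bar>\<theta>\<bar> * L" by (simp add: L_def algebra_simps)
    moreover have "cmod (\<rho> * D k) = \<rho> * cmod (D k)" using \<rho> by (simp add: norm_mult)
    ultimately show ?thesis unfolding eq by (smt (verit) norm_triangle_ineq)
  qed

  have D0: "cmod (D 0) \<le> L"
  proof -
    have "cmod (D 0) \<le> (\<integral>\<omega>. 1 + X 0 \<omega> ^ 4 + \<tau> \<partial>M)"
      unfolding D_def
    proof (rule norm_integral_le_integral)
      show "cmod (\<psi> 0 \<omega> * complex_of_real ((X 0 \<omega>)\<^sup>2 - \<tau>)) \<le> 1 + X 0 \<omega> ^ 4 + \<tau>" for \<omega>
        using square_le_one_plus_pow4[of "X 0 \<omega>"] \<tau> zero_le_power2[of "X 0 \<omega>"]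
        by (simp only: norm_mult \<psi>1 norm_of_real mult_1_left)
    qed (use int4 in auto)
    also have "\<dots> \<le> 1 + K + \<tau>" using K[of 0] int4 by (simp add: prob_space)
    also have "\<dots> \<le> L" using K0 \<tau> by (simp add: L_def algebra_simps)
    finally show ?thesis .
  qed

  have main: "cmod (\<phi> k - a ^ k) + \<gamma> * cmod (D k) \<le> \<gamma> * cmod (D 0) + k * (\<gamma> * \<bar>\<theta>\<bar> * L + \<bar>\<theta>\<bar> ^ 3 * (1 + K))" for k
  proof (induction k)
    case 0
    then show ?case by (simp add: \<phi>_def \<psi>_def prob_space)
  next
    case (Suc k)
    have "cmod (\<phi> (Suc k) - a ^ Suc k) \<le> cmod (\<phi> (Suc k) - a * \<phi> k) + cmod (a * (\<phi> k - a ^ k))"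
      by (rule order_trans[OF _ norm_triangle_ineq]) (simp add: algebra_simps)
    also have "cmod (a * (\<phi> k - a ^ k)) \<le> cmod (\<phi> k - a ^ k)"
      using a by (simp add: norm_mult mult_left_le_one_le)
    finally have 1: "cmod (\<phi> (Suc k) - a ^ Suc k) \<le> \<theta>\<^sup>2 / 2 * cmod (D k) + \<bar>\<theta>\<bar> ^ 3 * (1 + K) + cmod (\<phi> k - a ^ k)"
      using step1[of k] by linarith
    have 2: "\<gamma> * cmod (D (Suc k)) \<le> \<gamma> * \<rho> * cmod (D k) + \<gamma> * \<bar>\<theta>\<bar> * L"
      using mult_left_mono[OF step2[of k] \<gamma>0] by (simp add: algebra_simps)
    have 3: "\<theta>\<^sup>2 / 2 * cmod (D k) + \<gamma> * \<rho> * cmod (D k) = \<gamma> * cmod (D k)"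
      using \<rho> by (simp add: \<gamma>_def field_simps)
    have 4: "real (Suc k) * (\<gamma> * \<bar>\<theta>\<bar> * L + \<bar>\<theta>\<bar> ^ 3 * (1 + K)) =
        real k * (\<gamma> * \<bar>\<theta>\<bar> * L + \<bar>\<theta>\<bar> ^ 3 * (1 + K)) + (\<gamma> * \<bar>\<theta>\<bar> * L + \<bar>\<theta>\<bar> ^ 3 * (1 + K))"
      by (simp only: of_nat_Suc distrib_right mult_1_left add.commute)
    from 1 2 3 4 Suc show ?case by linarith
  qed
  have eq: "\<gamma> * \<bar>\<theta>\<bar> * L + \<bar>\<theta>\<bar> ^ 3 * (1 + K) = \<bar>\<theta>\<bar> ^ 3 * (L / (2 * (1 - \<rho>)) + (1 + K))"
  proof -
    have "\<theta>\<^sup>2 * \<bar>\<theta>\<bar> = \<bar>\<theta>\<bar> ^ 3" unfolding power2_abs[symmetric, of \<theta>] by (simp only: power3_eq_cube power2_eq_square)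
    then have "\<gamma> * \<bar>\<theta>\<bar> * L = \<bar>\<theta>\<bar> ^ 3 * (L / (2 * (1 - \<rho>)))" by (simp add: \<gamma>_def)
    then show ?thesis by (simp add: distrib_left)
  qed
  have "cmod (\<phi> n - a ^ n) \<le> \<gamma> * cmod (D 0) + n * (\<gamma> * \<bar>\<theta>\<bar> * L + \<bar>\<theta>\<bar> ^ 3 * (1 + K))"
    using main[of n] mult_nonneg_nonneg[OF \<gamma>0 norm_ge_zero[of "D n"]] by linarith
  also have "\<dots> \<le> \<gamma> * L + n * (\<bar>\<theta>\<bar> ^ 3 * (L / (2 * (1 - \<rho>)) + (1 + K)))"
    unfolding eq using D0 \<gamma>0 by (simp add: mult_left_mono)
  finally show ?thesis unfolding \<phi>_def a_def L_def \<gamma>_def by simp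
qed

text \<open>With \<theta> = s / sqrt n the two error terms of \<open>char_partial_sum_bound\<close>
  become O(1/n) and O(1/sqrt n), and the comparison term is (1 - s^2 \<tau> / (2n))^n. As \<theta>
  varies with n, \<open>orth\<close> and \<open>contr\<close> are assumed for every
  frequency.\<close>

lemma char_normalized_sum_tendsto:
  fixes X :: "nat \<Rightarrow> 'a \<Rightarrow> real" and \<tau> \<rho> K :: real
  assumes [measurable]: "\<And>k. X k \<in> borel_measurable M"
    and int4: "\<And>k. integrable M (\<lambda>\<omega>. X k \<omega> ^ 4)"
    and K: "\<And>k. expectation (\<lambda>\<omega>. X k \<omega> ^ 4) \<le> K"
    and \<rho>: "0 \<le> \<rho>" "\<rho> < 1" and \<tau>: "0 \<le> \<tau>"
    and orth: "\<And>s k. (CLINT \<omega>|M. iexp (s * (\<Sum>j<k. X j \<omega>)) * X k \<omega>) = 0"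
    and contr: "\<And>s k. (CLINT \<omega>|M. iexp (s * (\<Sum>j<k. X j \<omega>)) * ((X (Suc k) \<omega>)\<^sup>2 - \<tau>))
                  = \<rho> * (CLINT \<omega>|M. iexp (s * (\<Sum>j<k. X j \<omega>)) * ((X k \<omega>)\<^sup>2 - \<tau>))"
  shows "(\<lambda>n. CLINT \<omega>|M. iexp (s * ((\<Sum>j<n. X j \<omega>) / sqrt n))) \<longlonglongrightarrow> exp (- (s\<^sup>2 * \<tau> / 2))"
proof -
  define L where "L = 1 + 2 * K + \<tau> * (1 + K)"
  define C where "C = L / (2 * (1 - \<rho>)) + (1 + K)"
  define b where "b n = s\<^sup>2 / (2 * (1 - \<rho>)) * L * (1 / real n) + \<bar>s\<bar> ^ 3 * C * (1 / sqrt (real n))" for n :: nat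
  have lim_b: "b \<longlonglongrightarrow> 0"
  proof -
    have "b \<longlonglongrightarrow> s\<^sup>2 / (2 * (1 - \<rho>)) * L * 0 + \<bar>s\<bar> ^ 3 * C * 0"
      unfolding b_def
      by (intro tendsto_add tendsto_mult tendsto_const lim_1_over_n
           real_tendsto_divide_at_top[OF tendsto_const] filterlim_compose[OF sqrt_at_top] filterlim_real_sequentially)
    then show ?thesis by simp
  qed
  \<comment> \<open>For these n the condition \<open>\<theta>\<^sup>2 * \<tau> \<le> 2\<close>
    holds, which keeps the base of the n-th power in [0, 1].\<close>
  have "eventually (\<lambda>n::nat. s\<^sup>2 * \<tau> / 2 \<le> real n) sequentially"
    using filterlim_real_sequentially unfolding filterlim_at_top by blast
  then have "eventually (\<lambda>n. cmod ((CLINT \<omega>|M. iexp (s * ((\<Sum>j<n. X j \<omega>) / sqrt n)))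
      - (1 + (- (s\<^sup>2 * \<tau> / 2)) / n) ^ n) \<le> b n) sequentially"
    using eventually_gt_at_top[of 0]
  proof eventually_elim
    case (elim n)
    define \<theta> where "\<theta> = s / sqrt n"
    have \<theta>2: "\<theta>\<^sup>2 = s\<^sup>2 / n" using elim by (simp add: \<theta>_def power_divide)
    have arg: "s * ((\<Sum>j<n. X j \<omega>) / sqrt n) = \<theta> * (\<Sum>j<n. X j \<omega>)" for \<omega> by (simp add: \<theta>_def)
    have "cmod ((CLINT \<omega>|M. iexp (\<theta> * (\<Sum>j<n. X j \<omega>))) - (1 - \<theta>\<^sup>2 * \<tau> / 2) ^ n)
        \<le> \<theta>\<^sup>2 / (2 * (1 - \<rho>)) * (1 + 2 * K + \<tau> * (1 + K))
        + n * (\<bar>\<theta>\<bar> ^ 3 * ((1 + 2 * K + \<tau> * (1 + K)) / (2 * (1 - \<rho>)) + (1 + K)))"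
      using elim by (intro char_partial_sum_bound assms) (auto simp: \<theta>2 field_simps)
    also have "\<dots> = b n"
    proof -
      have "real n * \<bar>\<theta>\<bar> ^ 3 = \<bar>s\<bar> ^ 3 * (1 / sqrt n)"
        using elim by (simp add: \<theta>_def power_divide power3_eq_cube field_simps abs_mult)
      then show ?thesis by (simp add: b_def C_def L_def \<theta>2 mult.assoc[symmetric])
    qed
    finally have *: "cmod ((CLINT \<omega>|M. iexp (\<theta> * (\<Sum>j<n. X j \<omega>))) - (1 - \<theta>\<^sup>2 * \<tau> / 2) ^ n) \<le> b n" .
    have a: "1 - \<theta>\<^sup>2 * \<tau> / 2 = 1 + (- (s\<^sup>2 * \<tau> / 2)) / n" by (simp add: \<theta>2)
    show ?case using * unfolding arg a .
  qed
  then have "(\<lambda>n. (CLINT \<omega>|M. iexp (s * ((\<Sum>j<n. X j \<omega>) / sqrt n)))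
      - complex_of_real ((1 + (- (s\<^sup>2 * \<tau> / 2)) / n) ^ n)) \<longlonglongrightarrow> 0"
    by (intro Lim_null_comparison[OF _ lim_b]) simp
  moreover have "(\<lambda>n. complex_of_real ((1 + (- (s\<^sup>2 * \<tau> / 2)) / n) ^ n)) \<longlonglongrightarrow> complex_of_real (exp (- (s\<^sup>2 * \<tau> / 2)))"
    by (intro tendsto_of_real tendsto_exp_limit_sequentially)
  ultimately have "(\<lambda>n. (CLINT \<omega>|M. iexp (s * ((\<Sum>j<n. X j \<omega>) / sqrt n)))
      - complex_of_real ((1 + (- (s\<^sup>2 * \<tau> / 2)) / n) ^ n) + complex_of_real ((1 + (- (s\<^sup>2 * \<tau> / 2)) / n) ^ n))
       \<longlonglongrightarrow> 0 + complex_of_real (exp (- (s\<^sup>2 * \<tau> / 2)))"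
    by (rule tendsto_add)
  then show ?thesis by simp
qed

end

section \<open>Gaussian characteristic function and a Slutsky argument\<close>

lemma prob_space_normal_density_char:
  assumes "0 < s"
  shows "real_distribution (density lborel (normal_density 0 s))"
    and "char (density lborel (normal_density 0 s)) t = complex_of_real (exp (- (t\<^sup>2 * s\<^sup>2 / 2)))"
proof -
  interpret N: prob_space "density lborel (normal_density 0 s)" by (rule prob_space_normal_density[OF assms])
  show "real_distribution (density lborel (normal_density 0 s))" by unfold_locales simp_all
  interpret S: prob_space "density lborel std_normal_density" by (rule prob_space_normal_density) simp
  have "distributed (density lborel std_normal_density) lborel (\<lambda>x. x) std_normal_density"
    unfolding distributed_def by (auto simp: distr_id2)
  from S.normal_density_affine[OF this, of s 0] assms
  have "distributed (density lborel std_normal_density) lborel (\<lambda>x. s * x) (normal_density 0 s)" by simp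
  then have eq: "density lborel (normal_density 0 s) = distr (density lborel std_normal_density) lborel (\<lambda>x. s * x)"
    unfolding distributed_def by simp
  have "char (density lborel (normal_density 0 s)) t = char std_normal_distribution (t * s)"
    unfolding eq char_def by (subst integral_distr) (auto simp: mult.assoc)
  then show "char (density lborel (normal_density 0 s)) t = complex_of_real (exp (- (t\<^sup>2 * s\<^sup>2 / 2)))"
    by (simp add: char_std_normal_distribution power_mult_distrib)
qed

text \<open>Slutsky's theorem on the level of characteristic functions: iexp(t Y) and iexp(t Z)
  differ by at most |t| |Y - Z| and always by at most 2, so closeness in probability carries the
  limit over, and Levy continuity concludes.\<close>

lemma (in prob_space) weak_conv_normal_if_close:
  fixes Y Z :: "nat \<Rightarrow> 'a \<Rightarrow> real"
  assumes [measurable]: "\<And>n. Y n \<in> borel_measurable M" "\<And>n. Z n \<in> borel_measurable M"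
    and s: "0 < s"
    and char: "\<And>t. (\<lambda>n. CLINT \<omega>|M. iexp (t * Z n \<omega>)) \<longlonglongrightarrow> complex_of_real (exp (- (t\<^sup>2 * s\<^sup>2 / 2)))"
    and close: "\<And>e. 0 < e \<Longrightarrow> (\<lambda>n. prob {\<omega> \<in> space M. e < \<bar>Y n \<omega> - Z n \<omega>\<bar>}) \<longlonglongrightarrow> 0"
  shows "weak_conv_m (\<lambda>n. distr M borel (Y n)) (density lborel (normal_density 0 s))"
proof (rule levy_continuity)
  show "real_distribution (distr M borel (Y n))" for n
    by (intro real_distribution_distr) simp
  show "real_distribution (density lborel (normal_density 0 s))" by (rule prob_space_normal_density_char[OF s])
  fix t
  have int: "integrable M (\<lambda>\<omega>. iexp (t * U \<omega>))" if [measurable]: "U \<in> borel_measurable M" for U :: "'a \<Rightarrow> real"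
    by (intro integrable_iexp) auto
  have "(\<lambda>n. (CLINT \<omega>|M. iexp (t * Y n \<omega>)) - (CLINT \<omega>|M. iexp (t * Z n \<omega>))) \<longlonglongrightarrow> 0"
  proof (rule LIMSEQ_I)
    fix r :: real assume r: "0 < r"
    \<comment> \<open>Chosen so that |t| e is at most r/2, with \<open>1 +\<close> covering t = 0;
      the exceptional event of probability below r/4 contributes the other half through the bound
      2.\<close>
    define e where "e = r / (2 * (1 + \<bar>t\<bar>))"
    have e: "0 < e" "\<bar>t\<bar> * e \<le> r / 2" using r by (auto simp: e_def field_simps)
    from LIMSEQ_D[OF close[OF e(1)], of "r / 4"] r obtain N
      where N: "\<And>n. N \<le> n \<Longrightarrow> prob {\<omega> \<in> space M. e < \<bar>Y n \<omega> - Z n \<omega>\<bar>} < r / 4"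
      by auto
    have "cmod ((CLINT \<omega>|M. iexp (t * Y n \<omega>)) - (CLINT \<omega>|M. iexp (t * Z n \<omega>))) < r" if "N \<le> n" for n
    proof -
      let ?A = "{\<omega> \<in> space M. e < \<bar>Y n \<omega> - Z n \<omega>\<bar>}"
      have "(CLINT \<omega>|M. iexp (t * Y n \<omega>)) - (CLINT \<omega>|M. iexp (t * Z n \<omega>)) =
          (CLINT \<omega>|M. iexp (t * Y n \<omega>) - iexp (t * Z n \<omega>))"
        by (rule Bochner_Integration.integral_diff[symmetric]) (rule int, measurable)+
      also have "cmod \<dots> \<le> (\<integral>\<omega>. r / 2 + 2 * indicator ?A \<omega> \<partial>M)"
      proof (rule norm_integral_le_integral)
        fix \<omega> assume \<omega>: "\<omega> \<in> space M"
        have n1: "cmod (iexp x) = 1" for x by (simp only: norm_exp_i_times)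
        have "iexp (t * Y n \<omega>) - iexp (t * Z n \<omega>) = iexp (t * Z n \<omega>) * (iexp (t * (Y n \<omega> - Z n \<omega>)) - 1)"
          by (simp add: algebra_simps exp_add[symmetric])
        then have "cmod (iexp (t * Y n \<omega>) - iexp (t * Z n \<omega>)) = cmod (iexp (t * (Y n \<omega> - Z n \<omega>)) - 1)"
          by (simp only: norm_mult n1 mult_1_left)
        then have 1: "cmod (iexp (t * Y n \<omega>) - iexp (t * Z n \<omega>)) \<le> \<bar>t\<bar> * \<bar>Y n \<omega> - Z n \<omega>\<bar>"
          using iexp_approx_first_order[of "t * (Y n \<omega> - Z n \<omega>)"] by (simp only: abs_mult)
        have 2: "cmod (iexp (t * Y n \<omega>) - iexp (t * Z n \<omega>)) \<le> 2"
          using norm_triangle_ineq4[of "iexp (t * Y n \<omega>)" "iexp (t * Z n \<omega>)"] by (simp only: n1 one_add_one)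
        show "cmod (iexp (t * Y n \<omega>) - iexp (t * Z n \<omega>)) \<le> r / 2 + 2 * indicator ?A \<omega>"
        proof (cases "\<omega> \<in> ?A")
          case True then show ?thesis using 2 r by simp
        next
          case False
          then have "\<bar>t\<bar> * \<bar>Y n \<omega> - Z n \<omega>\<bar> \<le> \<bar>t\<bar> * e" using \<omega> by (intro mult_left_mono) auto
          then show ?thesis using 1 e False by simp
        qed
      qed (auto simp: emeasure_eq_measure)
      also have "\<dots> = r / 2 + 2 * prob ?A"
        by (subst Bochner_Integration.integral_add) (auto simp: prob_space emeasure_eq_measure)
      also have "\<dots> < r" using N[OF that] by simp
      finally show ?thesis .
    qed
    then show "\<exists>no. \<forall>n\<ge>no. norm ((CLINT \<omega>|M. iexp (t * Y n \<omega>)) - (CLINT \<omega>|M. iexp (t * Z n \<omega>)) - 0) < r"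
      by auto
  qed
  from tendsto_add[OF this char[of t]]
  have "(\<lambda>n. CLINT \<omega>|M. iexp (t * Y n \<omega>)) \<longlonglongrightarrow> complex_of_real (exp (- (t\<^sup>2 * s\<^sup>2 / 2)))" by simp
  moreover have "char (distr M borel (Y n)) t = (CLINT \<omega>|M. iexp (t * Y n \<omega>))" for n
    unfolding char_def by (subst integral_distr) auto
  ultimately show "(\<lambda>n. char (distr M borel (Y n)) t) \<longlonglongrightarrow> char (density lborel (normal_density 0 s)) t"
    using prob_space_normal_density_char(2)[OF s] by simp
qed

section \<open>Autoregressive random functions\<close>

text \<open>Two rounds of the arithmetic-geometric inequality. This is the domination that makes
  products of two inner products integrable from fourth moments alone.\<close>

lemma abs_mult4_le_pow4: "\<bar>a * b * (c * d)\<bar> \<le> a ^ 4 + b ^ 4 + c ^ 4 + (d::real) ^ 4"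
proof -
  have 1: "2 * \<bar>x * y\<bar> \<le> x ^ 2 + y ^ 2" for x y :: real
    using sum_squares_bound[of "\<bar>x\<bar>" "\<bar>y\<bar>"] by (simp add: abs_mult)
  have 2: "2 * (x * y) ^ 2 \<le> x ^ 4 + y ^ 4" for x y :: real
    using 1[of "x ^ 2" "y ^ 2"] by (simp add: power_mult_distrib abs_mult flip: power_mult)
  show ?thesis
    using 1[of "a * b" "c * d"] 2[of a b] 2[of c d]
    by (smt (verit) zero_le_even_power even_numeral)
qed

lemma (in prob_space) square_expectation_le:
  fixes Z :: "'a \<Rightarrow> real"
  assumes Z: "integrable M Z" "integrable M (\<lambda>x. (Z x)\<^sup>2)"
  shows "(expectation Z)\<^sup>2 \<le> expectation (\<lambda>x. (Z x)\<^sup>2)"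
  using variance_eq[OF Z] variance_positive[of Z] by simp

text \<open>A jointly measurable process integrated over its parameter need not be measurable for the
  \<open>\<sigma>\<close>-algebra of the coordinates, only almost surely so: the conditional expectation is a version.\<close>

lemma (in prob_space) parametric_integral_measurable_version:
  fixes H :: "'a \<Rightarrow> 'b \<Rightarrow> real"
  assumes sub: "subalgebra M F" and "sigma_finite_measure \<mu>"
    and H: "integrable (M \<Otimes>\<^sub>M \<mu>) (\<lambda>(\<omega>, u). H \<omega> u)"
    and HF: "\<And>u. u \<in> space \<mu> \<Longrightarrow> (\<lambda>\<omega>. H \<omega> u) \<in> borel_measurable F"
  shows "\<exists>Y\<in>borel_measurable F. AE \<omega> in M. (\<integral>u. H \<omega> u \<partial>\<mu>) = Y \<omega>"
proof -
  interpret U: sigma_finite_measure \<mu> by fact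
  interpret MU: pair_sigma_finite M \<mu> by unfold_locales
  interpret F: finite_measure_subalgebra M F by unfold_locales fact
  define Z where "Z \<omega> = (\<integral>u. H \<omega> u \<partial>\<mu>)" for \<omega>
  define Y where "Y = real_cond_exp M F Z"
  have [measurable]: "(\<lambda>(\<omega>, u). H \<omega> u) \<in> borel_measurable (M \<Otimes>\<^sub>M \<mu>)" using H by auto
  have Zint: "integrable M Z" using MU.integrable_fst'[OF H] by (simp add: Z_def[abs_def])
  have [measurable]: "Z \<in> borel_measurable M" using Zint by auto
  have Yint: "integrable M Y" unfolding Y_def by (rule F.real_cond_exp_int(1)[OF Zint])
  have YF[measurable]: "Y \<in> borel_measurable F" unfolding Y_def by simp
  have [measurable]: "Y \<in> borel_measurable M" using Yint by auto
  \<comment> \<open>Tested against this sign, Z - Y gives its absolute value, so it is enough that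
    E(B Z) = E(B Y).\<close>
  define B where "B \<omega> = sgn (Z \<omega> - Y \<omega>)" for \<omega>
  have [measurable]: "B \<in> borel_measurable M" unfolding B_def by measurable
  have Bb: "\<bar>B \<omega>\<bar> \<le> 1" for \<omega> by (simp add: B_def sgn_real_def)
  have Bint: "integrable M B" by (rule integrable_const_bound[of _ 1]) (auto simp: Bb)
  define B' where "B' = real_cond_exp M F B"
  have B'F[measurable]: "B' \<in> borel_measurable F" unfolding B'_def by simp
  have [measurable]: "B' \<in> borel_measurable M" using measurable_from_subalg[OF sub B'F] .
  have B'b: "AE \<omega> in M. \<bar>B' \<omega>\<bar> \<le> 1"
  proof -
    have "AE \<omega> in M. B' \<omega> \<le> 1" unfolding B'_def
      by (rule F.real_cond_exp_le_c[OF Bint]) (use Bb in \<open>auto simp: abs_le_iff\<close>)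
    moreover have "AE \<omega> in M. B' \<omega> \<ge> -1" unfolding B'_def
      by (rule F.real_cond_exp_ge_c[OF Bint]) (use Bb in \<open>auto simp: abs_le_iff minus_le_iff\<close>)
    ultimately show ?thesis by eventually_elim auto
  qed
  have bmul: "integrable M (\<lambda>\<omega>. C \<omega> * X \<omega>)"
    if "C \<in> borel_measurable M" "AE \<omega> in M. \<bar>C \<omega>\<bar> \<le> 1" "integrable M X" for C X :: "'a \<Rightarrow> real"
    by (rule Bochner_Integration.integrable_bound[OF that(3)])
      (use that in \<open>auto elim!: eventually_mono simp: abs_mult intro!: mult_left_le_one_le\<close>)
  have joint: "integrable (M \<Otimes>\<^sub>M \<mu>) (\<lambda>(\<omega>, u). C \<omega> * H \<omega> u)"
    if [measurable]: "C \<in> borel_measurable M" and "AE \<omega> in M. \<bar>C \<omega>\<bar> \<le> 1" for C :: "'a \<Rightarrow> real"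
  proof (rule Bochner_Integration.integrable_bound[OF H])
    have "AE x in M \<Otimes>\<^sub>M \<mu>. \<bar>C (fst x)\<bar> \<le> 1"
      using that(2) by (intro MU.AE_pair_measure) (auto elim: eventually_mono)
    then show "AE x in M \<Otimes>\<^sub>M \<mu>. norm (case x of (\<omega>, u) \<Rightarrow> C \<omega> * H \<omega> u) \<le> norm (case x of (\<omega>, u) \<Rightarrow> H \<omega> u)"
      by eventually_elim (auto simp: abs_mult split: prod.splits intro!: mult_left_le_one_le)
  qed measurable
  have swap: "expectation (\<lambda>\<omega>. C \<omega> * Z \<omega>) = (\<integral>u. expectation (\<lambda>\<omega>. C \<omega> * H \<omega> u) \<partial>\<mu>)"
    if "C \<in> borel_measurable M" and "AE \<omega> in M. \<bar>C \<omega>\<bar> \<le> 1" for C :: "'a \<Rightarrow> real"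
    using MU.Fubini_integral[OF joint[OF that]] by (simp add: Z_def)
  have "expectation (\<lambda>\<omega>. B \<omega> * Z \<omega>) = (\<integral>u. expectation (\<lambda>\<omega>. B \<omega> * H \<omega> u) \<partial>\<mu>)"
    by (rule swap) (auto simp: Bb)
  \<comment> \<open>For fixed u the slice of H is F-measurable, so B may be replaced by its
    conditional expectation B'. Fubini then returns to Z; B' being F-measurable, Z may be replaced
    by Y, and finally B' by B because Y is F-measurable.\<close>
  also have "\<dots> = (\<integral>u. expectation (\<lambda>\<omega>. B' \<omega> * H \<omega> u) \<partial>\<mu>)"
  proof (rule integral_cong_AE)
    show "AE u in \<mu>. expectation (\<lambda>\<omega>. B \<omega> * H \<omega> u) = expectation (\<lambda>\<omega>. B' \<omega> * H \<omega> u)"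
      using MU.AE_integrable_snd[OF H] AE_space
    proof eventually_elim
      case (elim u)
      have "integrable M (\<lambda>\<omega>. H \<omega> u * B \<omega>)" using bmul[of B "\<lambda>\<omega>. H \<omega> u"] elim Bb by (simp add: mult.commute)
      from F.real_cond_exp_intg(2)[OF this HF] elim(2)
      have "expectation (\<lambda>\<omega>. H \<omega> u * B' \<omega>) = expectation (\<lambda>\<omega>. H \<omega> u * B \<omega>)"
        unfolding B'_def by simp
      then show ?case by (simp add: mult.commute)
    qed
  qed measurable
  also have "\<dots> = expectation (\<lambda>\<omega>. B' \<omega> * Z \<omega>)" by (rule swap[symmetric]) (use B'b in auto)
  also have "\<dots> = expectation (\<lambda>\<omega>. B' \<omega> * Y \<omega>)"
    unfolding Y_def by (rule F.real_cond_exp_intg(2)[symmetric]) (use bmul B'b Zint in auto)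
  also have "\<dots> = expectation (\<lambda>\<omega>. Y \<omega> * B' \<omega>)" by (simp add: mult.commute)
  also have "\<dots> = expectation (\<lambda>\<omega>. Y \<omega> * B \<omega>)"
    unfolding B'_def using bmul[of B Y] Yint Bb
    by (intro F.real_cond_exp_intg(2)) (auto simp: mult.commute)
  finally have "expectation (\<lambda>\<omega>. B \<omega> * Z \<omega>) - expectation (\<lambda>\<omega>. B \<omega> * Y \<omega>) = 0" by (simp add: mult.commute)
  then have "expectation (\<lambda>\<omega>. B \<omega> * Z \<omega> - B \<omega> * Y \<omega>) = 0"
    using bmul[of B Y] bmul[of B Z] Yint Zint Bb by (subst Bochner_Integration.integral_diff) auto
  moreover have "B \<omega> * Z \<omega> - B \<omega> * Y \<omega> = \<bar>Z \<omega> - Y \<omega>\<bar>" for \<omega>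
    by (auto simp: B_def sgn_real_def)
  ultimately have "expectation (\<lambda>\<omega>. \<bar>Z \<omega> - Y \<omega>\<bar>) = 0" by simp
  then have "AE \<omega> in M. \<bar>Z \<omega> - Y \<omega>\<bar> = 0"
    using Zint Yint by (subst (asm) integral_nonneg_eq_0_iff_AE) auto
  then have "AE \<omega> in M. Z \<omega> = Y \<omega>" by eventually_elim auto
  then show ?thesis using YF unfolding Z_def by auto
qed

section \<open>The functional autoregression and its filtration\<close>

locale functional_ar1 = prob_space M + U: prob_space \<mu> for M :: "'a measure" and \<mu> :: "'b measure" +
  fixes \<epsilon> :: "int \<Rightarrow> 'a \<Rightarrow> 'b \<Rightarrow> real" and \<beta> :: real
  assumes eps_joint: "\<And>t. (\<lambda>(\<omega>, u). \<epsilon> t \<omega> u) \<in> borel_measurable (M \<Otimes>\<^sub>M \<mu>)"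
    and eps_indep: "indep_vars (\<lambda>_. Pi\<^sub>M UNIV (\<lambda>_. borel)) \<epsilon> UNIV"
    and eps_ident: "\<And>t. distr M (Pi\<^sub>M UNIV (\<lambda>_. borel)) (\<epsilon> t) = distr M (Pi\<^sub>M UNIV (\<lambda>_. borel)) (\<epsilon> 0)"
    and eps_mean: "AE u in \<mu>. \<forall>t. expectation (\<lambda>\<omega>. \<epsilon> t \<omega> u) = 0"
    and eps_pow4: "(\<integral>\<^sup>+u. (\<integral>\<^sup>+\<omega>. ennreal (\<epsilon> 0 \<omega> u ^ 4) \<partial>M) \<partial>\<mu>) < \<infinity>"
    and beta: "\<bar>\<beta>\<bar> < 1"
begin

sublocale MU: pair_prob_space M \<mu> ..
sublocale UU: pair_prob_space \<mu> \<mu> ..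
sublocale MUU: pair_prob_space M "\<mu> \<Otimes>\<^sub>M \<mu>" ..

lemma eps_measurable2[measurable (raw)]:
  "f \<in> measurable N M \<Longrightarrow> g \<in> measurable N \<mu> \<Longrightarrow> (\<lambda>x. \<epsilon> t (f x) (g x)) \<in> borel_measurable N"
  using measurable_compose[OF measurable_Pair[of f N M g \<mu>] eps_joint[of t]] by simp

definition V :: "int \<Rightarrow> 'a \<Rightarrow> 'b \<Rightarrow> real" where
  "V t \<omega> u = (\<Sum>i. \<beta> ^ i * \<epsilon> (t - int i) \<omega> u)"

lemma V_measurable2[measurable (raw)]:
  "f \<in> measurable N M \<Longrightarrow> g \<in> measurable N \<mu> \<Longrightarrow> (\<lambda>x. V t (f x) (g x)) \<in> borel_measurable N"
  unfolding V_def by measurable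

definition ip :: "('b \<Rightarrow> real) \<Rightarrow> ('b \<Rightarrow> real) \<Rightarrow> real" where
  "ip g h = (\<integral>u. g u * h u \<partial>\<mu>)"

text \<open>Generated by the single values \<open>\<epsilon> s \<omega> u\<close> with s at most k,
  without completion. An integral over u, such as an inner product, need not be measurable here,
  which is why versions appear later.\<close>

definition past :: "int \<Rightarrow> 'a measure" where
  "past k = vimage_algebra (space M) (\<lambda>\<omega>. restrict (\<lambda>s. \<epsilon> s \<omega>) {..k}) (Pi\<^sub>M {..k} (\<lambda>_. Pi\<^sub>M UNIV (\<lambda>_. borel)))"

lemma eps_random: "\<epsilon> t \<in> measurable M (Pi\<^sub>M UNIV (\<lambda>_. borel))"
  using eps_indep by (auto simp: indep_vars_def)

lemma restrict_eps_measurable: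
  "(\<lambda>\<omega>. restrict (\<lambda>s. \<epsilon> s \<omega>) {..k}) \<in> measurable M (Pi\<^sub>M {..k} (\<lambda>_. Pi\<^sub>M UNIV (\<lambda>_. borel)))"
  using eps_random by (intro measurable_restrict) auto

lemma subalgebra_past: "subalgebra M (past k)"
  unfolding subalgebra_def past_def
  by (auto intro: sets_image_in_sets[OF refl restrict_eps_measurable, THEN subsetD])

lemma space_past[simp]: "space (past k) = space M"
  by (simp add: past_def)

lemma eps_past: "s \<le> k \<Longrightarrow> (\<lambda>\<omega>. \<epsilon> s \<omega> u) \<in> borel_measurable (past k)"
proof -
  assume s: "s \<le> k"
  have 1: "(\<lambda>\<omega>. restrict (\<lambda>s. \<epsilon> s \<omega>) {..k}) \<in> measurable (past k) (Pi\<^sub>M {..k} (\<lambda>_. Pi\<^sub>M UNIV (\<lambda>_. borel)))"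
    unfolding past_def
    by (rule measurable_vimage_algebra1) (use measurable_space[OF restrict_eps_measurable] in auto)
  have 2: "(\<lambda>x. x s) \<in> measurable (Pi\<^sub>M {..k} (\<lambda>_. Pi\<^sub>M UNIV (\<lambda>_. borel))) (Pi\<^sub>M UNIV (\<lambda>_. borel :: real measure))"
    using s by (intro measurable_component_singleton) auto
  have 3: "(\<lambda>x. x u) \<in> measurable (Pi\<^sub>M UNIV (\<lambda>_. borel)) (borel :: real measure)"
    by (rule measurable_component_singleton) auto
  from measurable_compose[OF measurable_compose[OF 1 2] 3] s show ?thesis by simp
qed

lemma V_past: "s \<le> k \<Longrightarrow> (\<lambda>\<omega>. V s \<omega> u) \<in> borel_measurable (past k)"
  unfolding V_def using eps_past
  by (intro borel_measurable_suminf borel_measurable_times) auto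

lemma past_mono: "k \<le> l \<Longrightarrow> W \<in> borel_measurable (past k) \<Longrightarrow> W \<in> borel_measurable (past l)"
proof -
  assume kl: "k \<le> l" and W: "W \<in> borel_measurable (past k)"
  have 1: "(\<lambda>\<omega>. restrict (\<lambda>s. \<epsilon> s \<omega>) {..l}) \<in> measurable (past l) (Pi\<^sub>M {..l} (\<lambda>_. Pi\<^sub>M UNIV (\<lambda>_. borel)))"
    unfolding past_def
    by (rule measurable_vimage_algebra1) (use measurable_space[OF restrict_eps_measurable] in auto)
  have 2: "(\<lambda>x. restrict x {..k}) \<in> measurable (Pi\<^sub>M {..l} (\<lambda>_. Pi\<^sub>M UNIV (\<lambda>_. borel))) (Pi\<^sub>M {..k} (\<lambda>_. Pi\<^sub>M UNIV (\<lambda>_. borel :: real measure)))"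
    using kl by (intro measurable_restrict_subset) auto
  have "(\<lambda>\<omega>. restrict (\<lambda>s. \<epsilon> s \<omega>) {..k}) \<in> measurable (past l) (Pi\<^sub>M {..k} (\<lambda>_. Pi\<^sub>M UNIV (\<lambda>_. borel)))"
    using measurable_compose[OF 1 2] kl by (simp add: min_absorb2)
  then have "sets (past k) \<subseteq> sets (past l)"
    unfolding past_def[of k] by (intro sets_image_in_sets) auto
  then have "subalgebra (past l) (past k)" by (simp add: subalgebra_def)
  then show ?thesis using W by (rule measurable_from_subalg)
qed

text \<open>The index sets \<open>{..k}\<close> and \<open>{j}\<close> are disjoint, so the
  corresponding blocks of the family are independent, and W and g only generate smaller
  sigma-algebras. The functional g is later a coordinate, a product of two coordinates or a fourth
  power of one.\<close>

lemma past_indep: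
  fixes W :: "'a \<Rightarrow> real" and g :: "('b \<Rightarrow> real) \<Rightarrow> real"
  assumes W: "W \<in> borel_measurable (past k)" and kj: "k < j" and g: "g \<in> borel_measurable (Pi\<^sub>M UNIV (\<lambda>_. borel))"
  shows "indep_var borel W borel (\<lambda>\<omega>. g (\<epsilon> j \<omega>))"
proof -
  let ?N = "\<lambda>_::int. Pi\<^sub>M UNIV (\<lambda>_. borel :: real measure)"
  have ind: "indep_var (Pi\<^sub>M {..k} ?N) (\<lambda>\<omega>. restrict (\<lambda>s. \<epsilon> s \<omega>) {..k}) (Pi\<^sub>M {j} ?N) (\<lambda>\<omega>. restrict (\<lambda>s. \<epsilon> s \<omega>) {j})"
    using eps_indep kj by (intro indep_var_restrict[where I=UNIV]) auto
  let ?A = "{(\<lambda>\<omega>. restrict (\<lambda>s. \<epsilon> s \<omega>) {..k}) -` A \<inter> space M |A. A \<in> sets (Pi\<^sub>M {..k} ?N)}"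
  let ?B = "{(\<lambda>\<omega>. restrict (\<lambda>s. \<epsilon> s \<omega>) {j}) -` A \<inter> space M |A. A \<in> sets (Pi\<^sub>M {j} ?N)}"
  have gj: "(\<lambda>x. g (x j)) \<in> measurable (Pi\<^sub>M {j} ?N) borel"
    by (rule measurable_compose[OF _ g]) (rule measurable_component_singleton, simp)
  have WM: "W \<in> borel_measurable M" by (rule measurable_from_subalg[OF subalgebra_past W])
  have gM: "(\<lambda>\<omega>. g (\<epsilon> j \<omega>)) \<in> borel_measurable M" by (rule measurable_compose[OF eps_random g])
  have A: "sigma_sets (space M) {W -` A \<inter> space M |A. A \<in> sets borel} \<subseteq> sigma_sets (space M) ?A"
  proof (rule sigma_sets_mono, safe)
    fix A :: "real set" assume "A \<in> sets borel"
    then have "W -` A \<inter> space M \<in> sets (past k)" using measurable_sets[OF W] by simp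
    then show "W -` A \<inter> space M \<in> sigma_sets (space M) ?A"
      unfolding past_def sets_vimage_algebra .
  qed
  have B: "sigma_sets (space M) {(\<lambda>\<omega>. g (\<epsilon> j \<omega>)) -` A \<inter> space M |A. A \<in> sets borel} \<subseteq> sigma_sets (space M) ?B"
  proof (rule sigma_sets_mono, safe)
    fix A :: "real set" assume A: "A \<in> sets borel"
    have eq: "(\<lambda>\<omega>. g (\<epsilon> j \<omega>)) -` A \<inter> space M =
        (\<lambda>\<omega>. restrict (\<lambda>s. \<epsilon> s \<omega>) {j}) -` ((\<lambda>x. g (x j)) -` A \<inter> space (Pi\<^sub>M {j} ?N)) \<inter> space M"
      using measurable_space[OF eps_random[of j]] by (auto simp: space_PiM)
    show "(\<lambda>\<omega>. g (\<epsilon> j \<omega>)) -` A \<inter> space M \<in> sigma_sets (space M) ?B"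
      unfolding eq using measurable_sets[OF gj A] by (intro sigma_sets.Basic) blast
  qed
  have ind': "indep_set (sigma_sets (space M) ?A) (sigma_sets (space M) ?B)"
    using ind unfolding indep_var_eq by blast
  have "indep_set (sigma_sets (space M) {W -` A \<inter> space M |A. A \<in> sets borel})
      (sigma_sets (space M) {(\<lambda>\<omega>. g (\<epsilon> j \<omega>)) -` A \<inter> space M |A. A \<in> sets borel})"
    unfolding indep_set_def
  proof (rule indep_sets_mono_sets[OF ind'[unfolded indep_set_def]])
    fix i :: bool
    show "case_bool (sigma_sets (space M) {W -` A \<inter> space M |A. A \<in> sets borel})
        (sigma_sets (space M) {(\<lambda>\<omega>. g (\<epsilon> j \<omega>)) -` A \<inter> space M |A. A \<in> sets borel}) i
       \<subseteq> case_bool (sigma_sets (space M) ?A) (sigma_sets (space M) ?B) i"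
      by (cases i) (simp_all only: bool.case A B)
  qed
  then show ?thesis unfolding indep_var_eq using WM gM by blast
qed

definition cov :: "'b \<Rightarrow> 'b \<Rightarrow> real" where
  "cov u v = expectation (\<lambda>\<omega>. \<epsilon> 0 \<omega> u * \<epsilon> 0 \<omega> v)"

lemma coordinate_measurable[measurable]: "(\<lambda>x. x u) \<in> borel_measurable (Pi\<^sub>M UNIV (\<lambda>_. borel :: real measure))"
  by (rule measurable_component_singleton) auto

lemma expectation_ident:
  assumes g: "g \<in> borel_measurable (Pi\<^sub>M UNIV (\<lambda>_. borel))"
  shows "expectation (\<lambda>\<omega>. g (\<epsilon> t \<omega>) :: real) = expectation (\<lambda>\<omega>. g (\<epsilon> 0 \<omega>))"
  using integral_distr[OF eps_random[of t] g] integral_distr[OF eps_random[of 0] g] eps_ident[of t] by simp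

lemma nn_integral_ident:
  assumes g: "g \<in> borel_measurable (Pi\<^sub>M UNIV (\<lambda>_. borel))"
  shows "(\<integral>\<^sup>+\<omega>. g (\<epsilon> t \<omega>) \<partial>M) = (\<integral>\<^sup>+\<omega>. g (\<epsilon> 0 \<omega>) \<partial>M)"
  using nn_integral_distr[OF eps_random[of t], of g] nn_integral_distr[OF eps_random[of 0], of g] eps_ident[of t] g by simp

lemma cov_eq: "expectation (\<lambda>\<omega>. \<epsilon> t \<omega> u * \<epsilon> t \<omega> v) = cov u v"
  unfolding cov_def by (rule expectation_ident) measurable

section \<open>Fourth moments of the innovations and of the stationary solution\<close>

definition L4 :: "('a \<Rightarrow> 'b \<Rightarrow> real) \<Rightarrow> bool" where
  "L4 H \<longleftrightarrow> (\<lambda>(\<omega>, u). H \<omega> u) \<in> borel_measurable (M \<Otimes>\<^sub>M \<mu>) \<and> integrable (M \<Otimes>\<^sub>M \<mu>) (\<lambda>(\<omega>, u). H \<omega> u ^ 4)"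

definition m4 :: real where "m4 = enn2real (\<integral>\<^sup>+u. (\<integral>\<^sup>+\<omega>. ennreal (\<epsilon> 0 \<omega> u ^ 4) \<partial>M) \<partial>\<mu>)"

lemma m4_nonneg: "0 \<le> m4" by (simp add: m4_def)

lemma nn_integral_eps_pow4: "(\<integral>\<^sup>+x. ennreal (\<epsilon> t (fst x) (snd x) ^ 4) \<partial>(M \<Otimes>\<^sub>M \<mu>)) = ennreal m4"
proof -
  have "(\<integral>\<^sup>+x. ennreal (\<epsilon> t (fst x) (snd x) ^ 4) \<partial>(M \<Otimes>\<^sub>M \<mu>)) = (\<integral>\<^sup>+u. (\<integral>\<^sup>+\<omega>. ennreal (\<epsilon> t \<omega> u ^ 4) \<partial>M) \<partial>\<mu>)"
    by (subst MU.nn_integral_snd[symmetric]) auto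
  also have "\<dots> = (\<integral>\<^sup>+u. (\<integral>\<^sup>+\<omega>. ennreal (\<epsilon> 0 \<omega> u ^ 4) \<partial>M) \<partial>\<mu>)"
    by (intro nn_integral_cong nn_integral_ident) measurable
  finally show ?thesis using eps_pow4 by (simp add: m4_def)
qed

lemma L4_eps: "L4 (\<epsilon> t)"
  unfolding L4_def
proof
  show "integrable (M \<Otimes>\<^sub>M \<mu>) (\<lambda>(\<omega>, u). \<epsilon> t \<omega> u ^ 4)"
    by (rule integrableI_bounded) (use nn_integral_eps_pow4[of t] in \<open>auto simp: split_beta'\<close>)
qed (rule eps_joint)

lemma integral_eps_pow4: "(\<integral>x. \<epsilon> t (fst x) (snd x) ^ 4 \<partial>(M \<Otimes>\<^sub>M \<mu>)) = m4"
  using nn_integral_eps_pow4[of t] m4_nonneg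
  by (subst integral_eq_nn_integral) auto

lemma L4_const: "L4 (\<lambda>_ _. c)"
  by (auto simp: L4_def split_beta')

text \<open>Induction by peeling off the first term: |e_0| + b A is the convex combination of |e_0|
  / (1 - b) and A with weights 1 - b and b. Convexity of the fourth power turns the first part into
  (1 - b) (|e_0| / (1 - b))^4, whence the factor (1 - b)^(-3).\<close>

lemma geometric_jensen_pow4:
  fixes e :: "nat \<Rightarrow> real" and b :: real
  assumes b: "0 \<le> b" "b < 1"
  shows "(\<Sum>i<m. b ^ i * \<bar>e i\<bar>) ^ 4 \<le> (\<Sum>i<m. b ^ i * e i ^ 4) / (1 - b) ^ 3"
proof (induction m arbitrary: e)
  case (Suc m)
  define A where "A = (\<Sum>i<m. b ^ i * \<bar>e (Suc i)\<bar>)"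
  have "convex_on UNIV (\<lambda>x::real. x ^ 4)" by (rule convex_power_even) simp
  from convex_onD[OF this, of b "\<bar>e 0\<bar> / (1 - b)" A]
  have h1: "((1 - b) * (\<bar>e 0\<bar> / (1 - b)) + b * A) ^ 4 \<le> (1 - b) * (\<bar>e 0\<bar> / (1 - b)) ^ 4 + b * A ^ 4"
    using b by simp
  have h2: "(1 - b) * (\<bar>e 0\<bar> / (1 - b)) = \<bar>e 0\<bar>" using b by simp
  have h3: "(1 - b) * (\<bar>e 0\<bar> / (1 - b)) ^ 4 = e 0 ^ 4 / (1 - b) ^ 3"
  proof -
    have "d * (x / d) ^ 4 = x ^ 4 / d ^ 3" if "d \<noteq> 0" for d x :: real
      using that by (simp add: power_divide power4_eq_xxxx power3_eq_cube field_simps)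
    from this[of "1 - b" "\<bar>e 0\<bar>"] show ?thesis using b by simp
  qed
  have h4: "b * A ^ 4 \<le> b * ((\<Sum>i<m. b ^ i * e (Suc i) ^ 4) / (1 - b) ^ 3)"
    unfolding A_def using b Suc[of "\<lambda>i. e (Suc i)"] by (intro mult_left_mono) auto
  have "(\<bar>e 0\<bar> + b * A) ^ 4 \<le> e 0 ^ 4 / (1 - b) ^ 3 + b * ((\<Sum>i<m. b ^ i * e (Suc i) ^ 4) / (1 - b) ^ 3)"
    using h1 h4 unfolding h2 h3 by linarith
  then show ?case
    unfolding sum.lessThan_Suc_shift A_def
    by (simp add: sum_distrib_left mult.assoc add_divide_distrib sum_divide_distrib)
qed simp

text \<open>Bound for the fourth moment of V: three powers of 1 / (1 - |\<beta>|) come from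
  \<open>geometric_jensen_pow4\<close>, the fourth from summing the geometric weights.\<close>

definition KV :: real where "KV = m4 / (1 - \<bar>\<beta>\<bar>) ^ 4"

lemma KV_nonneg: "0 \<le> KV" using beta m4_nonneg by (simp add: KV_def)

lemma nn_integral_geometric_pow4:
  "(\<integral>\<^sup>+x. (\<Sum>i. ennreal (\<bar>\<beta>\<bar> ^ i * \<epsilon> (t - int i) (fst x) (snd x) ^ 4)) \<partial>(M \<Otimes>\<^sub>M \<mu>)) = ennreal (m4 / (1 - \<bar>\<beta>\<bar>))"
proof -
  have "(\<integral>\<^sup>+x. (\<Sum>i. ennreal (\<bar>\<beta>\<bar> ^ i * \<epsilon> (t - int i) (fst x) (snd x) ^ 4)) \<partial>(M \<Otimes>\<^sub>M \<mu>))
     = (\<Sum>i. \<integral>\<^sup>+x. ennreal (\<bar>\<beta>\<bar> ^ i) * ennreal (\<epsilon> (t - int i) (fst x) (snd x) ^ 4) \<partial>(M \<Otimes>\<^sub>M \<mu>))"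
    by (subst nn_integral_suminf) (auto simp: ennreal_mult)
  also have "\<dots> = (\<Sum>i. ennreal (\<bar>\<beta>\<bar> ^ i * m4))"
    by (subst nn_integral_cmult) (auto simp: nn_integral_eps_pow4 ennreal_mult m4_nonneg)
  also have "\<dots> = ennreal (\<Sum>i. \<bar>\<beta>\<bar> ^ i * m4)"
    using beta m4_nonneg by (intro suminf_ennreal2 summable_mult2 summable_geometric) auto
  also have "(\<Sum>i. \<bar>\<beta>\<bar> ^ i * m4) = m4 / (1 - \<bar>\<beta>\<bar>)"
    using beta by (subst suminf_mult2[symmetric]) (auto simp: suminf_geometric)
  finally show ?thesis .
qed

lemma AE_summable_pow4:
  "AE x in M \<Otimes>\<^sub>M \<mu>. \<forall>t. summable (\<lambda>i. \<bar>\<beta>\<bar> ^ i * \<epsilon> (t - int i) (fst x) (snd x) ^ 4)"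
proof (subst AE_all_countable, intro allI)
  fix t
  have "AE x in M \<Otimes>\<^sub>M \<mu>. (\<Sum>i. ennreal (\<bar>\<beta>\<bar> ^ i * \<epsilon> (t - int i) (fst x) (snd x) ^ 4)) \<noteq> \<infinity>"
    by (rule nn_integral_noteq_infinite) (auto simp: nn_integral_geometric_pow4)
  then show "AE x in M \<Otimes>\<^sub>M \<mu>. summable (\<lambda>i. \<bar>\<beta>\<bar> ^ i * \<epsilon> (t - int i) (fst x) (snd x) ^ 4)"
    by eventually_elim (auto intro!: summable_suminf_not_top)
qed

text \<open>Since |e| is at most 1 + e^4, the weighted series is dominated by a geometric series
  plus the given one.\<close>

lemma summable_if_summable_pow4:
  assumes "summable (\<lambda>i. \<bar>\<beta>\<bar> ^ i * e i ^ 4)"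
  shows "summable (\<lambda>i. \<beta> ^ i * e i)" "summable (\<lambda>i. \<bar>\<beta>\<bar> ^ i * \<bar>e i\<bar>)"
proof -
  have s: "summable (\<lambda>i. \<bar>\<beta>\<bar> ^ i + \<bar>\<beta>\<bar> ^ i * e i ^ 4)"
    using beta assms by (intro summable_add summable_geometric) auto
  have le: "\<bar>\<beta>\<bar> ^ i * \<bar>e i\<bar> \<le> \<bar>\<beta>\<bar> ^ i + \<bar>\<beta>\<bar> ^ i * e i ^ 4" for i
    using mult_left_mono[OF abs_le_one_plus_pow4[of "e i"], of "\<bar>\<beta>\<bar> ^ i"] by (simp add: distrib_left)
  show "summable (\<lambda>i. \<bar>\<beta>\<bar> ^ i * \<bar>e i\<bar>)"
    by (rule summable_comparison_test'[OF s, of 0]) (use le in \<open>auto simp: abs_mult\<close>)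
  then show "summable (\<lambda>i. \<beta> ^ i * e i)"
    by (intro summable_rabs_cancel[of "\<lambda>i. \<beta> ^ i * e i"]) (simp add: abs_mult power_abs)
qed

text \<open>The term i = 0 is split off from the series. This holds only almost everywhere, because
  \<open>suminf\<close> of a divergent series is a mere default value.\<close>

lemma AE_V_rec: "AE x in M \<Otimes>\<^sub>M \<mu>. \<forall>t. V t (fst x) (snd x) = \<beta> * V (t - 1) (fst x) (snd x) + \<epsilon> t (fst x) (snd x)"
  using AE_summable_pow4
proof eventually_elim
  case (elim x)
  show ?case
  proof
    fix t
    have s: "summable (\<lambda>i. \<beta> ^ i * \<epsilon> (t - int i) (fst x) (snd x))" for t
      using summable_if_summable_pow4(1)[OF elim[rule_format]] .
    have "V t (fst x) (snd x) = (\<Sum>i. \<beta> ^ Suc i * \<epsilon> (t - int (Suc i)) (fst x) (snd x)) + \<epsilon> t (fst x) (snd x)"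
      unfolding V_def using suminf_split_head[OF s[of t]] by simp
    also have "(\<Sum>i. \<beta> ^ Suc i * \<epsilon> (t - int (Suc i)) (fst x) (snd x))
       = (\<Sum>i. \<beta> * (\<beta> ^ i * \<epsilon> ((t - 1) - int i) (fst x) (snd x)))"
      by (simp add: mult.assoc diff_diff_eq)
    also have "\<dots> = \<beta> * V (t - 1) (fst x) (snd x)"
      unfolding V_def by (rule suminf_mult[OF s])
    finally show "V t (fst x) (snd x) = \<beta> * V (t - 1) (fst x) (snd x) + \<epsilon> t (fst x) (snd x)" .
  qed
qed

text \<open>The Jensen bound for a partial sum is at most the full series of weighted fourth powers,
  uniformly in the number of terms, so it survives the limit; that series integrates to m4 / (1 -
  |\<beta>|).\<close>

lemma nn_integral_V_pow4: "(\<integral>\<^sup>+x. ennreal (V t (fst x) (snd x) ^ 4) \<partial>(M \<Otimes>\<^sub>M \<mu>)) \<le> ennreal KV"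
proof -
  define c where "c = 1 / (1 - \<bar>\<beta>\<bar>) ^ 3"
  have c0: "0 \<le> c" using beta by (simp add: c_def)
  have "AE x in M \<Otimes>\<^sub>M \<mu>. ennreal (V t (fst x) (snd x) ^ 4)
     \<le> ennreal c * (\<Sum>i. ennreal (\<bar>\<beta>\<bar> ^ i * \<epsilon> (t - int i) (fst x) (snd x) ^ 4))"
    using AE_summable_pow4
  proof eventually_elim
    case (elim x)
    define e where "e i = \<epsilon> (t - int i) (fst x) (snd x)" for i
    have s4: "summable (\<lambda>i. \<bar>\<beta>\<bar> ^ i * e i ^ 4)" using elim by (simp add: e_def)
    note s = summable_if_summable_pow4[OF s4]
    have "(\<lambda>m. (\<Sum>i<m. \<beta> ^ i * e i) ^ 4) \<longlonglongrightarrow> V t (fst x) (snd x) ^ 4"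
      unfolding V_def e_def[symmetric] by (intro tendsto_power summable_LIMSEQ s)
    moreover have "(\<Sum>i<m. \<beta> ^ i * e i) ^ 4 \<le> c * (\<Sum>i. \<bar>\<beta>\<bar> ^ i * e i ^ 4)" for m
    proof -
      have "\<bar>\<Sum>i<m. \<beta> ^ i * e i\<bar> \<le> (\<Sum>i<m. \<bar>\<beta>\<bar> ^ i * \<bar>e i\<bar>)"
        by (rule order_trans[OF sum_abs]) (simp add: abs_mult power_abs)
      then have "\<bar>\<Sum>i<m. \<beta> ^ i * e i\<bar> ^ 4 \<le> (\<Sum>i<m. \<bar>\<beta>\<bar> ^ i * \<bar>e i\<bar>) ^ 4" by (intro power_mono) auto
      also have "\<dots> \<le> c * (\<Sum>i<m. \<bar>\<beta>\<bar> ^ i * e i ^ 4)"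
        using geometric_jensen_pow4[where b="\<bar>\<beta>\<bar>" and m=m and e=e] beta by (simp add: c_def)
      also have "\<dots> \<le> c * (\<Sum>i. \<bar>\<beta>\<bar> ^ i * e i ^ 4)"
        by (intro mult_left_mono sum_le_suminf s4 c0) auto
      finally show ?thesis by simp
    qed
    ultimately have "V t (fst x) (snd x) ^ 4 \<le> c * (\<Sum>i. \<bar>\<beta>\<bar> ^ i * e i ^ 4)"
      by (intro LIMSEQ_le_const2) auto
    then have "ennreal (V t (fst x) (snd x) ^ 4) \<le> ennreal (c * (\<Sum>i. \<bar>\<beta>\<bar> ^ i * e i ^ 4))"
      by (rule ennreal_leI)
    also have "\<dots> = ennreal c * (\<Sum>i. ennreal (\<bar>\<beta>\<bar> ^ i * e i ^ 4))"
      using c0 s4 by (subst suminf_ennreal2) (auto simp: ennreal_mult suminf_nonneg)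
    finally show ?case by (simp only: e_def)
  qed
  then have "(\<integral>\<^sup>+x. ennreal (V t (fst x) (snd x) ^ 4) \<partial>(M \<Otimes>\<^sub>M \<mu>))
    \<le> (\<integral>\<^sup>+x. ennreal c * (\<Sum>i. ennreal (\<bar>\<beta>\<bar> ^ i * \<epsilon> (t - int i) (fst x) (snd x) ^ 4)) \<partial>(M \<Otimes>\<^sub>M \<mu>))"
    by (rule nn_integral_mono_AE)
  also have "\<dots> = ennreal c * ennreal (m4 / (1 - \<bar>\<beta>\<bar>))"
    by (subst nn_integral_cmult) (auto simp: nn_integral_geometric_pow4)
  also have "\<dots> = ennreal KV"
  proof -
    have "c * (m4 / (1 - \<bar>\<beta>\<bar>)) = KV"
      by (simp add: c_def KV_def power4_eq_xxxx power3_eq_cube mult_ac)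
    then show ?thesis using c0 m4_nonneg beta by (subst ennreal_mult[symmetric]) auto
  qed
  finally show ?thesis .
qed

lemma L4_V: "L4 (V t)"
  unfolding L4_def
proof
  show "integrable (M \<Otimes>\<^sub>M \<mu>) (\<lambda>(\<omega>, u). V t \<omega> u ^ 4)"
    by (rule integrableI_bounded)
      (use order_le_less_trans[OF nn_integral_V_pow4[of t]] in \<open>auto simp: split_beta'\<close>)
qed measurable

lemma integral_V_pow4: "(\<integral>x. V t (fst x) (snd x) ^ 4 \<partial>(M \<Otimes>\<^sub>M \<mu>)) \<le> KV"
proof -
  have "(\<integral>x. V t (fst x) (snd x) ^ 4 \<partial>(M \<Otimes>\<^sub>M \<mu>)) = enn2real (\<integral>\<^sup>+x. ennreal (V t (fst x) (snd x) ^ 4) \<partial>(M \<Otimes>\<^sub>M \<mu>))"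
    by (subst integral_eq_nn_integral) auto
  also have "\<dots> \<le> enn2real (ennreal KV)" by (rule enn2real_mono[OF nn_integral_V_pow4]) simp
  finally show ?thesis using KV_nonneg by simp
qed

end

section \<open>Expectations of products of two inner products\<close>

lemma integrable_bounded_mult4:
  fixes G a b c d :: "'a \<Rightarrow> real"
  assumes [measurable]: "G \<in> borel_measurable N" "a \<in> borel_measurable N" "b \<in> borel_measurable N"
      "c \<in> borel_measurable N" "d \<in> borel_measurable N"
    and G: "\<And>x. x \<in> space N \<Longrightarrow> \<bar>G x\<bar> \<le> 1"
    and int: "integrable N (\<lambda>x. a x ^ 4)" "integrable N (\<lambda>x. b x ^ 4)"
      "integrable N (\<lambda>x. c x ^ 4)" "integrable N (\<lambda>x. d x ^ 4)"
  shows "integrable N (\<lambda>x. G x * (a x * b x * (c x * d x)))"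
proof (rule Bochner_Integration.integrable_bound)
  show "integrable N (\<lambda>x. a x ^ 4 + b x ^ 4 + c x ^ 4 + d x ^ 4)" using int by auto
  show "AE x in N. norm (G x * (a x * b x * (c x * d x))) \<le> norm (a x ^ 4 + b x ^ 4 + c x ^ 4 + d x ^ 4)"
  proof (rule AE_I2)
    fix x assume "x \<in> space N"
    then have "\<bar>G x\<bar> * \<bar>a x * b x * (c x * d x)\<bar> \<le> \<bar>a x * b x * (c x * d x)\<bar>"
      using G by (intro mult_left_le_one_le) auto
    then show "norm (G x * (a x * b x * (c x * d x))) \<le> norm (a x ^ 4 + b x ^ 4 + c x ^ 4 + d x ^ 4)"
      using abs_mult4_le_pow4[of "a x" "b x" "c x" "d x"] unfolding real_norm_def abs_mult[of "G x"]
      by linarith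
  qed
qed measurable

context functional_ar1
begin

lemma L4_measurable2:
  assumes "L4 H" "f \<in> measurable N M" "g \<in> measurable N \<mu>"
  shows "(\<lambda>x. H (f x) (g x)) \<in> borel_measurable N"
proof -
  have "(\<lambda>(\<omega>, u). H \<omega> u) \<in> borel_measurable (M \<Otimes>\<^sub>M \<mu>)" using assms(1) by (simp add: L4_def)
  from measurable_compose[OF measurable_Pair[OF assms(2,3)] this] show ?thesis by simp
qed

text \<open>The idle second or first copy of \<mu> has total mass 1 and integrates out. This moves
  fourth-moment bounds to the space of triples (\<omega>, u, v).\<close>

lemma nn_integral_lift:
  assumes [measurable]: "h \<in> borel_measurable (M \<Otimes>\<^sub>M \<mu>)"
  shows "(\<integral>\<^sup>+x. h (fst x, fst (snd x)) \<partial>(M \<Otimes>\<^sub>M (\<mu> \<Otimes>\<^sub>M \<mu>))) = (\<integral>\<^sup>+x. h x \<partial>(M \<Otimes>\<^sub>M \<mu>))"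
    and "(\<integral>\<^sup>+x. h (fst x, snd (snd x)) \<partial>(M \<Otimes>\<^sub>M (\<mu> \<Otimes>\<^sub>M \<mu>))) = (\<integral>\<^sup>+x. h x \<partial>(M \<Otimes>\<^sub>M \<mu>))"
proof -
  have "(\<integral>\<^sup>+x. h (fst x, fst (snd x)) \<partial>(M \<Otimes>\<^sub>M (\<mu> \<Otimes>\<^sub>M \<mu>)))
      = (\<integral>\<^sup>+\<omega>. \<integral>\<^sup>+y. h (\<omega>, fst y) \<partial>(\<mu> \<Otimes>\<^sub>M \<mu>) \<partial>M)"
    by (subst UU.P.nn_integral_fst[symmetric]) auto
  also have "\<dots> = (\<integral>\<^sup>+\<omega>. \<integral>\<^sup>+u. h (\<omega>, u) \<partial>\<mu> \<partial>M)"
    by (intro nn_integral_cong, subst U.nn_integral_fst[symmetric]) (auto simp: U.emeasure_space_1)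
  finally show "(\<integral>\<^sup>+x. h (fst x, fst (snd x)) \<partial>(M \<Otimes>\<^sub>M (\<mu> \<Otimes>\<^sub>M \<mu>))) = (\<integral>\<^sup>+x. h x \<partial>(M \<Otimes>\<^sub>M \<mu>))"
    by (simp add: U.nn_integral_fst)
  have "(\<integral>\<^sup>+x. h (fst x, snd (snd x)) \<partial>(M \<Otimes>\<^sub>M (\<mu> \<Otimes>\<^sub>M \<mu>)))
      = (\<integral>\<^sup>+\<omega>. \<integral>\<^sup>+y. h (\<omega>, snd y) \<partial>(\<mu> \<Otimes>\<^sub>M \<mu>) \<partial>M)"
    by (subst UU.P.nn_integral_fst[symmetric]) auto
  also have "\<dots> = (\<integral>\<^sup>+\<omega>. \<integral>\<^sup>+u. h (\<omega>, u) \<partial>\<mu> \<partial>M)"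
    by (intro nn_integral_cong, subst U.nn_integral_fst[symmetric]) (auto simp: U.emeasure_space_1)
  finally show "(\<integral>\<^sup>+x. h (fst x, snd (snd x)) \<partial>(M \<Otimes>\<^sub>M (\<mu> \<Otimes>\<^sub>M \<mu>))) = (\<integral>\<^sup>+x. h x \<partial>(M \<Otimes>\<^sub>M \<mu>))"
    by (simp add: U.nn_integral_fst)
qed

lemma L4_lift:
  assumes H: "L4 H"
  shows "integrable (M \<Otimes>\<^sub>M (\<mu> \<Otimes>\<^sub>M \<mu>)) (\<lambda>x. H (fst x) (fst (snd x)) ^ 4)"
    and "integrable (M \<Otimes>\<^sub>M (\<mu> \<Otimes>\<^sub>M \<mu>)) (\<lambda>x. H (fst x) (snd (snd x)) ^ 4)"
proof -
  note [measurable (raw)] = L4_measurable2[OF H]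
  have "integrable (M \<Otimes>\<^sub>M \<mu>) (\<lambda>x. H (fst x) (snd x) ^ 4)" using H by (simp add: L4_def split_beta')
  then have fin: "(\<integral>\<^sup>+x. ennreal (H (fst x) (snd x) ^ 4) \<partial>(M \<Otimes>\<^sub>M \<mu>)) < \<infinity>"
    by (subst (asm) integrable_iff_bounded) auto
  have m: "(\<lambda>x. ennreal (H (fst x) (snd x) ^ 4)) \<in> borel_measurable (M \<Otimes>\<^sub>M \<mu>)" by measurable
  show "integrable (M \<Otimes>\<^sub>M (\<mu> \<Otimes>\<^sub>M \<mu>)) (\<lambda>x. H (fst x) (fst (snd x)) ^ 4)"
    by (rule integrableI_bounded) (use nn_integral_lift(1)[OF m] fin in auto)
  show "integrable (M \<Otimes>\<^sub>M (\<mu> \<Otimes>\<^sub>M \<mu>)) (\<lambda>x. H (fst x) (snd (snd x)) ^ 4)"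
    by (rule integrableI_bounded) (use nn_integral_lift(2)[OF m] fin in auto)
qed

lemma L4_AE_integrable:
  assumes H: "L4 H"
  shows "AE u in \<mu>. integrable M (\<lambda>\<omega>. H \<omega> u ^ 4)" "AE \<omega> in M. integrable \<mu> (\<lambda>u. H \<omega> u ^ 4)"
  using MU.AE_integrable_snd[of "\<lambda>\<omega> u. H \<omega> u ^ 4"] MU.AE_integrable_fst[of "\<lambda>\<omega> u. H \<omega> u ^ 4"] H
  by (auto simp: L4_def)

lemma AE_pair_components:
  assumes "AE u in \<mu>. P u"
  shows "AE x in \<mu> \<Otimes>\<^sub>M \<mu>. P (fst x) \<and> P (snd x)"
proof -
  have "AE x in distr (\<mu> \<Otimes>\<^sub>M \<mu>) \<mu> fst. P x" using assms by (simp only: U.distr_pair_fst)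
  then have 1: "AE x in \<mu> \<Otimes>\<^sub>M \<mu>. P (fst x)" by (rule AE_distrD[OF measurable_fst])
  have snd: "distr (\<mu> \<Otimes>\<^sub>M \<mu>) \<mu> snd = \<mu>"
  proof (rule measure_eqI)
    fix A assume A: "A \<in> sets (distr (\<mu> \<Otimes>\<^sub>M \<mu>) \<mu> snd)"
    then have "emeasure (distr (\<mu> \<Otimes>\<^sub>M \<mu>) \<mu> snd) A = emeasure (\<mu> \<Otimes>\<^sub>M \<mu>) (space \<mu> \<times> A)"
      by (auto simp: emeasure_distr space_pair_measure dest: sets.sets_into_space intro!: arg_cong2[where f=emeasure])
    then show "emeasure (distr (\<mu> \<Otimes>\<^sub>M \<mu>) \<mu> snd) A = emeasure \<mu> A"
      using A by (simp add: U.emeasure_pair_measure_Times U.emeasure_space_1)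
  qed simp
  have "AE x in distr (\<mu> \<Otimes>\<^sub>M \<mu>) \<mu> snd. P x" using assms by (simp only: snd)
  then have "AE x in \<mu> \<Otimes>\<^sub>M \<mu>. P (snd x)" by (rule AE_distrD[OF measurable_snd])
  with 1 show ?thesis by eventually_elim auto
qed

lemma ip_mult_eq_pair_integral:
  assumes int: "integrable (\<mu> \<Otimes>\<^sub>M \<mu>) (\<lambda>x. g * (a (fst x) * b (fst x) * (c (snd x) * d (snd x))))"
  shows "(\<integral>x. g * (a (fst x) * b (fst x) * (c (snd x) * d (snd x))) \<partial>(\<mu> \<Otimes>\<^sub>M \<mu>)) = g * (ip a b * ip c d)"
  unfolding UU.integral_fst'[OF int, symmetric] ip_def by simp

text \<open>A product of two inner products is a single integral over
  \<open>\<mu> \<Otimes>\<^sub>M \<mu>\<close>, so Fubini can place the expectation inside. At fixed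
  (u, v) only finitely many coordinates occur, and there independence can be applied. The weight G
  stands for a bounded function of the past.\<close>

lemma
  assumes [measurable]: "G \<in> borel_measurable M" and G: "\<And>\<omega>. \<omega> \<in> space M \<Longrightarrow> \<bar>G \<omega>\<bar> \<le> 1"
    and L: "L4 a" "L4 b" "L4 c" "L4 d"
  shows integrable_ip_mult_ip: "integrable M (\<lambda>\<omega>. G \<omega> * (ip (a \<omega>) (b \<omega>) * ip (c \<omega>) (d \<omega>)))"
    and integrable_pair_expectation:
      "integrable (\<mu> \<Otimes>\<^sub>M \<mu>) (\<lambda>x. expectation (\<lambda>\<omega>. G \<omega> * (a \<omega> (fst x) * b \<omega> (fst x) * (c \<omega> (snd x) * d \<omega> (snd x)))))"
    and expectation_ip_mult_ip: "expectation (\<lambda>\<omega>. G \<omega> * (ip (a \<omega>) (b \<omega>) * ip (c \<omega>) (d \<omega>)))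
      = (\<integral>x. expectation (\<lambda>\<omega>. G \<omega> * (a \<omega> (fst x) * b \<omega> (fst x) * (c \<omega> (snd x) * d \<omega> (snd x)))) \<partial>(\<mu> \<Otimes>\<^sub>M \<mu>))"
proof -
  note [measurable (raw)] = L[THEN L4_measurable2]
  define q where "q = (\<lambda>\<omega> x. G \<omega> * (a \<omega> (fst x) * b \<omega> (fst x) * (c \<omega> (snd x) * d \<omega> (snd x))))"
  have int: "integrable (M \<Otimes>\<^sub>M (\<mu> \<Otimes>\<^sub>M \<mu>)) (\<lambda>(\<omega>, x). q \<omega> x)"
    unfolding q_def split_beta'
    by (rule integrable_bounded_mult4; (measurable; fail)?)
      (use G L[THEN L4_lift(1)] L[THEN L4_lift(2)] in \<open>simp_all add: space_pair_measure mem_Times_iff\<close>)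
  have eq: "AE \<omega> in M. (\<integral>x. q \<omega> x \<partial>(\<mu> \<Otimes>\<^sub>M \<mu>)) = G \<omega> * (ip (a \<omega>) (b \<omega>) * ip (c \<omega>) (d \<omega>))"
    using MUU.AE_integrable_fst[OF int] unfolding q_def
    by eventually_elim (rule ip_mult_eq_pair_integral)
  have m[measurable]: "(\<lambda>\<omega>. G \<omega> * (ip (a \<omega>) (b \<omega>) * ip (c \<omega>) (d \<omega>))) \<in> borel_measurable M"
    unfolding ip_def by measurable
  have i1: "integrable M (\<lambda>\<omega>. \<integral>x. q \<omega> x \<partial>(\<mu> \<Otimes>\<^sub>M \<mu>))" using MUU.integrable_fst'[OF int] by simp
  show "integrable M (\<lambda>\<omega>. G \<omega> * (ip (a \<omega>) (b \<omega>) * ip (c \<omega>) (d \<omega>)))"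
    using integrable_cong_AE_imp[OF i1 m] eq by (simp add: eq_commute)
  show "integrable (\<mu> \<Otimes>\<^sub>M \<mu>) (\<lambda>x. expectation (\<lambda>\<omega>. G \<omega> * (a \<omega> (fst x) * b \<omega> (fst x) * (c \<omega> (snd x) * d \<omega> (snd x)))))"
    using MUU.integrable_snd[OF int] by (simp add: q_def)
  have "expectation (\<lambda>\<omega>. G \<omega> * (ip (a \<omega>) (b \<omega>) * ip (c \<omega>) (d \<omega>))) = expectation (\<lambda>\<omega>. \<integral>x. q \<omega> x \<partial>(\<mu> \<Otimes>\<^sub>M \<mu>))"
    by (rule integral_cong_AE) (use eq i1 in \<open>auto elim: eventually_mono\<close>)
  also have "\<dots> = (\<integral>x. expectation (\<lambda>\<omega>. q \<omega> x) \<partial>(\<mu> \<Otimes>\<^sub>M \<mu>))" by (rule MUU.Fubini_integral[OF int, symmetric])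
  finally show "expectation (\<lambda>\<omega>. G \<omega> * (ip (a \<omega>) (b \<omega>) * ip (c \<omega>) (d \<omega>)))
      = (\<integral>x. expectation (\<lambda>\<omega>. G \<omega> * (a \<omega> (fst x) * b \<omega> (fst x) * (c \<omega> (snd x) * d \<omega> (snd x)))) \<partial>(\<mu> \<Otimes>\<^sub>M \<mu>))"
    by (simp add: q_def)
qed

text \<open>The points at which arguments over \<omega> may be run with u held fixed; the
  exceptional set of \<omega> in the recursion may depend on u.\<close>

definition good :: "'b \<Rightarrow> bool" where
  "good u \<longleftrightarrow> u \<in> space \<mu> \<and> (\<forall>t. integrable M (\<lambda>\<omega>. \<epsilon> t \<omega> u ^ 4) \<and> integrable M (\<lambda>\<omega>. V t \<omega> u ^ 4) \<and>
     expectation (\<lambda>\<omega>. \<epsilon> t \<omega> u) = 0 \<and> (AE \<omega> in M. V t \<omega> u = \<beta> * V (t - 1) \<omega> u + \<epsilon> t \<omega> u))"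

lemma AE_V_rec_swap: "AE u in \<mu>. AE \<omega> in M. \<forall>t. V t \<omega> u = \<beta> * V (t - 1) \<omega> u + \<epsilon> t \<omega> u"
proof -
  have "AE \<omega> in M. AE u in \<mu>. \<forall>t. V t \<omega> u = \<beta> * V (t - 1) \<omega> u + \<epsilon> t \<omega> u"
    using MU.AE_pair[OF AE_V_rec] by simp
  then show ?thesis by (subst MU.AE_commute[symmetric]) measurable
qed

lemma AE_good: "AE u in \<mu>. good u"
proof -
  have "AE u in \<mu>. \<forall>t. integrable M (\<lambda>\<omega>. \<epsilon> t \<omega> u ^ 4)"
    by (subst AE_all_countable) (use L4_AE_integrable(1)[OF L4_eps] in auto)
  moreover have "AE u in \<mu>. \<forall>t. integrable M (\<lambda>\<omega>. V t \<omega> u ^ 4)"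
    by (subst AE_all_countable) (use L4_AE_integrable(1)[OF L4_V] in auto)
  moreover note eps_mean AE_V_rec_swap AE_space[of \<mu>]
  ultimately show ?thesis
    by eventually_elim (auto simp: good_def elim: eventually_mono)
qed

lemma good_measurable:
  assumes "good u"
  shows "(\<lambda>\<omega>. \<epsilon> t \<omega> u) \<in> borel_measurable M" "(\<lambda>\<omega>. V t \<omega> u) \<in> borel_measurable M"
proof -
  have u: "(\<lambda>_. u) \<in> measurable M \<mu>" using assms by (simp add: good_def)
  show "(\<lambda>\<omega>. \<epsilon> t \<omega> u) \<in> borel_measurable M" by (rule eps_measurable2[OF measurable_ident_sets[OF refl] u])
  show "(\<lambda>\<omega>. V t \<omega> u) \<in> borel_measurable M" by (rule V_measurable2[OF measurable_ident_sets[OF refl] u])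
qed

lemma integrable_eps_mult:
  assumes "good u" "good v"
  shows "integrable M (\<lambda>\<omega>. \<epsilon> t \<omega> u)" "integrable M (\<lambda>\<omega>. \<epsilon> t \<omega> u * \<epsilon> t \<omega> v)"
proof -
  show "integrable M (\<lambda>\<omega>. \<epsilon> t \<omega> u)"
    by (rule integrable_lower_powers(1)[OF good_measurable(1)[OF assms(1)]]) (use assms in \<open>simp add: good_def\<close>)
  have "integrable M (\<lambda>\<omega>. 1 * (\<epsilon> t \<omega> u * \<epsilon> t \<omega> v * (1 * 1)))"
    by (rule integrable_bounded_mult4)
      (use good_measurable[OF assms(1)] good_measurable[OF assms(2)] assms in \<open>simp_all add: good_def\<close>)
  then show "integrable M (\<lambda>\<omega>. \<epsilon> t \<omega> u * \<epsilon> t \<omega> v)" by simp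
qed

lemma expectation_past_mult_eps:
  assumes W: "W \<in> borel_measurable (past k)" "integrable M W" and "k < j" and "good u"
  shows "expectation (\<lambda>\<omega>. W \<omega> * \<epsilon> j \<omega> u) = 0"
proof -
  have "indep_var borel W borel (\<lambda>\<omega>. (\<lambda>x. x u) (\<epsilon> j \<omega>))"
    by (rule past_indep[OF W(1) \<open>k < j\<close>]) measurable
  from indep_var_lebesgue_integral[OF this W(2)] integrable_eps_mult(1)[OF \<open>good u\<close> \<open>good u\<close>] \<open>good u\<close>
  show ?thesis by (simp add: good_def)
qed

lemma expectation_past_mult_eps2:
  assumes W: "W \<in> borel_measurable (past k)" "integrable M W" and "k < j" and "good u" "good v"
  shows "expectation (\<lambda>\<omega>. W \<omega> * (\<epsilon> j \<omega> u * \<epsilon> j \<omega> v)) = expectation W * cov u v"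
proof -
  have "indep_var borel W borel (\<lambda>\<omega>. (\<lambda>x. x u * x v) (\<epsilon> j \<omega>))"
    by (rule past_indep[OF W(1) \<open>k < j\<close>]) measurable
  from indep_var_lebesgue_integral[OF this W(2)] integrable_eps_mult(2)[OF \<open>good u\<close> \<open>good v\<close>]
  show ?thesis by (simp add: cov_eq)
qed

text \<open>Measurability for the past is asked coordinate by coordinate, as \<open>past\<close>
  provides it; joint measurability in (\<omega>, u) refers to M and comes with
  \<open>L4\<close>.\<close>

definition adapted :: "int \<Rightarrow> ('a \<Rightarrow> 'b \<Rightarrow> real) \<Rightarrow> bool" where
  "adapted k a \<longleftrightarrow> L4 a \<and> (\<forall>u. (\<lambda>\<omega>. a \<omega> u) \<in> borel_measurable (past k))"

lemma adapted_eps: "s \<le> k \<Longrightarrow> adapted k (\<epsilon> s)"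
  by (simp add: adapted_def L4_eps eps_past)

lemma adapted_V: "s \<le> k \<Longrightarrow> adapted k (V s)"
  by (simp add: adapted_def L4_V V_past)

lemma adapted_const: "adapted k (\<lambda>_ _. c)"
  by (simp add: adapted_def L4_const)

lemma adapted_L4: "adapted k a \<Longrightarrow> L4 a"
  by (simp add: adapted_def)

lemma past_imp_measurable: "W \<in> borel_measurable (past k) \<Longrightarrow> W \<in> borel_measurable M"
  by (rule measurable_from_subalg[OF subalgebra_past])

lemma adapted_measurable: "adapted k a \<Longrightarrow> (\<lambda>\<omega>. a \<omega> u) \<in> borel_measurable M"
  unfolding adapted_def using past_imp_measurable by blast

lemma adapted_past: "adapted k a \<Longrightarrow> (\<lambda>\<omega>. a \<omega> u) \<in> borel_measurable (past k)"
  by (simp add: adapted_def)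

lemma cov_measurable[measurable]: "(\<lambda>x. cov (fst x) (snd x)) \<in> borel_measurable (\<mu> \<Otimes>\<^sub>M \<mu>)"
  unfolding cov_def by measurable

text \<open>At almost every (u, v) the factor \<open>\<epsilon> j \<omega> u\<close> is centred and
  independent of all the other factors. This yields both the martingale property of \<open>X\<close>
  and the orthogonality of products at different times.\<close>

lemma expectation_ip_innovation:
  assumes G: "G \<in> borel_measurable (past k)" "\<And>\<omega>. \<bar>G \<omega>\<bar> \<le> 1"
    and A: "adapted k a" "adapted k c" "adapted k d" and kj: "k < j"
  shows "expectation (\<lambda>\<omega>. G \<omega> * (ip (a \<omega>) (\<epsilon> j \<omega>) * ip (c \<omega>) (d \<omega>))) = 0"
proof -
  note [measurable] = past_imp_measurable[OF G(1)]
  note L = A[THEN adapted_L4]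
  note [measurable (raw)] = L[THEN L4_measurable2]
  have "AE x in \<mu> \<Otimes>\<^sub>M \<mu>. expectation (\<lambda>\<omega>. G \<omega> * (a \<omega> (fst x) * \<epsilon> j \<omega> (fst x) * (c \<omega> (snd x) * d \<omega> (snd x)))) = 0"
    using AE_pair_components[OF AE_good] AE_pair_components[OF L4_AE_integrable(1)[OF L(1)]]
      AE_pair_components[OF L4_AE_integrable(1)[OF L(2)]] AE_pair_components[OF L4_AE_integrable(1)[OF L(3)]]
  proof eventually_elim
    case (elim x)
    define W where "W \<omega> = G \<omega> * (a \<omega> (fst x) * 1 * (c \<omega> (snd x) * d \<omega> (snd x)))" for \<omega>
    have "integrable M W" unfolding W_def
      by (rule integrable_bounded_mult4) (use elim G adapted_measurable[OF A(1)] adapted_measurable[OF A(2)] adapted_measurable[OF A(3)] in simp_all)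
    moreover have "W \<in> borel_measurable (past k)" unfolding W_def
      by (intro borel_measurable_times borel_measurable_const G(1) A[THEN adapted_past])
    ultimately have "expectation (\<lambda>\<omega>. W \<omega> * \<epsilon> j \<omega> (fst x)) = 0"
      using elim kj by (intro expectation_past_mult_eps) auto
    then show ?case by (simp add: W_def mult_ac)
  qed
  then have "(\<integral>x. expectation (\<lambda>\<omega>. G \<omega> * (a \<omega> (fst x) * \<epsilon> j \<omega> (fst x) * (c \<omega> (snd x) * d \<omega> (snd x)))) \<partial>(\<mu> \<Otimes>\<^sub>M \<mu>)) = (\<integral>x. 0 \<partial>(\<mu> \<Otimes>\<^sub>M \<mu>))"
    by (intro integral_cong_AE) auto
  then show ?thesis
    using G L L4_eps by (subst expectation_ip_mult_ip) auto
qed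

text \<open>Both inner products contain the same innovation, whose two coordinates average to
  \<open>cov\<close>. With a = c this is the formula for the conditional second moment as a
  quadratic form with kernel \<open>cov\<close>, tested against G.\<close>

lemma
  assumes G: "G \<in> borel_measurable (past k)" "\<And>\<omega>. \<bar>G \<omega>\<bar> \<le> 1"
    and A: "adapted k a" "adapted k c" and kj: "k < j"
  shows expectation_ip_innovation2: "expectation (\<lambda>\<omega>. G \<omega> * (ip (a \<omega>) (\<epsilon> j \<omega>) * ip (c \<omega>) (\<epsilon> j \<omega>)))
      = (\<integral>x. expectation (\<lambda>\<omega>. G \<omega> * (a \<omega> (fst x) * c \<omega> (snd x))) * cov (fst x) (snd x) \<partial>(\<mu> \<Otimes>\<^sub>M \<mu>))"
    and integrable_ip_innovation2:
      "integrable (\<mu> \<Otimes>\<^sub>M \<mu>) (\<lambda>x. expectation (\<lambda>\<omega>. G \<omega> * (a \<omega> (fst x) * c \<omega> (snd x))) * cov (fst x) (snd x))"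
proof -
  note [measurable] = past_imp_measurable[OF G(1)]
  note L = A[THEN adapted_L4]
  note [measurable (raw)] = L[THEN L4_measurable2]
  have eq: "AE x in \<mu> \<Otimes>\<^sub>M \<mu>. expectation (\<lambda>\<omega>. G \<omega> * (a \<omega> (fst x) * \<epsilon> j \<omega> (fst x) * (c \<omega> (snd x) * \<epsilon> j \<omega> (snd x))))
      = expectation (\<lambda>\<omega>. G \<omega> * (a \<omega> (fst x) * c \<omega> (snd x))) * cov (fst x) (snd x)"
    using AE_pair_components[OF AE_good] AE_pair_components[OF L4_AE_integrable(1)[OF L(1)]]
      AE_pair_components[OF L4_AE_integrable(1)[OF L(2)]]
  proof eventually_elim
    case (elim x)
    define W where "W \<omega> = G \<omega> * (a \<omega> (fst x) * c \<omega> (snd x) * (1 * 1))" for \<omega>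
    have "integrable M W" unfolding W_def
      by (rule integrable_bounded_mult4) (use elim G adapted_measurable[OF A(1)] adapted_measurable[OF A(2)] in simp_all)
    moreover have "W \<in> borel_measurable (past k)" unfolding W_def
      by (intro borel_measurable_times borel_measurable_const G(1) A[THEN adapted_past])
    ultimately have "expectation (\<lambda>\<omega>. W \<omega> * (\<epsilon> j \<omega> (fst x) * \<epsilon> j \<omega> (snd x))) = expectation W * cov (fst x) (snd x)"
      using elim kj by (intro expectation_past_mult_eps2) auto
    then show ?case by (simp add: W_def[abs_def] mult_ac)
  qed
  have G': "G \<in> borel_measurable M" "\<And>\<omega>. \<omega> \<in> space M \<Longrightarrow> \<bar>G \<omega>\<bar> \<le> 1" using G by auto
  show "integrable (\<mu> \<Otimes>\<^sub>M \<mu>) (\<lambda>x. expectation (\<lambda>\<omega>. G \<omega> * (a \<omega> (fst x) * c \<omega> (snd x))) * cov (fst x) (snd x))"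
    by (rule integrable_cong_AE_imp[OF integrable_pair_expectation[OF G' L(1) L4_eps L(2) L4_eps]])
      (use eq in \<open>auto elim: eventually_mono\<close>)
  show "expectation (\<lambda>\<omega>. G \<omega> * (ip (a \<omega>) (\<epsilon> j \<omega>) * ip (c \<omega>) (\<epsilon> j \<omega>)))
      = (\<integral>x. expectation (\<lambda>\<omega>. G \<omega> * (a \<omega> (fst x) * c \<omega> (snd x))) * cov (fst x) (snd x) \<partial>(\<mu> \<Otimes>\<^sub>M \<mu>))"
    by (rule trans[OF expectation_ip_mult_ip[OF G' L(1) L4_eps L(2) L4_eps] integral_cong_AE]) (use eq in auto)
qed

text \<open>The squared Hilbert-Schmidt norm of the covariance operator on L^2(\<mu>).\<close>

definition C2 :: real where "C2 = (\<integral>x. (cov (fst x) (snd x))\<^sup>2 \<partial>(\<mu> \<Otimes>\<^sub>M \<mu>))"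

text \<open>For G = 1, a = c = \<open>\<epsilon> 0\<close> and j = 1 the integrand of
  \<open>integrable_ip_innovation2\<close> is the square of \<open>cov\<close>. This is the
  finiteness of the numerator of the limit variance.\<close>

lemma integrable_cov_square: "integrable (\<mu> \<Otimes>\<^sub>M \<mu>) (\<lambda>x. (cov (fst x) (snd x))\<^sup>2)"
  using integrable_ip_innovation2[of "\<lambda>_. 1" 0 "\<epsilon> 0" "\<epsilon> 0" 1]
  by (simp add: adapted_eps cov_eq power2_eq_square)

section \<open>The martingale differences and their conditional variance\<close>

definition X :: "int \<Rightarrow> 'a \<Rightarrow> real" where "X t \<omega> = ip (V (t - 1) \<omega>) (\<epsilon> t \<omega>)"

lemma X_measurable[measurable]: "X t \<in> borel_measurable M"
  unfolding X_def ip_def by measurable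

lemma ip_one[simp]: "ip (\<lambda>_. 1) (\<lambda>_. 1) = 1"
  by (simp add: ip_def U.prob_space)

text \<open>The single inner product is put into the two-factor form by \<open>ip 1 1 = 1\<close>,
  valid as \<mu> has mass 1.\<close>

lemma expectation_past_mult_X:
  assumes "G \<in> borel_measurable (past k)" "\<And>\<omega>. \<bar>G \<omega>\<bar> \<le> 1"
  shows "expectation (\<lambda>\<omega>. G \<omega> * X (k + 1) \<omega>) = 0"
  using expectation_ip_innovation[OF assms adapted_V[of k] adapted_const[of k 1] adapted_const[of k 1], of "k + 1"]
  by (simp add: X_def)

text \<open>Inserting V_(k+1) = \<beta> V_k + \<epsilon>_(k+1) into the quadratic form for
  \<open>X (k + 2)\<close> gives \<beta>^2 times the form for \<open>X (k + 1)\<close>; the mixed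
  terms vanish because \<epsilon>_(k+1) is centred given the past k, and its own square reproduces
  \<open>cov\<close>, hence C2. The limiting variance is the fixed point C2 / (1 - \<beta>^2) of
  this affine recursion.\<close>

lemma expectation_past_mult_X_square:
  assumes G: "G \<in> borel_measurable (past k)" "\<And>\<omega>. \<bar>G \<omega>\<bar> \<le> 1"
  shows "expectation (\<lambda>\<omega>. G \<omega> * (X (k + 2) \<omega>)\<^sup>2) = \<beta>\<^sup>2 * expectation (\<lambda>\<omega>. G \<omega> * (X (k + 1) \<omega>)\<^sup>2) + expectation G * C2"
proof -
  \<comment> \<open>Integrand over (u, v) of E(G X_(s+1)^2), to be compared for s = k and s = k + 1.
    For s = k + 1 the weight G is regarded as a function of the larger past.\<close>
  define R where "R s x = expectation (\<lambda>\<omega>. G \<omega> * (V s \<omega> (fst x) * V s \<omega> (snd x))) * cov (fst x) (snd x)" for s x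
  have G1: "G \<in> borel_measurable (past (k + 1))" using past_mono[OF _ G(1)] by simp
  note [measurable] = past_imp_measurable[OF G(1)]
  have E2: "expectation (\<lambda>\<omega>. G \<omega> * (X (k + 2) \<omega>)\<^sup>2) = (\<integral>x. R (k + 1) x \<partial>(\<mu> \<Otimes>\<^sub>M \<mu>))"
    using expectation_ip_innovation2[OF G1 G(2) adapted_V[of "k + 1"] adapted_V[of "k + 1"], of "k + 2"]
    by (simp add: X_def power2_eq_square R_def add.commute[of 1 k])
  have E1: "expectation (\<lambda>\<omega>. G \<omega> * (X (k + 1) \<omega>)\<^sup>2) = (\<integral>x. R k x \<partial>(\<mu> \<Otimes>\<^sub>M \<mu>))"
    using expectation_ip_innovation2[OF G adapted_V[of k] adapted_V[of k], of "k + 1"]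
    by (simp add: X_def power2_eq_square R_def)
  have R: "integrable (\<mu> \<Otimes>\<^sub>M \<mu>) (R k)" unfolding R_def
    by (rule integrable_ip_innovation2[OF G adapted_V[of k] adapted_V[of k], of "k + 1"]) auto
  have "AE x in \<mu> \<Otimes>\<^sub>M \<mu>. R (k + 1) x = \<beta>\<^sup>2 * R k x + expectation G * (cov (fst x) (snd x))\<^sup>2"
    using AE_pair_components[OF AE_good]
  proof eventually_elim
    case (elim x)
    define u v where uv: "u = fst x" "v = snd x"
    then have g: "good u" "good v" using elim by auto
    note gm[measurable] = good_measurable[OF g(1)] good_measurable[OF g(2)]
    have prod: "integrable M (\<lambda>\<omega>. G \<omega> * (p \<omega> * q \<omega>))"
      if "p \<in> borel_measurable M" "q \<in> borel_measurable M" "integrable M (\<lambda>\<omega>. p \<omega> ^ 4)" "integrable M (\<lambda>\<omega>. q \<omega> ^ 4)" for p q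
      using integrable_bounded_mult4[of G M p q "\<lambda>_. 1" "\<lambda>_. 1"] that G(2) by auto
    have single: "integrable M (\<lambda>\<omega>. G \<omega> * p \<omega>)"
      if "p \<in> borel_measurable M" "integrable M (\<lambda>\<omega>. p \<omega> ^ 4)" for p
      using prod[of p "\<lambda>_. 1"] that by auto
    have iG: "integrable M G" using single[of "\<lambda>_. 1"] by auto
    have VV: "integrable M (\<lambda>\<omega>. G \<omega> * (V k \<omega> u * V k \<omega> v))"
      and Ve: "integrable M (\<lambda>\<omega>. G \<omega> * (V k \<omega> u * \<epsilon> (k + 1) \<omega> v))"
      and eV: "integrable M (\<lambda>\<omega>. G \<omega> * (V k \<omega> v * \<epsilon> (k + 1) \<omega> u))"
      and ee: "integrable M (\<lambda>\<omega>. G \<omega> * (\<epsilon> (k + 1) \<omega> u * \<epsilon> (k + 1) \<omega> v))"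
      by (rule prod; use g in \<open>auto simp: good_def\<close>)+
    have Ve0: "expectation (\<lambda>\<omega>. G \<omega> * (V k \<omega> u * \<epsilon> (k + 1) \<omega> v)) = 0"
      using expectation_past_mult_eps[of "\<lambda>\<omega>. G \<omega> * V k \<omega> u" k "k + 1" v] G V_past[of k k u] g single[of "\<lambda>\<omega>. V k \<omega> u"]
      by (simp add: mult.assoc good_def)
    have eV0: "expectation (\<lambda>\<omega>. G \<omega> * (V k \<omega> v * \<epsilon> (k + 1) \<omega> u)) = 0"
      using expectation_past_mult_eps[of "\<lambda>\<omega>. G \<omega> * V k \<omega> v" k "k + 1" u] G V_past[of k k v] g single[of "\<lambda>\<omega>. V k \<omega> v"]
      by (simp add: mult.assoc good_def)
    have ee0: "expectation (\<lambda>\<omega>. G \<omega> * (\<epsilon> (k + 1) \<omega> u * \<epsilon> (k + 1) \<omega> v)) = expectation G * cov u v"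
      using expectation_past_mult_eps2[OF G(1) iG _ g, of "k + 1"] by simp
    have "AE \<omega> in M. G \<omega> * (V (k + 1) \<omega> u * V (k + 1) \<omega> v) =
        \<beta>\<^sup>2 * (G \<omega> * (V k \<omega> u * V k \<omega> v)) + \<beta> * (G \<omega> * (V k \<omega> u * \<epsilon> (k + 1) \<omega> v))
        + \<beta> * (G \<omega> * (V k \<omega> v * \<epsilon> (k + 1) \<omega> u)) + G \<omega> * (\<epsilon> (k + 1) \<omega> u * \<epsilon> (k + 1) \<omega> v)"
    proof -
      have "AE \<omega> in M. V (k + 1) \<omega> u = \<beta> * V k \<omega> u + \<epsilon> (k + 1) \<omega> u" "AE \<omega> in M. V (k + 1) \<omega> v = \<beta> * V k \<omega> v + \<epsilon> (k + 1) \<omega> v"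
        using g by (auto simp: good_def dest!: spec[of _ "k + 1"])
      then show ?thesis by eventually_elim (simp add: algebra_simps power2_eq_square)
    qed
    then have "expectation (\<lambda>\<omega>. G \<omega> * (V (k + 1) \<omega> u * V (k + 1) \<omega> v)) =
      expectation (\<lambda>\<omega>. \<beta>\<^sup>2 * (G \<omega> * (V k \<omega> u * V k \<omega> v)) + \<beta> * (G \<omega> * (V k \<omega> u * \<epsilon> (k + 1) \<omega> v))
        + \<beta> * (G \<omega> * (V k \<omega> v * \<epsilon> (k + 1) \<omega> u)) + G \<omega> * (\<epsilon> (k + 1) \<omega> u * \<epsilon> (k + 1) \<omega> v))"
      by (intro integral_cong_AE) auto
    also have "\<dots> = \<beta>\<^sup>2 * expectation (\<lambda>\<omega>. G \<omega> * (V k \<omega> u * V k \<omega> v)) + expectation G * cov u v"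
      using VV Ve eV ee by (simp add: Ve0 eV0 ee0)
    finally show ?case unfolding R_def uv[symmetric] by (simp add: algebra_simps power2_eq_square)
  qed
  then have "(\<integral>x. R (k + 1) x \<partial>(\<mu> \<Otimes>\<^sub>M \<mu>)) = (\<integral>x. \<beta>\<^sup>2 * R k x + expectation G * (cov (fst x) (snd x))\<^sup>2 \<partial>(\<mu> \<Otimes>\<^sub>M \<mu>))"
    by (intro integral_cong_AE) (auto simp: R_def)
  also have "\<dots> = \<beta>\<^sup>2 * (\<integral>x. R k x \<partial>(\<mu> \<Otimes>\<^sub>M \<mu>)) + expectation G * C2"
    using R integrable_cov_square by (simp add: C2_def)
  finally show ?thesis unfolding E1 E2 .
qed

lemma X_version: "\<exists>Y\<in>borel_measurable (past t). AE \<omega> in M. X t \<omega> = Y \<omega>"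
  unfolding X_def ip_def
proof (rule parametric_integral_measurable_version[OF subalgebra_past U.sigma_finite_measure])
  have "integrable (M \<Otimes>\<^sub>M \<mu>) (\<lambda>x. 1 * (V (t - 1) (fst x) (snd x) * \<epsilon> t (fst x) (snd x) * (1 * 1)))"
    by (rule integrable_bounded_mult4) (use L4_V L4_eps in \<open>simp_all add: L4_def split_beta'\<close>)
  then show "integrable (M \<Otimes>\<^sub>M \<mu>) (\<lambda>(\<omega>, u). V (t - 1) \<omega> u * \<epsilon> t \<omega> u)" by (simp add: split_beta')
  show "(\<lambda>\<omega>. V (t - 1) \<omega> u * \<epsilon> t \<omega> u) \<in> borel_measurable (past t)" for u
    using V_past[of "t - 1" t u] eps_past[of t t u] by measurable
qed

end

text \<open>Cauchy-Schwarz, from the nonnegativity of the integral of (f - l g)^2 as a quadratic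
  polynomial in l.\<close>

lemma square_integral_mult_le:
  fixes f g :: "'a \<Rightarrow> real"
  assumes [measurable]: "f \<in> borel_measurable N" "g \<in> borel_measurable N"
    and f: "integrable N (\<lambda>x. (f x)\<^sup>2)" and g: "integrable N (\<lambda>x. (g x)\<^sup>2)"
  shows "integrable N (\<lambda>x. f x * g x)"
    and "(\<integral>x. f x * g x \<partial>N)\<^sup>2 \<le> (\<integral>x. (f x)\<^sup>2 \<partial>N) * (\<integral>x. (g x)\<^sup>2 \<partial>N)"
proof -
  show fg: "integrable N (\<lambda>x. f x * g x)"
  proof (rule Bochner_Integration.integrable_bound[of N "\<lambda>x. (f x)\<^sup>2 + (g x)\<^sup>2"])
    show "AE x in N. norm (f x * g x) \<le> norm ((f x)\<^sup>2 + (g x)\<^sup>2)"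
    proof (rule AE_I2)
      fix x
      have "2 * \<bar>f x * g x\<bar> \<le> (f x)\<^sup>2 + (g x)\<^sup>2"
        using sum_squares_bound[of "\<bar>f x\<bar>" "\<bar>g x\<bar>"] by (simp add: abs_mult)
      then show "norm (f x * g x) \<le> norm ((f x)\<^sup>2 + (g x)\<^sup>2)" unfolding real_norm_def by linarith
    qed
  qed (use f g in auto)
  define A B C where "A = (\<integral>x. (f x)\<^sup>2 \<partial>N)" and "B = (\<integral>x. (g x)\<^sup>2 \<partial>N)" and "C = (\<integral>x. f x * g x \<partial>N)"
  have key: "0 \<le> A - 2 * l * C + l\<^sup>2 * B" for l
  proof -
    have "0 \<le> (\<integral>x. (f x - l * g x)\<^sup>2 \<partial>N)" by simp
    also have "\<dots> = (\<integral>x. (f x)\<^sup>2 - 2 * l * (f x * g x) + l\<^sup>2 * (g x)\<^sup>2 \<partial>N)"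
      by (intro Bochner_Integration.integral_cong) (auto simp: power2_eq_square algebra_simps)
    also have "\<dots> = A - 2 * l * C + l\<^sup>2 * B" using f g fg by (simp add: A_def B_def C_def)
    finally show ?thesis .
  qed
  have "C\<^sup>2 \<le> A * B"
  proof (cases "B = 0")
    case True
    have "C = 0"
    proof (rule ccontr)
      assume "C \<noteq> 0"
      \<comment> \<open>With B = 0 the polynomial is affine in l; this choice of l gives it the
        value -1.\<close>
      then show False using key[of "(A + 1) / (2 * C)"] True by simp
    qed
    then show ?thesis using True by simp
  next
    case False
    moreover have "0 \<le> B" by (simp add: B_def)
    ultimately have B: "0 < B" by simp
    have "0 \<le> B * (A - 2 * (C / B) * C + (C / B)\<^sup>2 * B)" using key[of "C / B"] B by (intro mult_nonneg_nonneg) auto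
    also have "\<dots> = A * B - C\<^sup>2" using B by (simp add: power2_eq_square field_simps)
    finally show ?thesis by simp
  qed
  then show "(\<integral>x. f x * g x \<partial>N)\<^sup>2 \<le> (\<integral>x. (f x)\<^sup>2 \<partial>N) * (\<integral>x. (g x)\<^sup>2 \<partial>N)"
    by (simp add: A_def B_def C_def)
qed

text \<open>Here \<open>x\<close> and \<open>e\<close> are \<open>V\<close> and \<open>\<epsilon>\<close> at a fixed point, and \<open>q\<close> dominates all remainder terms; its integral
  has bounded expectation, so the remainders vanish after division by \<open>sqrt n\<close>.\<close>

locale scalar_ar1 =
  fixes x e :: "nat \<Rightarrow> real" and b :: real and m n :: nat and xb S q c :: real
  assumes rec: "\<And>j. x (Suc j) = b * x j + e j" and b: "\<bar>b\<bar> < 1"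
  defines "n \<equiv> Suc m"
    and "xb \<equiv> (\<Sum>j<n. x (Suc j)) / n"
    and "S \<equiv> (\<Sum>j<n. e j)"
    and "q \<equiv> (x 0)\<^sup>2 + (x n)\<^sup>2 + (e 0)\<^sup>2 + S\<^sup>2 / n"
    and "c \<equiv> 3 / (1 - b)\<^sup>2"
begin

lemma nonneg: "0 \<le> q" "0 \<le> c"
  by (auto simp: q_def c_def)

text \<open>Summing the recursion telescopes to (1 - b) n xb = b (x_0 - x_n) + S. Squaring this with
  (p - r + s)^2 at most 3 (p^2 + r^2 + s^2) is the origin of the constant \<open>c\<close>.\<close>

lemma mean_square: "n * xb\<^sup>2 \<le> c * q" "xb\<^sup>2 \<le> c * q"
proof -
  have sumx: "(\<Sum>j<n. x (Suc j)) = n * xb" by (simp add: xb_def n_def)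
  have "(\<Sum>j<n. x (Suc j)) = (\<Sum>j<n. b * x j + e j)" by (simp add: rec)
  also have "\<dots> = b * (\<Sum>j<n. x j) + S" by (simp add: S_def sum.distrib sum_distrib_left)
  also have "(\<Sum>j<n. x j) = (\<Sum>j<n. x (Suc j)) + x 0 - x n"
    using sum.lessThan_Suc[of x n] sum.lessThan_Suc_shift[of x n] by simp
  finally have "(1 - b) * (n * xb) = b * (x 0 - x n) + S" unfolding sumx by (simp add: algebra_simps)
  then have eq: "(1 - b)\<^sup>2 * (n * xb)\<^sup>2 = (b * x 0 - b * x n + S)\<^sup>2" by (simp add: power_mult_distrib[symmetric] right_diff_distrib)
  have three: "(p - r + s)\<^sup>2 \<le> 3 * (p\<^sup>2 + r\<^sup>2 + s\<^sup>2)" for p r s :: real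
    using zero_le_power2[of "p + r"] zero_le_power2[of "r + s"] zero_le_power2[of "p - s"]
    by (simp add: power2_eq_square algebra_simps)
  have b2: "b\<^sup>2 \<le> 1" using b abs_square_le_1[of b] by simp
  have "(b * x 0 - b * x n + S)\<^sup>2 \<le> 3 * ((b * x 0)\<^sup>2 + (b * x n)\<^sup>2 + S\<^sup>2)" by (rule three)
  also have "\<dots> \<le> 3 * ((x 0)\<^sup>2 + (x n)\<^sup>2 + S\<^sup>2)"
    using b2 by (intro mult_left_mono add_mono) (auto simp: power_mult_distrib mult_left_le_one_le)
  finally have "(1 - b)\<^sup>2 * (n * xb)\<^sup>2 \<le> 3 * ((x 0)\<^sup>2 + (x n)\<^sup>2 + S\<^sup>2)" unfolding eq .
  moreover have "0 < (1 - b)\<^sup>2" using b by auto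
  ultimately have 1: "(n * xb)\<^sup>2 \<le> c * ((x 0)\<^sup>2 + (x n)\<^sup>2 + S\<^sup>2)" by (simp add: c_def field_simps)
  have n1: "1 \<le> real n" by (simp add: n_def)
  have "n * xb\<^sup>2 = (n * xb)\<^sup>2 / n" using n1 by (simp add: power2_eq_square)
  also have "\<dots> \<le> c * ((x 0)\<^sup>2 + (x n)\<^sup>2 + S\<^sup>2) / n" using 1 n1 by (intro divide_right_mono) auto
  also have "\<dots> = c * ((x 0)\<^sup>2 / n + (x n)\<^sup>2 / n + S\<^sup>2 / n)"
    by (simp only: times_divide_eq_right[symmetric] add_divide_distrib)
  also have "\<dots> \<le> c * q"
  proof (rule mult_left_mono)
    have "(x 0)\<^sup>2 / n \<le> (x 0)\<^sup>2" "(x n)\<^sup>2 / n \<le> (x n)\<^sup>2" using n1 by (auto intro!: divide_right_mono[of _ _ 1, simplified] simp: divide_le_eq mult_le_cancel_left1)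
    then show "(x 0)\<^sup>2 / n + (x n)\<^sup>2 / n + S\<^sup>2 / n \<le> q"
      unfolding q_def using zero_le_power2[of "e 0"] by linarith
  qed (rule nonneg)
  finally show 2: "n * xb\<^sup>2 \<le> c * q" .
  have "1 * xb\<^sup>2 \<le> n * xb\<^sup>2" using n1 by (intro mult_right_mono) auto
  with 2 show "xb\<^sup>2 \<le> c * q" by linarith
qed

text \<open>With y_j = x_j - xb the recursion reads y_(j+1) - b y_j = e_j - (1 - b) xb, so each
  summand reduces to a deviation times an innovation plus terms in the mean. The constant 20 is
  generous.\<close>

lemma numerator_bound:
  "\<bar>(\<Sum>j<m. (x (Suc j) - xb) * (x (Suc (Suc j)) - xb)) - b * (\<Sum>j<n. (x (Suc j) - xb)\<^sup>2)
     - (\<Sum>j<n. x j * e j)\<bar> \<le> (20 + 20 * c) * q"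
proof -
  \<comment> \<open>The lagged products involve only e_1, ..., e_m, so e_0 is missing compared with
    S.\<close>
  define W where "W = (\<Sum>j<m. e (Suc j))"
  have SW: "S = e 0 + W" by (simp only: S_def n_def W_def sum.lessThan_Suc_shift)
  have sumx: "(\<Sum>j<n. x (Suc j)) = n * xb" by (simp add: xb_def n_def)
  have dev: "(\<Sum>j<m. x (Suc j) - xb) = xb - x n"
    using sumx by (simp add: n_def sum_subtractf algebra_simps)
  have "(\<Sum>j<m. (x (Suc j) - xb) * (x (Suc (Suc j)) - xb)) - b * (\<Sum>j<m. (x (Suc j) - xb)\<^sup>2)
      = (\<Sum>j<m. (x (Suc j) - xb) * (e (Suc j) - (1 - b) * xb))"
    unfolding sum_distrib_left sum_subtractf[symmetric]
    by (intro sum.cong refl) (simp add: rec[of "Suc _"] power2_eq_square algebra_simps)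
  also have "\<dots> = (\<Sum>j<m. x (Suc j) * e (Suc j) - xb * e (Suc j) - (1 - b) * xb * (x (Suc j) - xb))"
    by (intro sum.cong refl) (simp add: algebra_simps)
  also have "\<dots> = (\<Sum>j<m. x (Suc j) * e (Suc j)) - xb * W - (1 - b) * xb * (xb - x n)"
    unfolding sum_subtractf by (simp only: W_def sum_distrib_left[symmetric] dev)
  \<comment> \<open>The first two terms on the right come from centring. The last two come from
    mismatched ranges: the sum of squares has an extra last term, with x_n, and the sum of x_j e_j
    an extra first term.\<close>
  finally have eq: "(\<Sum>j<m. (x (Suc j) - xb) * (x (Suc (Suc j)) - xb)) - b * (\<Sum>j<n. (x (Suc j) - xb)\<^sup>2)
       - (\<Sum>j<n. x j * e j)
      = - (xb * W) - (1 - b) * xb * (xb - x n) - b * (x n - xb)\<^sup>2 - x 0 * e 0"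
    unfolding n_def sum.lessThan_Suc[where n=m and g="\<lambda>j. (x (Suc j) - xb)\<^sup>2"] sum.lessThan_Suc_shift[where n=m and g="\<lambda>j. x j * e j"]
    by (simp add: algebra_simps)
  have young: "2 * \<bar>p * r\<bar> \<le> p\<^sup>2 + r\<^sup>2" for p r :: real
    using sum_squares_bound[of "\<bar>p\<bar>" "\<bar>r\<bar>"] by (simp add: abs_mult)
  have n0: "0 < real n" by (simp add: n_def)
  \<comment> \<open>Young's inequality is balanced with sqrt n, since n xb^2 and W^2 / n are the
    quantities bounded by multiples of q.\<close>
  have t1: "\<bar>xb * W\<bar> \<le> n * xb\<^sup>2 + W\<^sup>2 / n"
  proof -
    have "2 * \<bar>(sqrt n * xb) * (W / sqrt n)\<bar> \<le> (sqrt n * xb)\<^sup>2 + (W / sqrt n)\<^sup>2" by (rule young)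
    then have "2 * \<bar>xb * W\<bar> \<le> n * xb\<^sup>2 + W\<^sup>2 / n" using n0 by (simp add: power_mult_distrib power_divide)
    then show ?thesis by linarith
  qed
  have t2: "W\<^sup>2 / n \<le> 2 * q"
  proof -
    have "W\<^sup>2 \<le> 2 * S\<^sup>2 + 2 * (e 0)\<^sup>2"
      using zero_le_power2[of "S + e 0"] by (simp add: SW power2_eq_square algebra_simps)
    then have "W\<^sup>2 / n \<le> (2 * S\<^sup>2 + 2 * (e 0)\<^sup>2) / n" using n0 by (intro divide_right_mono) auto
    also have "\<dots> = 2 * (S\<^sup>2 / n) + 2 * ((e 0)\<^sup>2 / n)" by (simp add: add_divide_distrib)
    finally have "W\<^sup>2 / n \<le> 2 * (S\<^sup>2 / n) + 2 * ((e 0)\<^sup>2 / n)" .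
    moreover have "(e 0)\<^sup>2 / n \<le> (e 0)\<^sup>2" by (simp add: field_simps n_def mult_left_le)
    moreover have "w \<le> 2 * a + 2 * b \<Longrightarrow> b \<le> e2 \<Longrightarrow> 0 \<le> y \<Longrightarrow> 0 \<le> z \<Longrightarrow> w \<le> 2 * (y + z + e2 + a)"
      for w a b e2 y z :: real by simp
    ultimately show ?thesis unfolding q_def by (meson zero_le_power2)
  qed
  have xq: "(x 0)\<^sup>2 \<le> q" "(x n)\<^sup>2 \<le> q" "(e 0)\<^sup>2 \<le> q" unfolding q_def by auto
  have t3: "\<bar>(1 - b) * xb * (xb - x n)\<bar> \<le> 4 * xb\<^sup>2 + 2 * (x n)\<^sup>2"
  proof -
    have "\<bar>(1 - b) * xb * (xb - x n)\<bar> = \<bar>1 - b\<bar> * \<bar>xb * (xb - x n)\<bar>" by (simp add: abs_mult mult.assoc)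
    also have "\<dots> \<le> 2 * \<bar>xb * (xb - x n)\<bar>" using b by (intro mult_right_mono) auto
    also have "\<dots> \<le> xb\<^sup>2 + (xb - x n)\<^sup>2" by (rule young)
    also have "\<dots> \<le> 4 * xb\<^sup>2 + 2 * (x n)\<^sup>2"
    proof -
      have "4 * xb\<^sup>2 + 2 * (x n)\<^sup>2 = xb\<^sup>2 + (xb - x n)\<^sup>2 + (xb + x n)\<^sup>2 + xb\<^sup>2" by (simp add: power2_eq_square algebra_simps)
      then show ?thesis using zero_le_power2[of "xb + x n"] zero_le_power2[of xb] by linarith
    qed
    finally show ?thesis .
  qed
  have t4: "\<bar>b * (x n - xb)\<^sup>2\<bar> \<le> 2 * (x n)\<^sup>2 + 2 * xb\<^sup>2"
  proof -
    have "\<bar>b * (x n - xb)\<^sup>2\<bar> \<le> (x n - xb)\<^sup>2" using b by (simp add: abs_mult mult_left_le_one_le)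
    also have "\<dots> \<le> 2 * (x n)\<^sup>2 + 2 * xb\<^sup>2" using zero_le_power2[of "xb + x n"] by (simp add: power2_eq_square algebra_simps)
    finally show ?thesis .
  qed
  have t5: "\<bar>x 0 * e 0\<bar> \<le> (x 0)\<^sup>2 + (e 0)\<^sup>2" using young[of "x 0" "e 0"] by linarith
  have "\<bar>- (xb * W) - (1 - b) * xb * (xb - x n) - b * (x n - xb)\<^sup>2 - x 0 * e 0\<bar> \<le> 20 * q + 20 * (c * q)"
    using t1 t2 t3 t4 t5 xq mean_square nonneg mult_nonneg_nonneg[OF nonneg(2,1)] by linarith
  then show ?thesis unfolding eq by (simp add: algebra_simps)
qed

text \<open>Squaring the recursion and summing compares the sum of x_(j+1)^2 with \<beta>^2, here
  b^2, times the sum of x_j^2; the two sums differ only in the end terms x_0^2 and x_n^2.\<close>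

lemma denominator_bound:
  "\<bar>(1 - b\<^sup>2) * (\<Sum>j<n. (x (Suc j) - xb)\<^sup>2) - (\<Sum>j<n. (e j)\<^sup>2) - 2 * b * (\<Sum>j<n. x j * e j)\<bar> \<le> (20 + 20 * c) * q"
proof -
  have sumx: "(\<Sum>j<n. x (Suc j)) = n * xb" by (simp add: xb_def n_def)
  have "(\<Sum>j<n. (x (Suc j) - xb)\<^sup>2) = (\<Sum>j<n. (x (Suc j))\<^sup>2 - 2 * xb * x (Suc j) + xb\<^sup>2)"
    by (intro sum.cong refl) (simp add: power2_eq_square algebra_simps)
  also have "\<dots> = (\<Sum>j<n. (x (Suc j))\<^sup>2) - n * xb\<^sup>2"
    by (simp add: sum.distrib sum_subtractf sum_distrib_left[symmetric] sumx power2_eq_square)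
  finally have D: "(\<Sum>j<n. (x (Suc j) - xb)\<^sup>2) = (\<Sum>j<n. (x (Suc j))\<^sup>2) - n * xb\<^sup>2" .
  have "(\<Sum>j<n. (x (Suc j))\<^sup>2) = (\<Sum>j<n. b\<^sup>2 * (x j)\<^sup>2 + 2 * b * (x j * e j) + (e j)\<^sup>2)"
    by (intro sum.cong refl) (simp add: rec power2_eq_square algebra_simps)
  also have "\<dots> = b\<^sup>2 * (\<Sum>j<n. (x j)\<^sup>2) + 2 * b * (\<Sum>j<n. x j * e j) + (\<Sum>j<n. (e j)\<^sup>2)"
    by (simp add: sum.distrib sum_distrib_left)
  also have "(\<Sum>j<n. (x j)\<^sup>2) = (\<Sum>j<n. (x (Suc j))\<^sup>2) + (x 0)\<^sup>2 - (x n)\<^sup>2"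
    using sum.lessThan_Suc[of "\<lambda>j. (x j)\<^sup>2" n] sum.lessThan_Suc_shift[of "\<lambda>j. (x j)\<^sup>2" n] by simp
  finally have "(1 - b\<^sup>2) * (\<Sum>j<n. (x (Suc j) - xb)\<^sup>2) - (\<Sum>j<n. (e j)\<^sup>2) - 2 * b * (\<Sum>j<n. x j * e j)
     = b\<^sup>2 * (x 0)\<^sup>2 - b\<^sup>2 * (x n)\<^sup>2 - (1 - b\<^sup>2) * (n * xb\<^sup>2)"
    unfolding D by (simp add: algebra_simps)
  moreover have b2: "0 \<le> b\<^sup>2" "b\<^sup>2 \<le> 1" using b abs_square_le_1[of b] by auto
  have "0 \<le> b\<^sup>2 * (x 0)\<^sup>2" "b\<^sup>2 * (x 0)\<^sup>2 \<le> (x 0)\<^sup>2" "0 \<le> b\<^sup>2 * (x n)\<^sup>2" "b\<^sup>2 * (x n)\<^sup>2 \<le> (x n)\<^sup>2"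
      "0 \<le> (1 - b\<^sup>2) * (n * xb\<^sup>2)" "(1 - b\<^sup>2) * (n * xb\<^sup>2) \<le> n * xb\<^sup>2"
    using b2 by (auto intro!: mult_left_le_one_le)
  moreover have "(x 0)\<^sup>2 \<le> q" "(x n)\<^sup>2 \<le> q" unfolding q_def by auto
  ultimately have "\<bar>(1 - b\<^sup>2) * (\<Sum>j<n. (x (Suc j) - xb)\<^sup>2) - (\<Sum>j<n. (e j)\<^sup>2) - 2 * b * (\<Sum>j<n. x j * e j)\<bar> \<le> 20 * q + 20 * (c * q)"
    using mean_square nonneg mult_nonneg_nonneg[OF nonneg(2,1)] by linarith
  then show ?thesis by (simp add: algebra_simps)
qed

end

lemma (in prob_space) expectation_square_sum_le:
  fixes Z :: "nat \<Rightarrow> 'a \<Rightarrow> real"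
  assumes [measurable]: "\<And>j. Z j \<in> borel_measurable M" and int: "\<And>j. integrable M (\<lambda>\<omega>. (Z j \<omega>)\<^sup>2)"
    and le: "\<And>j. expectation (\<lambda>\<omega>. (Z j \<omega>)\<^sup>2) \<le> K"
    and orth: "\<And>i j. i < j \<Longrightarrow> expectation (\<lambda>\<omega>. Z j \<omega> * Z i \<omega>) = 0"
  shows "integrable M (\<lambda>\<omega>. (\<Sum>j<n. Z j \<omega>)\<^sup>2)" "expectation (\<lambda>\<omega>. (\<Sum>j<n. Z j \<omega>)\<^sup>2) \<le> n * K"
proof -
  have ij: "integrable M (\<lambda>\<omega>. Z i \<omega> * Z j \<omega>)" for i j by (rule square_integral_mult_le) (use int in auto)
  have "integrable M (\<lambda>\<omega>. (\<Sum>j<n. Z j \<omega>)\<^sup>2) \<and> expectation (\<lambda>\<omega>. (\<Sum>j<n. Z j \<omega>)\<^sup>2) \<le> n * K"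
  proof (induction n)
    case (Suc n)
    have eq: "(\<Sum>j<Suc n. Z j \<omega>)\<^sup>2 = (\<Sum>j<n. Z j \<omega>)\<^sup>2 + 2 * (\<Sum>j<n. Z n \<omega> * Z j \<omega>) + (Z n \<omega>)\<^sup>2" for \<omega>
      by (simp add: power2_sum sum_distrib_left algebra_simps)
    have i2: "integrable M (\<lambda>\<omega>. \<Sum>j<n. Z n \<omega> * Z j \<omega>)" by (intro Bochner_Integration.integrable_sum ij)
    have 0: "expectation (\<lambda>\<omega>. \<Sum>j<n. Z n \<omega> * Z j \<omega>) = 0"
      by (subst Bochner_Integration.integral_sum) (auto intro!: ij sum.neutral orth)
    show ?case unfolding eq using Suc i2 int[of n] le[of n] 0
      by (simp add: algebra_simps)
  qed simp
  then show "integrable M (\<lambda>\<omega>. (\<Sum>j<n. Z j \<omega>)\<^sup>2)" "expectation (\<lambda>\<omega>. (\<Sum>j<n. Z j \<omega>)\<^sup>2) \<le> n * K" by auto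
qed

section \<open>Fourth moments of \<open>X\<close> and characteristic functions of its sums\<close>

context functional_ar1
begin

text \<open>Cauchy-Schwarz in L^2(\<mu>), squared, followed by Jensen for each squared norm.\<close>

lemma X_pow4_le:
  assumes "\<omega> \<in> space M" "integrable \<mu> (\<lambda>u. V (t - 1) \<omega> u ^ 4)" "integrable \<mu> (\<lambda>u. \<epsilon> t \<omega> u ^ 4)"
  shows "X t \<omega> ^ 4 \<le> (\<integral>u. V (t - 1) \<omega> u ^ 4 \<partial>\<mu>) * (\<integral>u. \<epsilon> t \<omega> u ^ 4 \<partial>\<mu>)"
proof -
  have \<omega>: "(\<lambda>_. \<omega>) \<in> measurable \<mu> M" using assms(1) by simp
  have [measurable]: "V (t - 1) \<omega> \<in> borel_measurable \<mu>" "\<epsilon> t \<omega> \<in> borel_measurable \<mu>"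
    using V_measurable2[OF \<omega> measurable_ident_sets[OF refl]] eps_measurable2[OF \<omega> measurable_ident_sets[OF refl]] by auto
  have i2: "integrable \<mu> (\<lambda>u. (V (t - 1) \<omega> u)\<^sup>2)" "integrable \<mu> (\<lambda>u. (\<epsilon> t \<omega> u)\<^sup>2)"
    using assms by (auto intro!: U.integrable_lower_powers(2))
  have "(X t \<omega>)\<^sup>2 \<le> (\<integral>u. (V (t - 1) \<omega> u)\<^sup>2 \<partial>\<mu>) * (\<integral>u. (\<epsilon> t \<omega> u)\<^sup>2 \<partial>\<mu>)"
    unfolding X_def ip_def by (rule square_integral_mult_le) (use i2 in auto)
  then have "((X t \<omega>)\<^sup>2)\<^sup>2 \<le> ((\<integral>u. (V (t - 1) \<omega> u)\<^sup>2 \<partial>\<mu>) * (\<integral>u. (\<epsilon> t \<omega> u)\<^sup>2 \<partial>\<mu>))\<^sup>2"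
    by (rule power_mono) simp
  also have "\<dots> = (\<integral>u. (V (t - 1) \<omega> u)\<^sup>2 \<partial>\<mu>)\<^sup>2 * (\<integral>u. (\<epsilon> t \<omega> u)\<^sup>2 \<partial>\<mu>)\<^sup>2" by (rule power_mult_distrib)
  also have "\<dots> \<le> (\<integral>u. ((V (t - 1) \<omega> u)\<^sup>2)\<^sup>2 \<partial>\<mu>) * (\<integral>u. ((\<epsilon> t \<omega> u)\<^sup>2)\<^sup>2 \<partial>\<mu>)"
    using assms i2 by (intro mult_mono U.square_expectation_le) auto
  finally show ?thesis by simp
qed

lemma X_pow4: "integrable M (\<lambda>\<omega>. X t \<omega> ^ 4)" "expectation (\<lambda>\<omega>. X t \<omega> ^ 4) \<le> KV * m4"
proof -
  define f where "f u = (\<integral>\<^sup>+\<omega>. ennreal (V (t - 1) \<omega> u ^ 4) \<partial>M)" for u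
  define g where "g u = (\<integral>\<^sup>+\<omega>. ennreal (\<epsilon> t \<omega> u ^ 4) \<partial>M)" for u
  have [measurable]: "f \<in> borel_measurable \<mu>" "g \<in> borel_measurable \<mu>" unfolding f_def g_def by measurable
  have "AE \<omega> in M. ennreal (X t \<omega> ^ 4) \<le> (\<integral>\<^sup>+x. ennreal (V (t - 1) \<omega> (fst x) ^ 4) * ennreal (\<epsilon> t \<omega> (snd x) ^ 4) \<partial>(\<mu> \<Otimes>\<^sub>M \<mu>))"
    using L4_AE_integrable(2)[OF L4_V[of "t - 1"]] L4_AE_integrable(2)[OF L4_eps[of t]] AE_space
  proof eventually_elim
    case (elim \<omega>)
    then have \<omega>: "(\<lambda>_. \<omega>) \<in> measurable \<mu> M" by simp
    have [measurable]: "V (t - 1) \<omega> \<in> borel_measurable \<mu>" "\<epsilon> t \<omega> \<in> borel_measurable \<mu>"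
      using V_measurable2[OF \<omega> measurable_ident_sets[OF refl]] eps_measurable2[OF \<omega> measurable_ident_sets[OF refl]] by auto
    have "(\<integral>\<^sup>+x. ennreal (V (t - 1) \<omega> (fst x) ^ 4) * ennreal (\<epsilon> t \<omega> (snd x) ^ 4) \<partial>(\<mu> \<Otimes>\<^sub>M \<mu>))
       = (\<integral>\<^sup>+u. ennreal (V (t - 1) \<omega> u ^ 4) \<partial>\<mu>) * (\<integral>\<^sup>+u. ennreal (\<epsilon> t \<omega> u ^ 4) \<partial>\<mu>)"
      by (subst U.nn_integral_fst[symmetric]) (auto simp: nn_integral_cmult nn_integral_multc)
    also have "\<dots> = ennreal (\<integral>u. V (t - 1) \<omega> u ^ 4 \<partial>\<mu>) * ennreal (\<integral>u. \<epsilon> t \<omega> u ^ 4 \<partial>\<mu>)"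
      using elim by (subst (1 2) nn_integral_eq_integral) auto
    also have "\<dots> = ennreal ((\<integral>u. V (t - 1) \<omega> u ^ 4 \<partial>\<mu>) * (\<integral>u. \<epsilon> t \<omega> u ^ 4 \<partial>\<mu>))"
      by (rule ennreal_mult[symmetric]) auto
    finally show ?case using X_pow4_le[OF elim(3,1,2)] by (simp add: ennreal_leI)
  qed
  then have "(\<integral>\<^sup>+\<omega>. ennreal (X t \<omega> ^ 4) \<partial>M) \<le>
      (\<integral>\<^sup>+\<omega>. (\<integral>\<^sup>+x. ennreal (V (t - 1) \<omega> (fst x) ^ 4) * ennreal (\<epsilon> t \<omega> (snd x) ^ 4) \<partial>(\<mu> \<Otimes>\<^sub>M \<mu>)) \<partial>M)"
    by (rule nn_integral_mono_AE)
  \<comment> \<open>The product of the two integrals over u is written as one over (u, v) and the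
    order is exchanged, so that independence of \<open>V (t - 1)\<close> and
    \<open>\<epsilon> t\<close> acts at fixed points and separates the moments.\<close>
  also have "\<dots> = (\<integral>\<^sup>+x. (\<integral>\<^sup>+\<omega>. ennreal (V (t - 1) \<omega> (fst x) ^ 4) * ennreal (\<epsilon> t \<omega> (snd x) ^ 4) \<partial>M) \<partial>(\<mu> \<Otimes>\<^sub>M \<mu>))"
    by (rule MUU.Fubini'[symmetric]) measurable
  also have "\<dots> = (\<integral>\<^sup>+x. f (fst x) * g (snd x) \<partial>(\<mu> \<Otimes>\<^sub>M \<mu>))"
  proof (rule nn_integral_cong_AE)
    show "AE x in \<mu> \<Otimes>\<^sub>M \<mu>. (\<integral>\<^sup>+\<omega>. ennreal (V (t - 1) \<omega> (fst x) ^ 4) * ennreal (\<epsilon> t \<omega> (snd x) ^ 4) \<partial>M) = f (fst x) * g (snd x)"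
      using AE_pair_components[OF AE_good]
    proof eventually_elim
      case (elim x)
      define u v where uv: "u = fst x" "v = snd x"
      then have g: "good u" "good v" using elim by auto
      have iV: "integrable M (\<lambda>\<omega>. V (t - 1) \<omega> u ^ 4)" and ie: "integrable M (\<lambda>\<omega>. \<epsilon> t \<omega> v ^ 4)"
        using g by (auto simp: good_def)
      have "(\<lambda>\<omega>. V (t - 1) \<omega> u ^ 4) \<in> borel_measurable (past (t - 1))"
        by (intro borel_measurable_power V_past) simp
      from past_indep[OF this, of t "\<lambda>x. x v ^ 4"]
      have ind: "indep_var borel (\<lambda>\<omega>. V (t - 1) \<omega> u ^ 4) borel (\<lambda>\<omega>. \<epsilon> t \<omega> v ^ 4)" by simp
      have "(\<integral>\<^sup>+\<omega>. ennreal (V (t - 1) \<omega> u ^ 4) * ennreal (\<epsilon> t \<omega> v ^ 4) \<partial>M) = (\<integral>\<^sup>+\<omega>. ennreal (V (t - 1) \<omega> u ^ 4 * \<epsilon> t \<omega> v ^ 4) \<partial>M)"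
        by (simp add: ennreal_mult)
      also have "\<dots> = ennreal (expectation (\<lambda>\<omega>. V (t - 1) \<omega> u ^ 4 * \<epsilon> t \<omega> v ^ 4))"
        by (rule nn_integral_eq_integral[OF indep_var_integrable[OF ind iV ie]]) simp
      also have "\<dots> = ennreal (expectation (\<lambda>\<omega>. V (t - 1) \<omega> u ^ 4)) * ennreal (expectation (\<lambda>\<omega>. \<epsilon> t \<omega> v ^ 4))"
        unfolding indep_var_lebesgue_integral[OF ind iV ie] by (rule ennreal_mult) auto
      also have "\<dots> = f u * g v" unfolding f_def g_def
        using iV ie by (subst (1 2) nn_integral_eq_integral) auto
      finally show ?case by (simp add: uv)
    qed
  qed
  also have "\<dots> = (\<integral>\<^sup>+u. f u \<partial>\<mu>) * (\<integral>\<^sup>+u. g u \<partial>\<mu>)"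
    by (subst U.nn_integral_fst[symmetric]) (auto simp: nn_integral_cmult nn_integral_multc)
  also have "(\<integral>\<^sup>+u. f u \<partial>\<mu>) = (\<integral>\<^sup>+x. ennreal (V (t - 1) (fst x) (snd x) ^ 4) \<partial>(M \<Otimes>\<^sub>M \<mu>))"
    unfolding f_def by (subst MU.nn_integral_snd[symmetric]) auto
  also have "(\<integral>\<^sup>+u. g u \<partial>\<mu>) = (\<integral>\<^sup>+x. ennreal (\<epsilon> t (fst x) (snd x) ^ 4) \<partial>(M \<Otimes>\<^sub>M \<mu>))"
    unfolding g_def by (subst MU.nn_integral_snd[symmetric]) auto
  also have "(\<integral>\<^sup>+x. ennreal (V (t - 1) (fst x) (snd x) ^ 4) \<partial>(M \<Otimes>\<^sub>M \<mu>)) * (\<integral>\<^sup>+x. ennreal (\<epsilon> t (fst x) (snd x) ^ 4) \<partial>(M \<Otimes>\<^sub>M \<mu>))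
     \<le> ennreal KV * ennreal m4"
    unfolding nn_integral_eps_pow4 by (intro mult_right_mono nn_integral_V_pow4) auto
  also have "\<dots> = ennreal (KV * m4)" by (rule ennreal_mult[symmetric]) (auto simp: KV_nonneg m4_nonneg)
  finally have bound: "(\<integral>\<^sup>+\<omega>. ennreal (X t \<omega> ^ 4) \<partial>M) \<le> ennreal (KV * m4)" .
  show "integrable M (\<lambda>\<omega>. X t \<omega> ^ 4)"
    by (rule integrableI_bounded) (use order_le_less_trans[OF bound] in auto)
  have "expectation (\<lambda>\<omega>. X t \<omega> ^ 4) = enn2real (\<integral>\<^sup>+\<omega>. ennreal (X t \<omega> ^ 4) \<partial>M)"
    by (subst integral_eq_nn_integral) auto
  also have "\<dots> \<le> enn2real (ennreal (KV * m4))" by (rule enn2real_mono[OF bound]) simp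
  finally show "expectation (\<lambda>\<omega>. X t \<omega> ^ 4) \<le> KV * m4" using KV_nonneg m4_nonneg by simp
qed

text \<open>Replacing each \<open>X\<close> by its version measurable for the past makes cosine and
  sine of the partial sum bounded weights to which the real-valued lemmas apply. The sum over j < k
  involves X_1, ..., X_k, hence \<open>past k\<close>.\<close>

lemma iexp_sum_version:
  fixes s :: real and k :: nat
  obtains Gc Gs where "Gc \<in> borel_measurable (past (int k))" "\<And>\<omega>. \<bar>Gc \<omega>\<bar> \<le> 1"
    "Gs \<in> borel_measurable (past (int k))" "\<And>\<omega>. \<bar>Gs \<omega>\<bar> \<le> 1"
    "AE \<omega> in M. iexp (s * (\<Sum>j<k. X (int j + 1) \<omega>)) = complex_of_real (Gc \<omega>) + \<i> * complex_of_real (Gs \<omega>)"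
proof -
  have "\<exists>Y. \<forall>t. Y t \<in> borel_measurable (past t) \<and> (AE \<omega> in M. X t \<omega> = Y t \<omega>)"
    using X_version by (intro choice) blast
  then obtain Y where Y: "\<And>t. Y t \<in> borel_measurable (past t)" "\<And>t. AE \<omega> in M. X t \<omega> = Y t \<omega>" by blast
  define T where "T \<omega> = s * (\<Sum>j<k. Y (int j + 1) \<omega>)" for \<omega>
  have T: "T \<in> borel_measurable (past (int k))"
    unfolding T_def by (intro borel_measurable_times borel_measurable_sum borel_measurable_const past_mono[OF _ Y(1)]) auto
  show ?thesis
  proof (rule that[of "\<lambda>\<omega>. cos (T \<omega>)" "\<lambda>\<omega>. sin (T \<omega>)"])
    show "(\<lambda>\<omega>. cos (T \<omega>)) \<in> borel_measurable (past (int k))" "(\<lambda>\<omega>. sin (T \<omega>)) \<in> borel_measurable (past (int k))"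
      using T by measurable
    have "AE \<omega> in M. \<forall>t. X t \<omega> = Y t \<omega>" using Y(2) by (simp add: AE_all_countable)
    then show "AE \<omega> in M. iexp (s * (\<Sum>j<k. X (int j + 1) \<omega>)) = complex_of_real (cos (T \<omega>)) + \<i> * complex_of_real (sin (T \<omega>))"
      by eventually_elim (simp only: T_def cis_conv_exp[symmetric] complex_eq_iff cis.sel, simp)
  qed auto
qed

lemma expectation_complex_split:
  fixes Z :: "'a \<Rightarrow> real" and W :: "'a \<Rightarrow> complex"
  assumes [measurable]: "W \<in> borel_measurable M" "Gc \<in> borel_measurable M" "Gs \<in> borel_measurable M"
    and W: "AE \<omega> in M. W \<omega> = complex_of_real (Gc \<omega>) + \<i> * complex_of_real (Gs \<omega>)"
    and Gc: "\<And>\<omega>. \<bar>Gc \<omega>\<bar> \<le> 1" and Gs: "\<And>\<omega>. \<bar>Gs \<omega>\<bar> \<le> 1" and Z: "integrable M Z"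
  shows "(CLINT \<omega>|M. W \<omega> * Z \<omega>) = complex_of_real (expectation (\<lambda>\<omega>. Gc \<omega> * Z \<omega>)) + \<i> * complex_of_real (expectation (\<lambda>\<omega>. Gs \<omega> * Z \<omega>))"
proof -
  have [measurable]: "Z \<in> borel_measurable M" using Z by auto
  have int: "integrable M (\<lambda>\<omega>. g \<omega> * Z \<omega>)" if "g \<in> borel_measurable M" "\<And>\<omega>. \<bar>g \<omega>\<bar> \<le> 1" for g :: "'a \<Rightarrow> real"
    by (rule Bochner_Integration.integrable_bound[OF Z]) (use that in \<open>auto simp: abs_mult mult_left_le_one_le\<close>)
  have "(CLINT \<omega>|M. W \<omega> * Z \<omega>) = (CLINT \<omega>|M. complex_of_real (Gc \<omega> * Z \<omega>) + \<i> * complex_of_real (Gs \<omega> * Z \<omega>))"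
    by (rule integral_cong_AE) (use W in \<open>auto elim!: eventually_mono simp: algebra_simps\<close>)
  also have "\<dots> = (CLINT \<omega>|M. complex_of_real (Gc \<omega> * Z \<omega>)) + (CLINT \<omega>|M. \<i> * complex_of_real (Gs \<omega> * Z \<omega>))"
    by (rule Bochner_Integration.integral_add)
      (intro integrable_mult_right integrable_of_real int; use Gc Gs in simp)+
  also have "\<dots> = complex_of_real (expectation (\<lambda>\<omega>. Gc \<omega> * Z \<omega>)) + \<i> * complex_of_real (expectation (\<lambda>\<omega>. Gs \<omega> * Z \<omega>))"
    by (simp only: integral_mult_right_zero integral_complex_of_real)
  finally show ?thesis .
qed

lemma char_sum_X_tendsto:
  "(\<lambda>n. CLINT \<omega>|M. iexp (s * ((\<Sum>j<n. X (int j + 1) \<omega>) / sqrt n))) \<longlonglongrightarrow> exp (- (s\<^sup>2 * (C2 / (1 - \<beta>\<^sup>2)) / 2))"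
proof (rule char_normalized_sum_tendsto[where K="KV * m4" and \<rho>="\<beta>\<^sup>2"])
  have b2: "\<beta>\<^sup>2 < 1" using beta abs_square_less_1[of \<beta>] by simp
  then show "\<beta>\<^sup>2 < 1" "0 \<le> \<beta>\<^sup>2" by auto
  show "0 \<le> C2 / (1 - \<beta>\<^sup>2)" using b2 by (auto simp: C2_def)
  \<comment> \<open>Fixed point of the recursion in \<open>expectation_past_mult_X_square\<close>;
    subtracting it turns the affine recursion into the pure contraction by \<beta>^2 required for
    \<open>contr\<close>.\<close>
  define \<tau> where "\<tau> = C2 / (1 - \<beta>\<^sup>2)"
  have "\<tau> * (1 - \<beta>\<^sup>2) = C2" using b2 by (simp add: \<tau>_def)
  then have C2: "C2 = \<tau> - \<beta>\<^sup>2 * \<tau>" by (simp add: algebra_simps)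
  have iX: "integrable M (X t)" and iX2: "integrable M (\<lambda>\<omega>. (X t \<omega>)\<^sup>2)" for t
    using integrable_lower_powers[OF X_measurable X_pow4(1)] by auto
  fix s :: real and k :: nat
  obtain Gc Gs where G: "Gc \<in> borel_measurable (past (int k))" "\<And>\<omega>. \<bar>Gc \<omega>\<bar> \<le> 1"
    "Gs \<in> borel_measurable (past (int k))" "\<And>\<omega>. \<bar>Gs \<omega>\<bar> \<le> 1"
    "AE \<omega> in M. iexp (s * (\<Sum>j<k. X (int j + 1) \<omega>)) = complex_of_real (Gc \<omega>) + \<i> * complex_of_real (Gs \<omega>)"
    using iexp_sum_version[of k s] by blast
  have split: "(CLINT \<omega>|M. iexp (s * (\<Sum>j<k. X (int j + 1) \<omega>)) * complex_of_real (Z \<omega>))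
     = complex_of_real (expectation (\<lambda>\<omega>. Gc \<omega> * Z \<omega>)) + \<i> * complex_of_real (expectation (\<lambda>\<omega>. Gs \<omega> * Z \<omega>))"
    if "integrable M Z" for Z
    by (rule expectation_complex_split) (use that G past_imp_measurable in auto)
  show "(CLINT \<omega>|M. iexp (s * (\<Sum>j<k. X (int j + 1) \<omega>)) * complex_of_real (X (int k + 1) \<omega>)) = 0"
    unfolding split[OF iX] by (simp add: expectation_past_mult_X G)
  have real: "expectation (\<lambda>\<omega>. G \<omega> * ((X (int k + 2) \<omega>)\<^sup>2 - \<tau>)) = \<beta>\<^sup>2 * expectation (\<lambda>\<omega>. G \<omega> * ((X (int k + 1) \<omega>)\<^sup>2 - \<tau>))"
    if G: "G \<in> borel_measurable (past (int k))" "\<And>\<omega>. \<bar>G \<omega>\<bar> \<le> 1" for G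
  proof -
    have GM: "G \<in> borel_measurable M" by (rule past_imp_measurable[OF G(1)])
    have iG: "integrable M G" by (rule integrable_const_bound[of _ 1]) (use G GM in auto)
    have iGX: "integrable M (\<lambda>\<omega>. G \<omega> * (X t \<omega>)\<^sup>2)" for t
      by (rule Bochner_Integration.integrable_bound[OF iX2[of t]]) (use G(2) GM in \<open>auto simp: abs_mult mult_left_le_one_le\<close>)
    have e: "expectation (\<lambda>\<omega>. G \<omega> * ((X t \<omega>)\<^sup>2 - \<tau>)) = expectation (\<lambda>\<omega>. G \<omega> * (X t \<omega>)\<^sup>2) - \<tau> * expectation G" for t
      using iG iGX[of t] by (simp add: right_diff_distrib mult.commute[of _ \<tau>])
    show ?thesis unfolding e expectation_past_mult_X_square[OF G] by (simp add: C2 algebra_simps)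
  qed
  have i3: "integrable M (\<lambda>\<omega>. (X t \<omega>)\<^sup>2 - \<tau>)" for t using iX2 by simp
  have Suc: "int (Suc k) + 1 = int k + 2" by simp
  show "(CLINT \<omega>|M. iexp (s * (\<Sum>j<k. X (int j + 1) \<omega>)) * complex_of_real ((X (int (Suc k) + 1) \<omega>)\<^sup>2 - C2 / (1 - \<beta>\<^sup>2)))
     = complex_of_real (\<beta>\<^sup>2) * (CLINT \<omega>|M. iexp (s * (\<Sum>j<k. X (int j + 1) \<omega>)) * complex_of_real ((X (int k + 1) \<omega>)\<^sup>2 - C2 / (1 - \<beta>\<^sup>2)))"
    unfolding \<tau>_def[symmetric] Suc split[OF i3] real[OF G(1,2)] real[OF G(3,4)] by (simp add: algebra_simps)
qed (use X_pow4 in auto)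

end

text \<open>Rectangles are an intersection-stable generator, so the vanishing spreads to all
  measurable sets by Dynkin induction; the sets where f is positive and where it is negative then
  decide.\<close>

lemma AE_eq_0_if_rectangle_integrals_0:
  fixes f :: "'a \<times> 'b \<Rightarrow> real"
  assumes f: "integrable (M \<Otimes>\<^sub>M N) f"
    and rect: "\<And>A B. A \<in> sets M \<Longrightarrow> B \<in> sets N \<Longrightarrow> (\<integral>x. indicator (A \<times> B) x * f x \<partial>(M \<Otimes>\<^sub>M N)) = 0"
  shows "AE x in M \<Otimes>\<^sub>M N. f x = 0"
proof -
  let ?P = "M \<Otimes>\<^sub>M N"
  have [measurable]: "f \<in> borel_measurable ?P" using f by auto
  have int: "integrable ?P (\<lambda>x. indicator S x * f x)" if "S \<in> sets ?P" for S
    using integrable_mult_indicator[OF that f] by simp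
  have zero: "(\<integral>x. indicator S x * f x \<partial>?P) = 0" if "S \<in> sets ?P" for S
    using Int_stable_pair_measure_generator pair_measure_closed that unfolding sets_pair_measure
  proof (induct rule: sigma_sets_induct_disjoint)
    case (basic S)
    then show ?case using rect by auto
  next
    case empty
    then show ?case by simp
  next
    case (compl S)
    have S: "S \<in> sets ?P" using compl by (simp add: sets_pair_measure)
    have sp: "space M \<times> space N = space ?P" by (simp add: space_pair_measure)
    have "(\<integral>x. indicator (space ?P - S) x * f x \<partial>?P) = (\<integral>x. indicator (space ?P) x * f x - indicator S x * f x \<partial>?P)"
      by (intro Bochner_Integration.integral_cong) (auto simp: indicator_def)
    also have "\<dots> = (\<integral>x. indicator (space ?P) x * f x \<partial>?P) - (\<integral>x. indicator S x * f x \<partial>?P)"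
      by (intro Bochner_Integration.integral_diff int S) auto
    also have "(\<integral>x. indicator (space ?P) x * f x \<partial>?P) = 0" using rect[of "space M" "space N"] by (simp add: sp)
    finally show ?case using compl by (simp add: sp)
  next
    case (union S)
    have S: "S i \<in> sets ?P" for i using union by (auto simp: sets_pair_measure)
    have "(LINT x:(\<Union>i. S i)|?P. f x) = (\<Sum>i. (LINT x:S i|?P. f x))"
      using union(1) S int[of "\<Union>i. S i"]
      by (intro lebesgue_integral_countable_add) (auto simp: disjoint_family_on_def set_integrable_def)
    then show ?case using union by (simp add: set_lebesgue_integral_def)
  qed
  have nonneg: "AE x in ?P. g x = 0" if g: "integrable ?P g" "\<And>x. 0 \<le> g x" "(\<integral>x. g x \<partial>?P) = 0" for g :: "_ \<Rightarrow> real"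
    using integral_nonneg_eq_0_iff_AE[OF g(1)] g by auto
  let ?S = "{x \<in> space ?P. 0 < f x}" and ?T = "{x \<in> space ?P. f x < 0}"
  have S: "?S \<in> sets ?P" and T: "?T \<in> sets ?P" by measurable
  have "(\<integral>x. max 0 (f x) \<partial>?P) = (\<integral>x. indicator ?S x * f x \<partial>?P)"
    by (intro Bochner_Integration.integral_cong) (auto simp: indicator_def max_def)
  then have 1: "AE x in ?P. max 0 (f x) = 0" using f zero[OF S] by (intro nonneg) auto
  have "(\<integral>x. max 0 (- f x) \<partial>?P) = (\<integral>x. - (indicator ?T x * f x) \<partial>?P)"
    by (intro Bochner_Integration.integral_cong) (auto simp: indicator_def max_def)
  then have 2: "AE x in ?P. max 0 (- f x) = 0" using f zero[OF T] by (intro nonneg) auto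
  from 1 2 show ?thesis by eventually_elim (auto simp: max_def split: if_splits)
qed

context functional_ar1
begin

definition \<kappa> :: real where "\<kappa> = (\<integral>u. cov u u \<partial>\<mu>)"

text \<open>C2 = 0 makes \<open>cov\<close> vanish almost everywhere on the product, which says
  nothing directly about the diagonal, possibly a null set. Instead the second moment of the
  integral of \<open>\<epsilon> 0\<close> over any set B is a double integral of \<open>cov\<close>
  and vanishes; hence \<open>\<epsilon> 0\<close> is zero almost everywhere, and with it the
  diagonal of \<open>cov\<close>. Positivity matters because the limit has to be a genuine normal
  density.\<close>

lemma C2_pos:
  assumes "\<kappa> \<noteq> 0"
  shows "0 < C2"
proof (rule ccontr)
  assume "\<not> 0 < C2"
  moreover have "0 \<le> C2" by (simp add: C2_def)
  ultimately have "C2 = 0" by linarith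
  then have "(\<integral>x. (cov (fst x) (snd x))\<^sup>2 \<partial>(\<mu> \<Otimes>\<^sub>M \<mu>)) = 0" by (simp add: C2_def)
  then have cov0: "AE x in \<mu> \<Otimes>\<^sub>M \<mu>. cov (fst x) (snd x) = 0"
    using integral_nonneg_eq_0_iff_AE[OF integrable_cov_square] by auto
  have inte: "integrable (M \<Otimes>\<^sub>M \<mu>) (\<lambda>(\<omega>, u). \<epsilon> 0 \<omega> u)"
    using MU.P.integrable_lower_powers(1)[of "\<lambda>(\<omega>, u). \<epsilon> 0 \<omega> u"] L4_eps[of 0] by (simp add: L4_def split_beta')
  have ipA: "AE \<omega> in M. ip (indicator B) (\<epsilon> 0 \<omega>) = 0" if B[measurable]: "B \<in> sets \<mu>" for B
  proof -
    define a where "a = (\<lambda>(_::'a) u. indicator B u :: real)"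
    have a: "L4 a" unfolding L4_def a_def
      using B by (auto simp: split_beta' indicator_def intro!: MU.P.integrable_const_bound[of _ 1])
    have "expectation (\<lambda>\<omega>. 1 * (ip (a \<omega>) (\<epsilon> 0 \<omega>) * ip (a \<omega>) (\<epsilon> 0 \<omega>)))
       = (\<integral>x. expectation (\<lambda>\<omega>. 1 * (a \<omega> (fst x) * \<epsilon> 0 \<omega> (fst x) * (a \<omega> (snd x) * \<epsilon> 0 \<omega> (snd x)))) \<partial>(\<mu> \<Otimes>\<^sub>M \<mu>))"
      by (rule expectation_ip_mult_ip) (use a L4_eps in auto)
    also have "\<dots> = (\<integral>x. (indicator B (fst x) * indicator B (snd x)) * cov (fst x) (snd x) \<partial>(\<mu> \<Otimes>\<^sub>M \<mu>))"
    proof (intro Bochner_Integration.integral_cong refl)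
      fix x
      have "expectation (\<lambda>\<omega>. 1 * (a \<omega> (fst x) * \<epsilon> 0 \<omega> (fst x) * (a \<omega> (snd x) * \<epsilon> 0 \<omega> (snd x)))) =
          expectation (\<lambda>\<omega>. (indicator B (fst x) * indicator B (snd x)) * (\<epsilon> 0 \<omega> (fst x) * \<epsilon> 0 \<omega> (snd x)))"
        by (intro Bochner_Integration.integral_cong) (auto simp: a_def)
      then show "expectation (\<lambda>\<omega>. 1 * (a \<omega> (fst x) * \<epsilon> 0 \<omega> (fst x) * (a \<omega> (snd x) * \<epsilon> 0 \<omega> (snd x)))) =
          (indicator B (fst x) * indicator B (snd x)) * cov (fst x) (snd x)"
        by (simp add: cov_def)
    qed
    also have "\<dots> = (\<integral>x. 0 \<partial>(\<mu> \<Otimes>\<^sub>M \<mu>))"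
      by (intro integral_cong_AE) (use cov0 in \<open>auto elim: eventually_mono\<close>)
    finally have "expectation (\<lambda>\<omega>. (ip (a \<omega>) (\<epsilon> 0 \<omega>))\<^sup>2) = 0" by (simp add: power2_eq_square)
    moreover have "integrable M (\<lambda>\<omega>. (ip (a \<omega>) (\<epsilon> 0 \<omega>))\<^sup>2)"
      using integrable_ip_mult_ip[of "\<lambda>_. 1", OF _ _ a L4_eps[of 0] a L4_eps[of 0]] by (simp add: power2_eq_square)
    ultimately have "AE \<omega> in M. (ip (a \<omega>) (\<epsilon> 0 \<omega>))\<^sup>2 = 0"
      using integral_nonneg_eq_0_iff_AE[of M "\<lambda>\<omega>. (ip (a \<omega>) (\<epsilon> 0 \<omega>))\<^sup>2"] by simp
    then show ?thesis by (simp add: a_def)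
  qed
  have "AE x in M \<Otimes>\<^sub>M \<mu>. (case x of (\<omega>, u) \<Rightarrow> \<epsilon> 0 \<omega> u) = 0"
  proof (rule AE_eq_0_if_rectangle_integrals_0[OF inte])
    fix A B assume [measurable]: "A \<in> sets M" "B \<in> sets \<mu>"
    have int: "integrable (M \<Otimes>\<^sub>M \<mu>) (\<lambda>x. indicator (A \<times> B) x * (case x of (\<omega>, u) \<Rightarrow> \<epsilon> 0 \<omega> u))"
      using integrable_mult_indicator[OF _ inte, of "A \<times> B"] by simp
    have "(\<integral>x. indicator (A \<times> B) x * (case x of (\<omega>, u) \<Rightarrow> \<epsilon> 0 \<omega> u) \<partial>(M \<Otimes>\<^sub>M \<mu>))
        = expectation (\<lambda>\<omega>. indicator A \<omega> * ip (indicator B) (\<epsilon> 0 \<omega>))"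
      unfolding MU.integral_fst'[OF int, symmetric] ip_def by (simp add: indicator_times mult.assoc)
    also have "\<dots> = expectation (\<lambda>\<omega>. 0)"
      by (intro integral_cong_AE) (use ipA[of B] in \<open>auto simp: ip_def elim: eventually_mono\<close>)
    finally show "(\<integral>x. indicator (A \<times> B) x * (case x of (\<omega>, u) \<Rightarrow> \<epsilon> 0 \<omega> u) \<partial>(M \<Otimes>\<^sub>M \<mu>)) = 0" by simp
  qed
  then have "AE \<omega> in M. AE u in \<mu>. \<epsilon> 0 \<omega> u = 0" using MU.AE_pair by fastforce
  then have "AE u in \<mu>. AE \<omega> in M. \<epsilon> 0 \<omega> u = 0" by (subst MU.AE_commute[symmetric]) measurable
  then have "AE u in \<mu>. cov u u = 0"
    using AE_space
  proof eventually_elim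
    case (elim u)
    have [measurable]: "(\<lambda>\<omega>. \<epsilon> 0 \<omega> u) \<in> borel_measurable M"
      using elim(2) by (intro eps_measurable2[OF measurable_ident_sets[OF refl]]) simp
    have "expectation (\<lambda>\<omega>. \<epsilon> 0 \<omega> u * \<epsilon> 0 \<omega> u) = expectation (\<lambda>\<omega>. 0)"
      by (intro integral_cong_AE) (use elim in \<open>auto elim: eventually_mono\<close>)
    then show ?case by (simp add: cov_def)
  qed
  then have "\<kappa> = (\<integral>u. 0 \<partial>\<mu>)" unfolding \<kappa>_def by (intro integral_cong_AE) (auto simp: cov_def)
  with assms show False by simp
qed

section \<open>Second moments of squared norms, sums and remainders\<close>

definition Neps :: "int \<Rightarrow> 'a \<Rightarrow> real" where "Neps t \<omega> = ip (\<epsilon> t \<omega>) (\<epsilon> t \<omega>)"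

lemma Neps_measurable[measurable]: "Neps t \<in> borel_measurable M"
  unfolding Neps_def ip_def by measurable

lemma expectation_Neps: "expectation (Neps t) = \<kappa>" "integrable M (\<lambda>\<omega>. (Neps t \<omega>)\<^sup>2)" "integrable M (Neps t)"
  "expectation (\<lambda>\<omega>. (Neps t \<omega>)\<^sup>2) \<le> m4"
proof -
  have int: "integrable (M \<Otimes>\<^sub>M \<mu>) (\<lambda>(\<omega>, u). \<epsilon> t \<omega> u * \<epsilon> t \<omega> u)"
    using MU.P.integrable_lower_powers(2)[of "\<lambda>(\<omega>, u). \<epsilon> t \<omega> u"] L4_eps[of t]
    by (simp add: L4_def split_beta' power2_eq_square)
  show "expectation (Neps t) = \<kappa>"
    unfolding Neps_def ip_def \<kappa>_def MU.Fubini_integral[OF int, symmetric] cov_eq ..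
  show "integrable M (Neps t)" unfolding Neps_def ip_def using MU.integrable_fst'[OF int] by simp
  show i2: "integrable M (\<lambda>\<omega>. (Neps t \<omega>)\<^sup>2)" unfolding Neps_def power2_eq_square
    using integrable_ip_mult_ip[of "\<lambda>_. 1", OF _ _ L4_eps[of t] L4_eps[of t] L4_eps[of t] L4_eps[of t]] by simp
  have i4: "integrable (M \<Otimes>\<^sub>M \<mu>) (\<lambda>(\<omega>, u). \<epsilon> t \<omega> u ^ 4)" using L4_eps by (simp add: L4_def)
  have "expectation (\<lambda>\<omega>. (Neps t \<omega>)\<^sup>2) \<le> expectation (\<lambda>\<omega>. \<integral>u. \<epsilon> t \<omega> u ^ 4 \<partial>\<mu>)"
  proof (rule integral_mono_AE[OF i2])
    show "integrable M (\<lambda>\<omega>. \<integral>u. \<epsilon> t \<omega> u ^ 4 \<partial>\<mu>)" using MU.integrable_fst'[OF i4] by simp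
    show "AE \<omega> in M. (Neps t \<omega>)\<^sup>2 \<le> (\<integral>u. \<epsilon> t \<omega> u ^ 4 \<partial>\<mu>)"
      using L4_AE_integrable(2)[OF L4_eps[of t]] AE_space
    proof eventually_elim
      case (elim \<omega>)
      then have \<omega>: "(\<lambda>_. \<omega>) \<in> measurable \<mu> M" by simp
      have "\<epsilon> t \<omega> \<in> borel_measurable \<mu>" using eps_measurable2[OF \<omega> measurable_ident_sets[OF refl]] by auto
      from U.square_expectation_le[OF U.integrable_lower_powers(2)[OF this elim(1)]] elim(1)
      show ?case by (simp add: Neps_def ip_def power2_eq_square[symmetric])
    qed
  qed
  also have "\<dots> = m4" using MU.integral_fst'[OF i4] integral_eps_pow4[of t] by (simp add: split_beta')
  finally show "expectation (\<lambda>\<omega>. (Neps t \<omega>)\<^sup>2) \<le> m4" .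
qed

lemma kappa_nonneg: "0 \<le> \<kappa>"
  by (subst expectation_Neps(1)[of 0, symmetric]) (simp add: Neps_def ip_def)

text \<open>\<open>Neps\<close> is not known to be a measurable functional of the coordinates, so
  independence of different times is again used at fixed points under the double integral. The
  result makes the centred squared norms orthogonal.\<close>

lemma expectation_Neps_mult:
  assumes "s < t"
  shows "expectation (\<lambda>\<omega>. Neps t \<omega> * Neps s \<omega>) = \<kappa>\<^sup>2"
proof -
  have intc: "integrable \<mu> (\<lambda>u. cov u u)"
  proof -
    have int: "integrable (M \<Otimes>\<^sub>M \<mu>) (\<lambda>(\<omega>, u). \<epsilon> 0 \<omega> u * \<epsilon> 0 \<omega> u)"
      using MU.P.integrable_lower_powers(2)[of "\<lambda>(\<omega>, u). \<epsilon> 0 \<omega> u"] L4_eps[of 0]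
      by (simp add: L4_def split_beta' power2_eq_square)
    show ?thesis using MU.integrable_snd[OF int] by (simp add: cov_def)
  qed
  define q where "q x = expectation (\<lambda>\<omega>. 1 * (\<epsilon> t \<omega> (fst x) * \<epsilon> t \<omega> (fst x) * (\<epsilon> s \<omega> (snd x) * \<epsilon> s \<omega> (snd x))))" for x
  have iq: "integrable (\<mu> \<Otimes>\<^sub>M \<mu>) q" unfolding q_def by (rule integrable_pair_expectation) (auto intro: L4_eps)
  have [measurable]: "(\<lambda>x. cov (fst x) (fst x) * cov (snd x) (snd x)) \<in> borel_measurable (\<mu> \<Otimes>\<^sub>M \<mu>)"
    unfolding cov_def by measurable
  have eq: "AE x in \<mu> \<Otimes>\<^sub>M \<mu>. q x = cov (fst x) (fst x) * cov (snd x) (snd x)"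
    using AE_pair_components[OF AE_good]
  proof eventually_elim
    case (elim x)
    have "expectation (\<lambda>\<omega>. (\<epsilon> s \<omega> (snd x) * \<epsilon> s \<omega> (snd x)) * (\<epsilon> t \<omega> (fst x) * \<epsilon> t \<omega> (fst x))) =
       expectation (\<lambda>\<omega>. \<epsilon> s \<omega> (snd x) * \<epsilon> s \<omega> (snd x)) * cov (fst x) (fst x)"
      using elim assms integrable_eps_mult(2) eps_past[of s s]
      by (intro expectation_past_mult_eps2[where k=s]) auto
    then show ?case by (simp add: q_def cov_eq mult.commute)
  qed
  have ic: "integrable (\<mu> \<Otimes>\<^sub>M \<mu>) (\<lambda>x. cov (fst x) (fst x) * cov (snd x) (snd x))"
    by (rule integrable_cong_AE_imp[OF iq]) (use eq in \<open>auto elim: eventually_mono\<close>)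
  have "expectation (\<lambda>\<omega>. 1 * (Neps t \<omega> * Neps s \<omega>)) = (\<integral>x. q x \<partial>(\<mu> \<Otimes>\<^sub>M \<mu>))"
    unfolding Neps_def q_def by (rule expectation_ip_mult_ip) (auto intro: L4_eps)
  also have "\<dots> = (\<integral>x. cov (fst x) (fst x) * cov (snd x) (snd x) \<partial>(\<mu> \<Otimes>\<^sub>M \<mu>))"
    by (rule integral_cong_AE) (use eq iq in auto)
  also have "\<dots> = \<kappa>\<^sup>2" unfolding UU.integral_fst'[OF ic, symmetric] by (simp add: \<kappa>_def power2_eq_square)
  finally show ?thesis by simp
qed

lemma sum_Neps:
  "integrable M (\<lambda>\<omega>. (\<Sum>j<n. Neps (int j + 1) \<omega> - \<kappa>)\<^sup>2)"
  "expectation (\<lambda>\<omega>. (\<Sum>j<n. Neps (int j + 1) \<omega> - \<kappa>)\<^sup>2) \<le> n * m4"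
proof -
  have sq: "(Neps t \<omega> - \<kappa>)\<^sup>2 = (Neps t \<omega>)\<^sup>2 - 2 * \<kappa> * Neps t \<omega> + \<kappa>\<^sup>2" for t \<omega>
    by (simp add: power2_eq_square algebra_simps)
  have pr: "(Neps t \<omega> - \<kappa>) * (Neps s \<omega> - \<kappa>) = Neps t \<omega> * Neps s \<omega> - \<kappa> * Neps t \<omega> - \<kappa> * Neps s \<omega> + \<kappa>\<^sup>2" for t s \<omega>
    by (simp add: power2_eq_square algebra_simps)
  have i2: "integrable M (\<lambda>\<omega>. (Neps t \<omega> - \<kappa>)\<^sup>2)" for t unfolding sq using expectation_Neps by simp
  have le: "expectation (\<lambda>\<omega>. (Neps t \<omega> - \<kappa>)\<^sup>2) \<le> m4" for t
  proof -
    have "expectation (\<lambda>\<omega>. (Neps t \<omega> - \<kappa>)\<^sup>2) = expectation (\<lambda>\<omega>. (Neps t \<omega>)\<^sup>2) - \<kappa>\<^sup>2"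
      unfolding sq using expectation_Neps[of t] by (simp add: prob_space power2_eq_square)
    then show ?thesis using expectation_Neps(4)[of t] zero_le_power2[of \<kappa>] by linarith
  qed
  have ist: "integrable M (\<lambda>\<omega>. Neps t \<omega> * Neps s \<omega>)" for t s
    by (rule square_integral_mult_le) (use expectation_Neps in auto)
  have orth: "expectation (\<lambda>\<omega>. (Neps t \<omega> - \<kappa>) * (Neps s \<omega> - \<kappa>)) = 0" if "s < t" for s t
    unfolding pr using expectation_Neps ist expectation_Neps_mult[OF that] by (simp add: prob_space power2_eq_square)
  show "integrable M (\<lambda>\<omega>. (\<Sum>j<n. Neps (int j + 1) \<omega> - \<kappa>)\<^sup>2)"
    "expectation (\<lambda>\<omega>. (\<Sum>j<n. Neps (int j + 1) \<omega> - \<kappa>)\<^sup>2) \<le> n * m4"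
    by (rule expectation_square_sum_le; use i2 le orth in auto)+
qed

lemma sum_X:
  "integrable M (\<lambda>\<omega>. (\<Sum>j<n. X (int j + 1) \<omega>)\<^sup>2)"
  "expectation (\<lambda>\<omega>. (\<Sum>j<n. X (int j + 1) \<omega>)\<^sup>2) \<le> n * (1 + KV * m4)"
proof -
  have i2: "integrable M (\<lambda>\<omega>. (X t \<omega>)\<^sup>2)" for t
    using integrable_lower_powers[OF X_measurable X_pow4(1)] by auto
  have le: "expectation (\<lambda>\<omega>. (X t \<omega>)\<^sup>2) \<le> 1 + KV * m4" for t
  proof -
    have "expectation (\<lambda>\<omega>. (X t \<omega>)\<^sup>2) \<le> expectation (\<lambda>\<omega>. 1 + X t \<omega> ^ 4)"
      using X_pow4[of t] by (intro integral_mono i2) (auto intro: square_le_one_plus_pow4)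
    also have "\<dots> \<le> 1 + KV * m4" using X_pow4[of t] by (simp add: prob_space)
    finally show ?thesis .
  qed
  have orth: "expectation (\<lambda>\<omega>. X t \<omega> * X s \<omega>) = 0" if "s < t" for s t
    using expectation_ip_innovation[of "\<lambda>_. 1" "t - 1" "V (t - 1)" "V (s - 1)" "\<epsilon> s" t] that
    by (simp add: X_def adapted_V adapted_eps)
  show "integrable M (\<lambda>\<omega>. (\<Sum>j<n. X (int j + 1) \<omega>)\<^sup>2)"
    "expectation (\<lambda>\<omega>. (\<Sum>j<n. X (int j + 1) \<omega>)\<^sup>2) \<le> n * (1 + KV * m4)"
    by (rule expectation_square_sum_le; use i2 le orth in auto)+
qed

text \<open>The dominating quantity \<open>q\<close> of \<open>scalar_ar1\<close> for x_j =
  \<open>V j\<close> and e_j = \<open>\<epsilon> (j + 1)\<close> at the point u.\<close>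

definition qrem :: "nat \<Rightarrow> 'a \<Rightarrow> 'b \<Rightarrow> real" where
  "qrem n \<omega> u = (V 0 \<omega> u)\<^sup>2 + (V (int n) \<omega> u)\<^sup>2 + (\<epsilon> 1 \<omega> u)\<^sup>2 + (\<Sum>j<n. \<epsilon> (int j + 1) \<omega> u)\<^sup>2 / n"

lemma qrem_measurable2[measurable (raw)]:
  assumes [measurable]: "f \<in> measurable N M" "g \<in> measurable N \<mu>"
  shows "(\<lambda>x. qrem n (f x) (g x)) \<in> borel_measurable N"
  unfolding qrem_def by measurable

text \<open>Uniform in n: the innovations are orthogonal in L^2 of
  \<open>M \<Otimes>\<^sub>M \<mu>\<close>, so the squared sum grows linearly and its quotient by n
  stays bounded.\<close>

lemma qrem:
  "integrable (M \<Otimes>\<^sub>M \<mu>) (\<lambda>(\<omega>, u). qrem n \<omega> u)"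
  "expectation (\<lambda>\<omega>. \<integral>u. qrem n \<omega> u \<partial>\<mu>) \<le> 2 * (1 + KV) + 2 * (1 + m4)"
proof -
  have sqV: "integrable (M \<Otimes>\<^sub>M \<mu>) (\<lambda>x. (V t (fst x) (snd x))\<^sup>2)" "(\<integral>x. (V t (fst x) (snd x))\<^sup>2 \<partial>(M \<Otimes>\<^sub>M \<mu>)) \<le> 1 + KV" for t
  proof -
    have i4: "integrable (M \<Otimes>\<^sub>M \<mu>) (\<lambda>x. V t (fst x) (snd x) ^ 4)" using L4_V[of t] by (simp add: L4_def split_beta')
    show i: "integrable (M \<Otimes>\<^sub>M \<mu>) (\<lambda>x. (V t (fst x) (snd x))\<^sup>2)" by (rule MU.P.integrable_lower_powers(2)[OF _ i4]) measurable
    have "(\<integral>x. (V t (fst x) (snd x))\<^sup>2 \<partial>(M \<Otimes>\<^sub>M \<mu>)) \<le> (\<integral>x. 1 + V t (fst x) (snd x) ^ 4 \<partial>(M \<Otimes>\<^sub>M \<mu>))"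
      using i4 by (intro integral_mono i) (auto intro: square_le_one_plus_pow4)
    also have "\<dots> \<le> 1 + KV" using i4 integral_V_pow4[of t] by (simp add: MU.P.prob_space)
    finally show "(\<integral>x. (V t (fst x) (snd x))\<^sup>2 \<partial>(M \<Otimes>\<^sub>M \<mu>)) \<le> 1 + KV" .
  qed
  have sqe: "integrable (M \<Otimes>\<^sub>M \<mu>) (\<lambda>x. (\<epsilon> t (fst x) (snd x))\<^sup>2)" "(\<integral>x. (\<epsilon> t (fst x) (snd x))\<^sup>2 \<partial>(M \<Otimes>\<^sub>M \<mu>)) \<le> 1 + m4" for t
  proof -
    have i4: "integrable (M \<Otimes>\<^sub>M \<mu>) (\<lambda>x. \<epsilon> t (fst x) (snd x) ^ 4)" using L4_eps[of t] by (simp add: L4_def split_beta')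
    show i: "integrable (M \<Otimes>\<^sub>M \<mu>) (\<lambda>x. (\<epsilon> t (fst x) (snd x))\<^sup>2)" by (rule MU.P.integrable_lower_powers(2)[OF _ i4]) measurable
    have "(\<integral>x. (\<epsilon> t (fst x) (snd x))\<^sup>2 \<partial>(M \<Otimes>\<^sub>M \<mu>)) \<le> (\<integral>x. 1 + \<epsilon> t (fst x) (snd x) ^ 4 \<partial>(M \<Otimes>\<^sub>M \<mu>))"
      using i4 by (intro integral_mono i) (auto intro: square_le_one_plus_pow4)
    also have "\<dots> \<le> 1 + m4" using i4 integral_eps_pow4[of t] by (simp add: MU.P.prob_space)
    finally show "(\<integral>x. (\<epsilon> t (fst x) (snd x))\<^sup>2 \<partial>(M \<Otimes>\<^sub>M \<mu>)) \<le> 1 + m4" .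
  qed
  have orth: "(\<integral>x. \<epsilon> t (fst x) (snd x) * \<epsilon> s (fst x) (snd x) \<partial>(M \<Otimes>\<^sub>M \<mu>)) = 0" if "s < t" for s t
  proof -
    have int: "integrable (M \<Otimes>\<^sub>M \<mu>) (\<lambda>x. \<epsilon> t (fst x) (snd x) * \<epsilon> s (fst x) (snd x))"
      by (rule square_integral_mult_le) (use sqe in auto)
    have "expectation (\<lambda>\<omega>. 1 * (ip (\<epsilon> s \<omega>) (\<epsilon> t \<omega>) * ip (\<lambda>_. 1) (\<lambda>_. 1))) = 0"
      using that by (intro expectation_ip_innovation[where k=s] adapted_eps adapted_const) auto
    then have "expectation (\<lambda>\<omega>. \<integral>u. \<epsilon> t \<omega> u * \<epsilon> s \<omega> u \<partial>\<mu>) = 0" by (simp add: ip_def U.prob_space mult.commute)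
    then show ?thesis using MU.integral_fst'[OF int] by simp
  qed
  have S: "integrable (M \<Otimes>\<^sub>M \<mu>) (\<lambda>x. (\<Sum>j<n. \<epsilon> (int j + 1) (fst x) (snd x))\<^sup>2)"
    "(\<integral>x. (\<Sum>j<n. \<epsilon> (int j + 1) (fst x) (snd x))\<^sup>2 \<partial>(M \<Otimes>\<^sub>M \<mu>)) \<le> n * (1 + m4)"
    by (rule MU.P.expectation_square_sum_le; use sqe orth in auto)+
  show int: "integrable (M \<Otimes>\<^sub>M \<mu>) (\<lambda>(\<omega>, u). qrem n \<omega> u)"
    unfolding qrem_def split_beta' using S(1) sqV sqe by auto
  have "expectation (\<lambda>\<omega>. \<integral>u. qrem n \<omega> u \<partial>\<mu>) = (\<integral>x. qrem n (fst x) (snd x) \<partial>(M \<Otimes>\<^sub>M \<mu>))"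
    using MU.integral_fst'[OF int] by (simp add: split_beta')
  also have "\<dots> = (\<integral>x. (V 0 (fst x) (snd x))\<^sup>2 \<partial>(M \<Otimes>\<^sub>M \<mu>)) + (\<integral>x. (V (int n) (fst x) (snd x))\<^sup>2 \<partial>(M \<Otimes>\<^sub>M \<mu>))
      + (\<integral>x. (\<epsilon> 1 (fst x) (snd x))\<^sup>2 \<partial>(M \<Otimes>\<^sub>M \<mu>)) + (\<integral>x. (\<Sum>j<n. \<epsilon> (int j + 1) (fst x) (snd x))\<^sup>2 \<partial>(M \<Otimes>\<^sub>M \<mu>)) / n"
    unfolding qrem_def using S(1) sqV sqe by simp
  also have "\<dots> \<le> (1 + KV) + (1 + KV) + (1 + m4) + (1 + m4)"
  proof (intro add_mono sqV sqe)
    show "(\<integral>x. (\<Sum>j<n. \<epsilon> (int j + 1) (fst x) (snd x))\<^sup>2 \<partial>(M \<Otimes>\<^sub>M \<mu>)) / n \<le> 1 + m4"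
      using S(2) m4_nonneg by (cases "n = 0") (auto simp: divide_le_eq mult.commute)
  qed
  finally show "expectation (\<lambda>\<omega>. \<integral>u. qrem n \<omega> u \<partial>\<mu>) \<le> 2 * (1 + KV) + 2 * (1 + m4)" by simp
qed

end

section \<open>The ratio of empirical autocovariances\<close>

lemma (in prob_space) square_integrable_add:
  fixes g h :: "'a \<Rightarrow> real"
  assumes [measurable]: "g \<in> borel_measurable M" "h \<in> borel_measurable M"
    and "integrable M (\<lambda>x. (g x)\<^sup>2)" "integrable M (\<lambda>x. (h x)\<^sup>2)"
  shows "integrable M (\<lambda>x. (g x + h x)\<^sup>2)"
proof -
  have "integrable M (\<lambda>x. g x * h x)" by (rule square_integral_mult_le) (use assms in auto)
  then have "integrable M (\<lambda>x. (g x)\<^sup>2 + (h x)\<^sup>2 + 2 * (g x * h x))" using assms by auto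
  then show ?thesis by (simp add: power2_sum mult.assoc)
qed

lemma (in prob_space) square_integrable_sum:
  fixes g :: "nat \<Rightarrow> 'a \<Rightarrow> real"
  assumes [measurable]: "\<And>j. g j \<in> borel_measurable M" and "\<And>j. integrable M (\<lambda>x. (g j x)\<^sup>2)"
  shows "integrable M (\<lambda>x. (\<Sum>j<n. g j x)\<^sup>2)"
proof (induction n)
  case (Suc n)
  have "integrable M (\<lambda>x. ((\<Sum>j<n. g j x) + g n x)\<^sup>2)"
    by (rule square_integrable_add) (use Suc assms in auto)
  then show ?case by simp
qed simp

text \<open>From |Z| \<le> sqrt n + Z^2 / sqrt n, which trades a root of the second moment for a
  harmless constant.\<close>

lemma (in prob_space) expectation_abs_le:
  fixes Z :: "'a \<Rightarrow> real"
  assumes [measurable]: "Z \<in> borel_measurable M" and i: "integrable M (\<lambda>\<omega>. (Z \<omega>)\<^sup>2)"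
    and le: "expectation (\<lambda>\<omega>. (Z \<omega>)\<^sup>2) \<le> real n * K" and n: "0 < n"
  shows "integrable M (\<lambda>\<omega>. \<bar>Z \<omega>\<bar>)" "expectation (\<lambda>\<omega>. \<bar>Z \<omega>\<bar>) \<le> sqrt n * (1 + K)"
proof -
  have pt: "\<bar>Z \<omega>\<bar> \<le> sqrt n + (Z \<omega>)\<^sup>2 / sqrt n" for \<omega>
  proof -
    have s: "0 < sqrt n" using n by simp
    have "0 \<le> (sqrt n - \<bar>Z \<omega>\<bar>)\<^sup>2" by simp
    then have "2 * (sqrt n * \<bar>Z \<omega>\<bar>) \<le> n + (Z \<omega>)\<^sup>2" by (simp add: power2_diff)
    moreover have "0 \<le> sqrt n * \<bar>Z \<omega>\<bar>" by simp
    ultimately have "sqrt n * \<bar>Z \<omega>\<bar> \<le> n + (Z \<omega>)\<^sup>2" by linarith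
    then have "\<bar>Z \<omega>\<bar> \<le> (n + (Z \<omega>)\<^sup>2) / sqrt n" using s by (simp add: le_divide_eq mult.commute)
    also have "\<dots> = sqrt n + (Z \<omega>)\<^sup>2 / sqrt n" by (simp add: add_divide_distrib real_div_sqrt)
    finally show ?thesis .
  qed
  have i2: "integrable M (\<lambda>\<omega>. sqrt n + (Z \<omega>)\<^sup>2 / sqrt n)" using i by simp
  show i1: "integrable M (\<lambda>\<omega>. \<bar>Z \<omega>\<bar>)"
    by (rule Bochner_Integration.integrable_bound[OF i2]) (use pt in \<open>auto intro!: AE_I2 intro: order_trans[OF _ abs_ge_self]\<close>)
  have "expectation (\<lambda>\<omega>. \<bar>Z \<omega>\<bar>) \<le> expectation (\<lambda>\<omega>. sqrt n + (Z \<omega>)\<^sup>2 / sqrt n)" by (intro integral_mono i1 i2 pt)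
  also have "\<dots> = sqrt n + expectation (\<lambda>\<omega>. (Z \<omega>)\<^sup>2) / sqrt n" using i by (simp add: prob_space)
  also have "\<dots> \<le> sqrt n + (real n * K) / sqrt n" using le by (intro add_left_mono divide_right_mono) auto
  also have "(real n * K) / sqrt n = sqrt n * K" using n by (simp add: field_simps)
  finally show "expectation (\<lambda>\<omega>. \<bar>Z \<omega>\<bar>) \<le> sqrt n * (1 + K)" by (simp add: algebra_simps)
qed

lemma (in prob_space) markov_bound:
  fixes Z :: "'a \<Rightarrow> real"
  assumes "integrable M Z" "\<And>\<omega>. 0 \<le> Z \<omega>" "0 < a" "expectation Z \<le> B"
  shows "prob {\<omega> \<in> space M. a \<le> Z \<omega>} \<le> B / a"
proof -
  have "prob {\<omega> \<in> space M. a \<le> Z \<omega>} \<le> expectation Z / a"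
    using assms by (intro integral_Markov_inequality_measure[where A="{}"]) auto
  also have "\<dots> \<le> B / a" using assms by (intro divide_right_mono) auto
  finally show ?thesis .
qed

text \<open>The deterministic half of the Slutsky step. The normalised denominator d lies within
  \<delta> of k, and with A = (nm - b d0) / sqrt n, B = SX / sqrt n the quantity to bound is (1 -
  b^2) (A/d - B/k). The split (A - B)/d + B (k - d)/(d k) gives two parts of at most e/2 each;
  \<delta> < k/2 keeps d away from zero and g is a free bound for |B|.\<close>

lemma ratio_linearization:
  fixes nm d0 b k SX SN Q g e :: real and n :: nat
  assumes b: "\<bar>b\<bar> < 1" and k: "0 < k" and n: "0 < n" and Q: "0 \<le> Q" and e: "0 < e" and g: "0 < g"
    and num: "\<bar>nm - b * d0 - SX\<bar> \<le> Q" and den: "\<bar>(1 - b\<^sup>2) * d0 - (SN + n * k) - 2 * b * SX\<bar> \<le> Q"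
    and \<delta>: "\<delta> = (\<bar>SN\<bar> + 2 * \<bar>SX\<bar> + Q) / n"
    and h: "\<delta> < k / 2" "\<delta> < e * k\<^sup>2 / (4 * g)" "\<bar>SX\<bar> / sqrt n < g" "Q / sqrt n < e * k / 4"
  shows "\<bar>sqrt n * (nm / d0 - b) - (1 - b\<^sup>2) / k * (SX / sqrt n)\<bar> \<le> e"
proof -
  define d where "d = (1 - b\<^sup>2) * d0 / n"
  define A B where "A = (nm - b * d0) / sqrt n" and "B = SX / sqrt n"
  have b2: "0 < 1 - b\<^sup>2" "1 - b\<^sup>2 \<le> 1" using b abs_square_less_1[of b] by auto
  have n0: "0 < real n" "0 < sqrt n" using n by auto
  have \<delta>0: "0 \<le> \<delta>" using Q by (simp add: \<delta>)
  have dk: "\<bar>d - k\<bar> \<le> \<delta>"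
  proof -
    have "2 * \<bar>b * SX\<bar> \<le> 2 * \<bar>SX\<bar>" using b by (simp add: abs_mult mult_left_le_one_le)
    then have "\<bar>(1 - b\<^sup>2) * d0 - n * k\<bar> \<le> \<bar>SN\<bar> + 2 * \<bar>SX\<bar> + Q" using den by linarith
    then have "\<bar>(1 - b\<^sup>2) * d0 - n * k\<bar> / n \<le> \<delta>" unfolding \<delta> using n0 by (intro divide_right_mono) auto
    moreover have "d - k = ((1 - b\<^sup>2) * d0 - n * k) / n" using n0 by (simp add: d_def diff_divide_distrib)
    ultimately show ?thesis using n0 by (simp add: abs_divide)
  qed
  then have d: "k / 2 \<le> d" "0 < d" using h(1) k by linarith+
  have d0: "d0 = n * d / (1 - b\<^sup>2)" using n0 b2 by (simp add: d_def)
  then have d0p: "0 < d0" using d b2 n0 by simp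
  have "sqrt n * (nm / d0 - b) = sqrt n * (nm - b * d0) / d0" using d0p by (simp add: field_simps)
  also have "\<dots> = (1 - b\<^sup>2) * (A / d)"
  proof -
    have "sqrt n * X / (n * d / (1 - b\<^sup>2)) = (1 - b\<^sup>2) * (X / sqrt n / d)" for X
      using n0 b2 d by (simp add: divide_simps)
    from this[of "nm - b * d0"] show ?thesis by (simp only: A_def d0[symmetric])
  qed
  finally have "sqrt n * (nm / d0 - b) - (1 - b\<^sup>2) / k * (SX / sqrt n) = (1 - b\<^sup>2) * (A / d - B / k)"
    by (simp add: B_def right_diff_distrib)
  also have "A / d - B / k = (A - B) / d + B * (k - d) / (d * k)" using d k by (simp add: field_simps)
  finally have eq: "\<bar>sqrt n * (nm / d0 - b) - (1 - b\<^sup>2) / k * (SX / sqrt n)\<bar> = (1 - b\<^sup>2) * \<bar>(A - B) / d + B * (k - d) / (d * k)\<bar>"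
    using b2 by (simp add: abs_mult)
  have t1: "\<bar>(A - B) / d\<bar> \<le> e / 2"
  proof -
    have "A - B = (nm - b * d0 - SX) / sqrt n" by (simp add: A_def B_def diff_divide_distrib)
    then have "\<bar>A - B\<bar> \<le> Q / sqrt n" using num n0 by (simp add: abs_divide divide_right_mono)
    then have "\<bar>A - B\<bar> \<le> e * k / 4" using h(4) by linarith
    also have "\<dots> \<le> (e / 2) * d" using mult_left_mono[OF d(1), of "e / 2"] e by simp
    finally show ?thesis using d by (simp add: abs_divide divide_le_eq)
  qed
  have t2: "\<bar>B * (k - d) / (d * k)\<bar> \<le> e / 2"
  proof -
    have "\<bar>B\<bar> \<le> g" using h(3) n0 by (simp add: B_def abs_divide)
    then have "\<bar>B * (k - d)\<bar> \<le> g * \<delta>" unfolding abs_mult using dk g by (intro mult_mono) auto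
    also have "\<dots> \<le> g * (e * k\<^sup>2 / (4 * g))" using h(2) g by (intro mult_left_mono) auto
    also have "\<dots> = (e / 2) * (k / 2 * k)" using g by (simp add: power2_eq_square)
    also have "\<dots> \<le> (e / 2) * (d * k)" using d e k by (intro mult_left_mono mult_right_mono) auto
    finally have "\<bar>B * (k - d)\<bar> / (d * k) \<le> e / 2" using d k by (simp add: divide_le_eq)
    moreover have "0 < d * k" using d k by simp
    ultimately show ?thesis by (simp only: abs_divide abs_of_pos)
  qed
  have "(1 - b\<^sup>2) * \<bar>(A - B) / d + B * (k - d) / (d * k)\<bar> \<le> \<bar>(A - B) / d + B * (k - d) / (d * k)\<bar>"
    using b2 by (intro mult_left_le_one_le) auto
  also have "\<dots> \<le> e" using t1 t2 by linarith
  finally show ?thesis unfolding eq .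
qed

section \<open>Numerator, denominator and the limit law of their ratio\<close>

context functional_ar1
begin

definition vb :: "nat \<Rightarrow> 'a \<Rightarrow> 'b \<Rightarrow> real" where
  "vb n \<omega> u = (\<Sum>j<n. V (int (Suc j)) \<omega> u) / n"

text \<open>The factor 1/n of the empirical autocovariances is left out here and in
  \<open>den\<close>, as it cancels in the ratio.\<close>

definition num :: "nat \<Rightarrow> 'a \<Rightarrow> real" where
  "num n \<omega> = (\<integral>u. (\<Sum>j<n - 1. (V (int (Suc j)) \<omega> u - vb n \<omega> u) * (V (int (Suc (Suc j))) \<omega> u - vb n \<omega> u)) \<partial>\<mu>)"

definition den :: "nat \<Rightarrow> 'a \<Rightarrow> real" where
  "den n \<omega> = (\<integral>u. (\<Sum>j<n. (V (int (Suc j)) \<omega> u - vb n \<omega> u)\<^sup>2) \<partial>\<mu>)"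

text \<open>The constant \<open>20 + 20 * c\<close> of the scalar bounds for b = \<beta>.\<close>

definition Kc :: real where "Kc = 20 + 20 * (3 / (1 - \<beta>)\<^sup>2)"

lemma Kc_nonneg: "0 \<le> Kc" by (simp add: Kc_def)

lemma AE_square_integrable:
  "AE \<omega> in M. \<forall>t. integrable \<mu> (\<lambda>u. (V t \<omega> u)\<^sup>2) \<and> integrable \<mu> (\<lambda>u. (\<epsilon> t \<omega> u)\<^sup>2)
     \<and> V t \<omega> \<in> borel_measurable \<mu> \<and> \<epsilon> t \<omega> \<in> borel_measurable \<mu>"
proof -
  have "AE \<omega> in M. \<forall>t. integrable \<mu> (\<lambda>u. V t \<omega> u ^ 4)"
    by (subst AE_all_countable) (use L4_AE_integrable(2)[OF L4_V] in auto)
  moreover have "AE \<omega> in M. \<forall>t. integrable \<mu> (\<lambda>u. \<epsilon> t \<omega> u ^ 4)"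
    by (subst AE_all_countable) (use L4_AE_integrable(2)[OF L4_eps] in auto)
  ultimately show ?thesis
    using AE_space
  proof eventually_elim
    case (elim \<omega>)
    then have \<omega>: "(\<lambda>_. \<omega>) \<in> measurable \<mu> M" by simp
    have "V t \<omega> \<in> borel_measurable \<mu>" "\<epsilon> t \<omega> \<in> borel_measurable \<mu>" for t
      using V_measurable2[OF \<omega> measurable_ident_sets[OF refl]] eps_measurable2[OF \<omega> measurable_ident_sets[OF refl]] by auto
    then show ?case using elim U.integrable_lower_powers(2) by auto
  qed
qed

lemma AE_num_den_bounds:
  assumes n: "0 < n"
  shows "AE \<omega> in M. \<bar>num n \<omega> - \<beta> * den n \<omega> - (\<Sum>j<n. X (int j + 1) \<omega>)\<bar> \<le> Kc * (\<integral>u. qrem n \<omega> u \<partial>\<mu>) \<and>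
    \<bar>(1 - \<beta>\<^sup>2) * den n \<omega> - ((\<Sum>j<n. Neps (int j + 1) \<omega> - \<kappa>) + n * \<kappa>) - 2 * \<beta> * (\<Sum>j<n. X (int j + 1) \<omega>)\<bar> \<le> Kc * (\<integral>u. qrem n \<omega> u \<partial>\<mu>)"
proof -
  obtain m where m: "n = Suc m" using n by (cases n) auto
  have rec: "AE \<omega> in M. AE u in \<mu>. \<forall>t. V t \<omega> u = \<beta> * V (t - 1) \<omega> u + \<epsilon> t \<omega> u"
    using MU.AE_pair[OF AE_V_rec] by simp
  show ?thesis
    using AE_square_integrable rec
  proof eventually_elim
    case (elim \<omega>)
    have V2: "integrable \<mu> (\<lambda>u. (V t \<omega> u)\<^sup>2)" and E2: "integrable \<mu> (\<lambda>u. (\<epsilon> t \<omega> u)\<^sup>2)"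
      and [measurable]: "V t \<omega> \<in> borel_measurable \<mu>" "\<epsilon> t \<omega> \<in> borel_measurable \<mu>" for t
      using elim(1) by auto
    have [measurable]: "vb n \<omega> \<in> borel_measurable \<mu>" unfolding vb_def by measurable
    have vb2: "integrable \<mu> (\<lambda>u. (- vb n \<omega> u)\<^sup>2)"
      unfolding vb_def power2_minus power_divide by (intro integrable_divide U.square_integrable_sum V2) auto
    have dev2: "integrable \<mu> (\<lambda>u. (V t \<omega> u - vb n \<omega> u)\<^sup>2)" for t
      using U.square_integrable_add[OF _ _ V2[of t] vb2] by simp
    have dev: "integrable \<mu> (\<lambda>u. (V t \<omega> u - vb n \<omega> u) * (V s \<omega> u - vb n \<omega> u))" for t s
      by (rule square_integral_mult_le) (use dev2 in auto)
    have VE: "integrable \<mu> (\<lambda>u. V t \<omega> u * \<epsilon> s \<omega> u)" for t s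
      by (rule square_integral_mult_le) (use V2 E2 in auto)
    have q: "integrable \<mu> (\<lambda>u. Kc * qrem n \<omega> u)"
      unfolding qrem_def using V2 E2 U.square_integrable_sum[of "\<lambda>j. \<epsilon> (int j + 1) \<omega>" n] by auto
    define fN where "fN u = (\<Sum>j<n - 1. (V (int (Suc j)) \<omega> u - vb n \<omega> u) * (V (int (Suc (Suc j))) \<omega> u - vb n \<omega> u))" for u
    define fD where "fD u = (\<Sum>j<n. (V (int (Suc j)) \<omega> u - vb n \<omega> u)\<^sup>2)" for u
    define fX where "fX u = (\<Sum>j<n. V (int j) \<omega> u * \<epsilon> (int j + 1) \<omega> u)" for u
    define fE where "fE u = (\<Sum>j<n. (\<epsilon> (int j + 1) \<omega> u)\<^sup>2)" for u
    have int: "integrable \<mu> fN" "integrable \<mu> fD" "integrable \<mu> fX" "integrable \<mu> fE"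
      unfolding fN_def fD_def fX_def fE_def by (intro Bochner_Integration.integrable_sum dev dev2 VE E2)+
    have X: "(\<Sum>j<n. X (int j + 1) \<omega>) = (\<integral>u. fX u \<partial>\<mu>)"
      unfolding fX_def X_def ip_def by (subst Bochner_Integration.integral_sum) (use VE in auto)
    have E: "(\<Sum>j<n. Neps (int j + 1) \<omega>) = (\<integral>u. fE u \<partial>\<mu>)"
      unfolding fE_def Neps_def ip_def power2_eq_square[symmetric]
      by (subst Bochner_Integration.integral_sum) (use E2 in auto)
    have N: "num n \<omega> = (\<integral>u. fN u \<partial>\<mu>)" and D: "den n \<omega> = (\<integral>u. fD u \<partial>\<mu>)"
      by (simp_all add: num_def den_def fN_def fD_def)
    have pt: "AE u in \<mu>. \<bar>fN u - \<beta> * fD u - fX u\<bar> \<le> Kc * qrem n \<omega> u \<and>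
        \<bar>(1 - \<beta>\<^sup>2) * fD u - fE u - 2 * \<beta> * fX u\<bar> \<le> Kc * qrem n \<omega> u"
      using elim(2)
    proof eventually_elim
      case (elim u)
      \<comment> \<open>The innovation is shifted by one: step j leads from \<open>V j\<close> to
        \<open>V (j + 1)\<close> and uses \<open>\<epsilon> (j + 1)\<close>. The pointwise bounds
        are integrated over u afterwards.\<close>
      have S: "scalar_ar1 (\<lambda>j. V (int j) \<omega> u) (\<lambda>j. \<epsilon> (int j + 1) \<omega> u) \<beta>"
      proof
        show "V (int (Suc j)) \<omega> u = \<beta> * V (int j) \<omega> u + \<epsilon> (int j + 1) \<omega> u" for j
          using elim[rule_format, of "int j + 1"] by (simp add: add.commute)
      qed (use beta in auto)
      show ?case
        using scalar_ar1.numerator_bound[OF S, of m] scalar_ar1.denominator_bound[OF S, of m]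
        unfolding fN_def fD_def fX_def fE_def vb_def qrem_def Kc_def m by simp
    qed
    have bnd: "\<bar>\<integral>u. h u \<partial>\<mu>\<bar> \<le> Kc * (\<integral>u. qrem n \<omega> u \<partial>\<mu>)"
      if "integrable \<mu> h" "AE u in \<mu>. \<bar>h u\<bar> \<le> Kc * qrem n \<omega> u" for h
    proof -
      have "\<bar>\<integral>u. h u \<partial>\<mu>\<bar> \<le> (\<integral>u. \<bar>h u\<bar> \<partial>\<mu>)" by (rule integral_abs_bound)
      also have "\<dots> \<le> (\<integral>u. Kc * qrem n \<omega> u \<partial>\<mu>)" using that q by (intro integral_mono_AE) auto
      finally show ?thesis by simp
    qed
    have 1: "num n \<omega> - \<beta> * den n \<omega> - (\<Sum>j<n. X (int j + 1) \<omega>) = (\<integral>u. fN u - \<beta> * fD u - fX u \<partial>\<mu>)"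
      unfolding X N D using int by simp
    have 2: "(1 - \<beta>\<^sup>2) * den n \<omega> - ((\<Sum>j<n. Neps (int j + 1) \<omega> - \<kappa>) + n * \<kappa>) - 2 * \<beta> * (\<Sum>j<n. X (int j + 1) \<omega>)
        = (\<integral>u. (1 - \<beta>\<^sup>2) * fD u - fE u - 2 * \<beta> * fX u \<partial>\<mu>)"
      unfolding sum_subtractf X D E using int by simp
    show ?case unfolding 1 2
      by (intro conjI bnd) (use pt int in \<open>auto elim: eventually_mono\<close>)
  qed
qed

theorem ratio_weak_conv_normal:
  fixes bn :: "nat \<Rightarrow> 'a \<Rightarrow> real"
  assumes meas: "\<And>n. 0 < n \<Longrightarrow> bn n \<in> borel_measurable M" and \<kappa>: "\<kappa> \<noteq> 0"
    and bn: "\<And>n. 0 < n \<Longrightarrow> AE \<omega> in M. bn n \<omega> = num n \<omega> / den n \<omega>"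
  shows "weak_conv_m (\<lambda>n. distr M borel (\<lambda>\<omega>. sqrt (real n) * (bn n \<omega> - \<beta>)))
           (density lborel (normal_density 0 (sqrt (C2 / \<kappa>\<^sup>2 * (1 - \<beta>\<^sup>2)))))"
proof -
  define s where "s = sqrt (C2 / \<kappa>\<^sup>2 * (1 - \<beta>\<^sup>2))"
  define SX where "SX n \<omega> = (\<Sum>j<n. X (int j + 1) \<omega>)" for n \<omega>
  define SN where "SN n \<omega> = (\<Sum>j<n. Neps (int j + 1) \<omega> - \<kappa>)" for n \<omega>
  define Q where "Q n \<omega> = Kc * (\<integral>u. qrem n \<omega> u \<partial>\<mu>)" for n \<omega>
  define Y where "Y n \<omega> = sqrt (real n) * (bn n \<omega> - \<beta>)" for n \<omega>
  define Z where "Z n \<omega> = (1 - \<beta>\<^sup>2) / \<kappa> * (SX n \<omega> / sqrt n)" for n \<omega>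
  define \<delta> where "\<delta> n \<omega> = (\<bar>SN n \<omega>\<bar> + 2 * \<bar>SX n \<omega>\<bar> + Q n \<omega>) / n" for n \<omega>
  define K1 where "K1 = 1 + KV * m4"
  define Kq where "Kq = Kc * (2 * (1 + KV) + 2 * (1 + m4))"
  define c1 where "c1 = (1 + m4) + 2 * (1 + K1) + Kq"
  have k: "0 < \<kappa>" using \<kappa> kappa_nonneg by simp
  have b2: "0 < 1 - \<beta>\<^sup>2" using beta abs_square_less_1[of \<beta>] by auto
  have s: "0 < s" unfolding s_def using C2_pos[OF \<kappa>] b2 k by simp
  have s2: "s\<^sup>2 = C2 / \<kappa>\<^sup>2 * (1 - \<beta>\<^sup>2)" unfolding s_def using C2_pos[OF \<kappa>] b2 by simp
  have nn: "0 \<le> K1" "0 \<le> Kq" "0 \<le> c1" using KV_nonneg m4_nonneg Kc_nonneg by (auto simp: K1_def Kq_def c1_def)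
  have [measurable]: "SX n \<in> borel_measurable M" "SN n \<in> borel_measurable M" "Q n \<in> borel_measurable M" for n
    unfolding SX_def SN_def Q_def by measurable
  \<comment> \<open>For n = 0 the factor sqrt 0 makes \<open>Y\<close> vanish, so nothing about
    \<open>bn 0\<close> enters.\<close>
  have [measurable]: "Y n \<in> borel_measurable M" for n
    unfolding Y_def using meas[of n] by (cases "n = 0") auto
  have [measurable]: "Z n \<in> borel_measurable M" for n unfolding Z_def by measurable
  have qint: "integrable M (Q n)" and qE: "expectation (Q n) \<le> Kq" for n
  proof -
    show "integrable M (Q n)" unfolding Q_def using MU.integrable_fst'[OF qrem(1)[of n]] by simp
    show "expectation (Q n) \<le> Kq" unfolding Q_def Kq_def
      using qrem(2)[of n] Kc_nonneg by (simp add: mult_left_mono)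
  qed
  have q0: "0 \<le> Q n \<omega>" for n \<omega>
    unfolding Q_def qrem_def by (intro mult_nonneg_nonneg Kc_nonneg Bochner_Integration.integral_nonneg) auto
  have sxE: "integrable M (\<lambda>\<omega>. (SX n \<omega>)\<^sup>2)" "expectation (\<lambda>\<omega>. (SX n \<omega>)\<^sup>2) \<le> n * K1" for n
    unfolding SX_def K1_def by (rule sum_X)+
  have snE: "integrable M (\<lambda>\<omega>. (SN n \<omega>)\<^sup>2)" "expectation (\<lambda>\<omega>. (SN n \<omega>)\<^sup>2) \<le> n * m4" for n
    unfolding SN_def by (rule sum_Neps)+
  have \<delta>E: "integrable M (\<delta> n)" "expectation (\<delta> n) \<le> c1 / sqrt n" if n: "0 < n" for n
  proof -
    note ax = expectation_abs_le[of "SX n", OF _ sxE n] and an = expectation_abs_le[of "SN n", OF _ snE n]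
    show "integrable M (\<delta> n)" unfolding \<delta>_def using ax an qint by auto
    have "expectation (\<delta> n) = (expectation (\<lambda>\<omega>. \<bar>SN n \<omega>\<bar>) + 2 * expectation (\<lambda>\<omega>. \<bar>SX n \<omega>\<bar>) + expectation (Q n)) / n"
      unfolding \<delta>_def using ax an qint by simp
    also have "\<dots> \<le> (sqrt n * (1 + m4) + 2 * (sqrt n * (1 + K1)) + sqrt n * Kq) / n"
    proof (intro divide_right_mono add_mono mult_left_mono ax an)
      have "1 * Kq \<le> sqrt n * Kq" using nn n by (intro mult_right_mono) auto
      then show "expectation (Q n) \<le> sqrt n * Kq" using qE[of n] by simp
    qed auto
    also have "\<dots> = c1 * (sqrt n / n)" by (simp add: c1_def algebra_simps add_divide_distrib)
    also have "sqrt n / n = 1 / sqrt n" using n by (simp add: real_sqrt_divide field_simps)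
    finally show "expectation (\<delta> n) \<le> c1 / sqrt n" by simp
  qed
  have close: "(\<lambda>n. prob {\<omega> \<in> space M. e < \<bar>Y n \<omega> - Z n \<omega>\<bar>}) \<longlonglongrightarrow> 0" if e: "0 < e" for e
  proof -
    \<comment> \<open>The rate n^(-1/4). The threshold g = n^(1/4) for |SX| / sqrt n must grow so
      that exceeding it becomes unlikely, yet slowly enough that \<delta>, of mean O(n^(-1/2)),
      stays below a multiple of 1/g with high probability.\<close>
    define w where "w n = 1 / sqrt (sqrt (real n))" for n :: nat
    define p where "p n = (2 * c1 / \<kappa>) * (w n * w n) + (4 * c1 / (e * \<kappa>\<^sup>2)) * w n + K1 * (w n * w n) + (4 * Kq / (e * \<kappa>)) * (w n * w n)" for n
    have w: "w \<longlonglongrightarrow> 0"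
      unfolding w_def
      by (intro real_tendsto_divide_at_top[OF tendsto_const] filterlim_compose[OF sqrt_at_top]
            filterlim_compose[OF sqrt_at_top filterlim_real_sequentially])
    have "p \<longlonglongrightarrow> (2 * c1 / \<kappa>) * (0 * 0) + (4 * c1 / (e * \<kappa>\<^sup>2)) * 0 + K1 * (0 * 0) + (4 * Kq / (e * \<kappa>)) * (0 * 0)"
      unfolding p_def by (intro tendsto_add tendsto_mult tendsto_const w)
    then have p0: "p \<longlonglongrightarrow> 0" by simp
    have "prob {\<omega> \<in> space M. e < \<bar>Y n \<omega> - Z n \<omega>\<bar>} \<le> p n" if n: "0 < n" for n
    proof -
      define g where "g = sqrt (sqrt n)"
      have g: "0 < g" "g * g = sqrt n" using n by (auto simp: g_def)
      have wg: "w n = 1 / g" by (simp add: w_def g_def)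
      have ww: "w n * w n = 1 / sqrt n" using g by (simp add: wg)
      have [measurable]: "\<delta> n \<in> borel_measurable M" unfolding \<delta>_def by measurable
      \<comment> \<open>One bad event for each smallness condition of
        \<open>ratio_linearization\<close>; the third is stated with squares so that the Markov
        bound uses the second moment of \<open>SX\<close>.\<close>
      let ?A1 = "{\<omega> \<in> space M. \<kappa> / 2 \<le> \<delta> n \<omega>}" and ?A2 = "{\<omega> \<in> space M. e * \<kappa>\<^sup>2 / (4 * g) \<le> \<delta> n \<omega>}"
      let ?A3 = "{\<omega> \<in> space M. g * g \<le> (SX n \<omega>)\<^sup>2 / n}" and ?A4 = "{\<omega> \<in> space M. e * \<kappa> / 4 \<le> Q n \<omega> / sqrt n}"
      have \<delta>0: "0 \<le> \<delta> n \<omega>" for \<omega> unfolding \<delta>_def using q0[of n \<omega>] by simp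
      have "AE \<omega> in M. e < \<bar>Y n \<omega> - Z n \<omega>\<bar> \<longrightarrow> \<omega> \<in> ((?A1 \<union> ?A2) \<union> ?A3) \<union> ?A4"
        using AE_num_den_bounds[OF n] bn[OF n] AE_space
      proof eventually_elim
        case (elim \<omega>)
        show ?case
        proof (rule impI, rule ccontr)
          assume y: "e < \<bar>Y n \<omega> - Z n \<omega>\<bar>" and na: "\<omega> \<notin> ((?A1 \<union> ?A2) \<union> ?A3) \<union> ?A4"
          have "(SX n \<omega>)\<^sup>2 / n < g\<^sup>2" using na elim(3) by (auto simp: power2_eq_square)
          then have "(\<bar>SX n \<omega>\<bar> / sqrt n)\<^sup>2 < g\<^sup>2" by (simp add: power_divide)
          then have g3: "\<bar>SX n \<omega>\<bar> / sqrt n < g" by (rule power2_less_imp_less) (use g in simp)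
          have "\<bar>sqrt n * (num n \<omega> / den n \<omega> - \<beta>) - (1 - \<beta>\<^sup>2) / \<kappa> * (SX n \<omega> / sqrt n)\<bar> \<le> e"
            by (rule ratio_linearization[OF beta k n q0[of n \<omega>] e g(1), where SN="SN n \<omega>" and \<delta>="\<delta> n \<omega>"])
              (use elim na g3 in \<open>auto simp: SX_def SN_def Q_def \<delta>_def\<close>)
          then show False using y elim(2) by (simp add: Y_def Z_def)
        qed
      qed
      then have u: "prob {\<omega> \<in> space M. e < \<bar>Y n \<omega> - Z n \<omega>\<bar>} \<le> prob (((?A1 \<union> ?A2) \<union> ?A3) \<union> ?A4)"
        by (intro finite_measure_mono_AE) auto
      have u1: "prob (((?A1 \<union> ?A2) \<union> ?A3) \<union> ?A4) \<le> prob ((?A1 \<union> ?A2) \<union> ?A3) + prob ?A4" by (rule measure_Un_le) measurable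
      have u2: "prob ((?A1 \<union> ?A2) \<union> ?A3) \<le> prob (?A1 \<union> ?A2) + prob ?A3" by (rule measure_Un_le) measurable
      have u3: "prob (?A1 \<union> ?A2) \<le> prob ?A1 + prob ?A2" by (rule measure_Un_le) measurable
      have "prob ?A1 \<le> (c1 / sqrt n) / (\<kappa> / 2)" by (rule markov_bound) (use \<delta>E[OF n] \<delta>0 k in auto)
      also have "\<dots> = (2 * c1 / \<kappa>) * (w n * w n)" by (simp add: ww mult_ac)
      finally have a1: "prob ?A1 \<le> (2 * c1 / \<kappa>) * (w n * w n)" .
      have "prob ?A2 \<le> (c1 / sqrt n) / (e * \<kappa>\<^sup>2 / (4 * g))" by (rule markov_bound) (use \<delta>E[OF n] \<delta>0 k e g in auto)
      also have "\<dots> = (4 * c1 / (e * \<kappa>\<^sup>2)) * w n" unfolding g(2)[symmetric] wg using g(1) by (simp add: mult_ac)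
      finally have a2: "prob ?A2 \<le> (4 * c1 / (e * \<kappa>\<^sup>2)) * w n" .
      have "prob ?A3 \<le> K1 / (g * g)"
        by (rule markov_bound) (use sxE[of n] n g in \<open>auto simp: divide_le_eq mult.commute\<close>)
      also have "\<dots> = K1 * (w n * w n)" by (simp add: g(2) ww)
      finally have a3: "prob ?A3 \<le> K1 * (w n * w n)" .
      have "prob ?A4 \<le> (Kq / sqrt n) / (e * \<kappa> / 4)"
        by (rule markov_bound) (use qint[of n] qE[of n] q0[of n] k e in \<open>auto intro!: divide_right_mono\<close>)
      also have "\<dots> = (4 * Kq / (e * \<kappa>)) * (w n * w n)" by (simp add: ww mult_ac)
      finally have a4: "prob ?A4 \<le> (4 * Kq / (e * \<kappa>)) * (w n * w n)" .
      show ?thesis unfolding p_def using u u1 u2 u3 a1 a2 a3 a4 by linarith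
    qed
    then have "eventually (\<lambda>n. norm (prob {\<omega> \<in> space M. e < \<bar>Y n \<omega> - Z n \<omega>\<bar>}) \<le> p n) sequentially"
      by (intro eventually_mono[OF eventually_gt_at_top[of 0]]) auto
    then show ?thesis by (rule Lim_null_comparison[OF _ p0])
  qed
  have char: "(\<lambda>n. CLINT \<omega>|M. iexp (t * Z n \<omega>)) \<longlonglongrightarrow> complex_of_real (exp (- (t\<^sup>2 * s\<^sup>2 / 2)))" for t
  proof -
    define r where "r = t * ((1 - \<beta>\<^sup>2) / \<kappa>)"
    have 1: "t * Z n \<omega> = r * ((\<Sum>j<n. X (int j + 1) \<omega>) / sqrt n)" for n \<omega>
      by (simp add: Z_def r_def SX_def)
    have 2: "t\<^sup>2 * s\<^sup>2 = r\<^sup>2 * (C2 / (1 - \<beta>\<^sup>2))"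
      unfolding s2 r_def using b2 by (simp add: power_mult_distrib power_divide power2_eq_square[of "1 - \<beta>\<^sup>2"])
    show ?thesis unfolding 1 2 by (rule char_sum_X_tendsto)
  qed
  have "weak_conv_m (\<lambda>n. distr M borel (Y n)) (density lborel (normal_density 0 s))"
    by (rule weak_conv_normal_if_close[OF _ _ s char close]) measurable
  then show ?thesis unfolding Y_def s_def .
qed

end

section \<open>Measurability of the estimator\<close>

text \<open>For levels that F never reaches, or reaches everywhere, the set behind the quantile is
  empty or everything and \<open>Inf\<close> is a default value, but a constant one; by monotonicity
  both cases are recognised on integers. Each condition is thus a countable combination of
  comparisons with values of F.\<close>

lemma quantile_le_iff:
  assumes mono: "mono F" and rc: "\<And>x. continuous (at_right x) F"
  shows "quantile F p \<le> a \<longleftrightarrow>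
    (if \<forall>n::nat. \<not> p \<le> F (real n) then Inf ({}::real set) \<le> a
     else if \<forall>n::nat. p \<le> F (- real n) then Inf (UNIV::real set) \<le> a
     else p \<le> F a)"
proof -
  define S where "S = {x. p \<le> F x}"
  have up: "x \<in> S \<Longrightarrow> x \<le> y \<Longrightarrow> y \<in> S" for x y
    using monoD[OF mono, of x y] by (auto simp: S_def)
  have empty: "(\<forall>n::nat. \<not> p \<le> F (real n)) \<longleftrightarrow> S = {}"
  proof
    assume *: "\<forall>n::nat. \<not> p \<le> F (real n)"
    show "S = {}"
    proof (rule ccontr)
      assume "S \<noteq> {}"
      then obtain x where "x \<in> S" by auto
      moreover obtain n :: nat where "x \<le> real n" using real_arch_simple by blast
      ultimately show False using up * by (auto simp: S_def)
    qed
  qed (auto simp: S_def)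
  have full: "(\<forall>n::nat. p \<le> F (- real n)) \<longleftrightarrow> S = UNIV"
  proof
    assume *: "\<forall>n::nat. p \<le> F (- real n)"
    have "x \<in> S" for x
    proof -
      obtain n :: nat where "- x \<le> real n" using real_arch_simple by blast
      then show ?thesis using up[of "- real n" x] * by (auto simp: S_def)
    qed
    then show "S = UNIV" by auto
  qed (auto simp: S_def)
  have main: "Inf S \<le> a \<longleftrightarrow> a \<in> S" if ne: "S \<noteq> {}" "S \<noteq> UNIV"
  proof
    obtain z where z: "z \<notin> S" using ne by auto
    have bdd: "bdd_below S" using z up by (intro bdd_belowI[of _ z]) (meson linear)
    show "Inf S \<le> a" if "a \<in> S" using bdd that by (rule cInf_lower[rotated])
    assume le: "Inf S \<le> a"
    have gt: "x \<in> S" if "a < x" for x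
    proof -
      have "Inf S < x" using le that by simp
      then obtain y where "y \<in> S" "y < x" using ne(1) bdd by (auto simp: cInf_less_iff)
      then show ?thesis using up by auto
    qed
    \<comment> \<open>Right-continuity makes the infimum attained: all points beyond a belong to the
      set, hence so does a.\<close>
    have "(F \<longlongrightarrow> F a) (at_right a)" using rc[of a] by (simp add: continuous_within)
    moreover have "eventually (\<lambda>x. p \<le> F x) (at_right a)"
      by (rule eventually_mono[OF eventually_at_right_less[of a]]) (use gt in \<open>auto simp: S_def\<close>)
    ultimately show "a \<in> S" unfolding S_def mem_Collect_eq by (rule tendsto_lowerbound) simp
  qed
  show ?thesis
    unfolding quantile_def S_def[symmetric] using empty full main by (auto simp: S_def)
qed

lemma quantile_measurable:
  fixes F :: "'a \<Rightarrow> real \<Rightarrow> real"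
  assumes mono: "\<And>\<omega>. \<omega> \<in> space M \<Longrightarrow> mono (F \<omega>)"
    and rc: "\<And>\<omega> x. \<omega> \<in> space M \<Longrightarrow> continuous (at_right x) (F \<omega>)"
    and [measurable]: "\<And>x. (\<lambda>\<omega>. F \<omega> x) \<in> borel_measurable M"
  shows "(\<lambda>(\<omega>, p). quantile (F \<omega>) p) \<in> borel_measurable (M \<Otimes>\<^sub>M borel)"
proof (rule borel_measurableI_le)
  fix a
  have "{x \<in> space (M \<Otimes>\<^sub>M borel). (case x of (\<omega>, p) \<Rightarrow> quantile (F \<omega>) p) \<le> a} =
    {x \<in> space (M \<Otimes>\<^sub>M borel). if \<forall>n::nat. \<not> snd x \<le> F (fst x) (real n) then Inf ({}::real set) \<le> a
     else if \<forall>n::nat. snd x \<le> F (fst x) (- real n) then Inf (UNIV::real set) \<le> a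
     else snd x \<le> F (fst x) a}"
    unfolding split_beta' by (intro Collect_cong conj_cong refl quantile_le_iff mono rc) (auto simp: space_pair_measure)
  also have "\<dots> \<in> sets (M \<Otimes>\<^sub>M borel)" by measurable
  finally show "{x \<in> space (M \<Otimes>\<^sub>M borel). (case x of (\<omega>, p) \<Rightarrow> quantile (F \<omega>) p) \<le> a} \<in> sets (M \<Otimes>\<^sub>M borel)" .
qed

lemma quantile_mono_on:
  assumes "real_distribution \<nu>"
  shows "mono_on {0<..<1} (quantile (cdf \<nu>))"
proof (rule mono_onI)
  fix p p' :: real assume p: "p \<in> {0<..<1}" "p' \<in> {0<..<1}" "p \<le> p'"
  interpret real_distribution \<nu> by fact
  have "eventually (\<lambda>x. p' < cdf \<nu> x) at_top" using cdf_lim_at_top_prob p(2) by (auto intro: order_tendstoD)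
  then obtain x where x: "p' < cdf \<nu> x" by (auto simp: eventually_at_top_linorder)
  have "eventually (\<lambda>x. cdf \<nu> x < p) at_bot" using cdf_lim_at_bot p(1) by (auto intro: order_tendstoD)
  then obtain z where z: "cdf \<nu> z < p" by (auto simp: eventually_at_bot_linorder)
  show "quantile (cdf \<nu>) p \<le> quantile (cdf \<nu>) p'"
    unfolding quantile_def
  proof (rule cInf_superset_mono)
    show "{x. p' \<le> cdf \<nu> x} \<noteq> {}" using x by (auto intro: less_imp_le)
    show "bdd_below {x. p \<le> cdf \<nu> x}"
    proof (rule bdd_belowI[of _ z])
      fix y assume "y \<in> {x. p \<le> cdf \<nu> x}"
      then have "cdf \<nu> z < cdf \<nu> y" using z by simp
      then show "z \<le> y" using cdf_nondecreasing[of y z] by (meson le_cases not_le)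
    qed
    show "{x. p' \<le> cdf \<nu> x} \<subseteq> {x. p \<le> cdf \<nu> x}" using p by auto
  qed
qed

lemma cdf_of_quantile_set:
  fixes R :: "real \<Rightarrow> real"
  shows "{0} \<union> {p \<in> {0<..<1}. R p \<le> u} \<noteq> {}" "bdd_above ({0} \<union> {p \<in> {0<..<1}. R p \<le> u})"
  by (auto intro!: bdd_aboveI[of _ 1])

lemma less_cdf_of_quantile_iff:
  "a < cdf_of_quantile R u \<longleftrightarrow> a < 0 \<or> (\<exists>p\<in>{0<..<1}. a < p \<and> R p \<le> u)"
  unfolding cdf_of_quantile_def less_cSup_iff[OF cdf_of_quantile_set] by auto

text \<open>Monotonicity allows the witness p to be lowered to a rational one, which makes the
  existential countable and the event measurable.\<close>

lemma less_cdf_of_quantile_iff_rat: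
  assumes mono: "mono_on {0<..<1} R"
  shows "a < cdf_of_quantile R u \<longleftrightarrow>
    a < 0 \<or> (\<exists>q::rat. 0 < real_of_rat q \<and> real_of_rat q < 1 \<and> a < real_of_rat q \<and> R (real_of_rat q) \<le> u)"
proof -
  have "\<exists>q::rat. 0 < real_of_rat q \<and> real_of_rat q < 1 \<and> a < real_of_rat q \<and> R (real_of_rat q) \<le> u"
    if p: "p \<in> {0<..<1}" "a < p" "R p \<le> u" for p
  proof -
    obtain q where "max a 0 < real_of_rat q" "real_of_rat q < p"
      using of_rat_dense[of "max a 0" p] p by auto
    moreover define r where "r = real_of_rat q"
    ultimately have r: "0 < r" "a < r" "r < p" by simp_all
    then have "R r \<le> R p" using p by (intro mono_onD[OF mono]) auto
    then have "0 < r \<and> r < 1 \<and> a < r \<and> R r \<le> u" using p r by auto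
    then show ?thesis unfolding r_def by blast
  qed
  then show ?thesis unfolding less_cdf_of_quantile_iff by force
qed

lemma cdf_of_quantile_bounds: "0 \<le> cdf_of_quantile R u" "cdf_of_quantile R u \<le> 1"
  unfolding cdf_of_quantile_def using cdf_of_quantile_set[of R u]
  by (auto intro!: cSup_upper cSup_least)

lemma cdf_of_quantile_mono: "u \<le> v \<Longrightarrow> cdf_of_quantile R u \<le> cdf_of_quantile R v"
  unfolding cdf_of_quantile_def using cdf_of_quantile_set by (intro cSup_subset_mono) auto

text \<open>If the values to the right of u stayed above some a exceeding the value at u, a level p
  in between would satisfy R p \<le> y for every y > u, hence R p \<le> u, and p would already be
  counted at u.\<close>

lemma cdf_of_quantile_right_continuous:
  assumes mono: "mono_on {0<..<1} R"
  shows "continuous (at_right u) (cdf_of_quantile R)"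
  unfolding continuous_within
proof (rule order_tendstoI)
  fix a assume a: "a < cdf_of_quantile R u"
  then have "a < cdf_of_quantile R y" if "u < y" for y using cdf_of_quantile_mono[of u y R] that by linarith
  then show "eventually (\<lambda>y. a < cdf_of_quantile R y) (at_right u)"
    by (intro eventually_mono[OF eventually_at_right_less[of u]])
next
  fix a assume a: "cdf_of_quantile R u < a"
  have "\<exists>y>u. cdf_of_quantile R y < a"
  proof (rule ccontr)
    assume "\<not> (\<exists>y>u. cdf_of_quantile R y < a)"
    then have ge: "a \<le> cdf_of_quantile R y" if "u < y" for y using that by (metis not_less)
    obtain p where p: "cdf_of_quantile R u < p" "p < a" using dense[OF a] by blast
    have p0: "0 < p" using p cdf_of_quantile_bounds(1)[of R u] by linarith
    have p1: "p < 1" using p ge[of "u + 1"] cdf_of_quantile_bounds(2)[of R "u + 1"] by simp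
    have "R p \<le> y" if "u < y" for y
    proof -
      have "p < cdf_of_quantile R y" using ge[OF that] p by linarith
      then obtain p' where "p' \<in> {0<..<1}" "p < p'" "R p' \<le> y" using p0 unfolding less_cdf_of_quantile_iff by auto
      then show ?thesis using mono_onD[OF mono, of p p'] p0 p1 by auto
    qed
    then have "R p \<le> u" by (rule field_le_epsilon[of "R p" u, rotated]) (metis less_add_same_cancel1)
    obtain p2 where p2: "cdf_of_quantile R u < p2" "p2 < p" using dense[OF p(1)] by blast
    then have "p2 < cdf_of_quantile R u" unfolding less_cdf_of_quantile_iff using \<open>R p \<le> u\<close> p0 p1 by auto
    then show False using p2 by simp
  qed
  then obtain y where "u < y" "cdf_of_quantile R y < a" by blast
  then show "eventually (\<lambda>y. cdf_of_quantile R y < a) (at_right u)"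
    by (auto simp: eventually_at_right intro!: exI[of _ y] order_le_less_trans[OF cdf_of_quantile_mono[of _ y R]])
qed

lemma cdf_of_quantile_measurable:
  fixes R :: "'a \<Rightarrow> real \<Rightarrow> real"
  assumes mono: "\<And>\<omega>. \<omega> \<in> space M \<Longrightarrow> mono_on {0<..<1} (R \<omega>)"
    and [measurable]: "\<And>p. (\<lambda>\<omega>. R \<omega> p) \<in> borel_measurable M"
  shows "(\<lambda>(\<omega>, u). cdf_of_quantile (R \<omega>) u) \<in> borel_measurable (M \<Otimes>\<^sub>M borel)"
proof (rule borel_measurableI_greater)
  fix a
  have "{x \<in> space (M \<Otimes>\<^sub>M borel). a < (case x of (\<omega>, u) \<Rightarrow> cdf_of_quantile (R \<omega>) u)} =
    {x \<in> space (M \<Otimes>\<^sub>M borel). a < 0 \<or> (\<exists>q::rat. 0 < real_of_rat q \<and> real_of_rat q < 1 \<and> a < real_of_rat q \<and> R (fst x) (real_of_rat q) \<le> snd x)}"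
    unfolding split_beta' by (intro Collect_cong conj_cong refl less_cdf_of_quantile_iff_rat mono) (auto simp: space_pair_measure)
  also have "\<dots> \<in> sets (M \<Otimes>\<^sub>M borel)" by measurable
  finally show "{x \<in> space (M \<Otimes>\<^sub>M borel). a < (case x of (\<omega>, u) \<Rightarrow> cdf_of_quantile (R \<omega>) u)} \<in> sets (M \<Otimes>\<^sub>M borel)" .
qed

text \<open>For a right-continuous function differentiability can be tested along rational increments.\<close>

lemma deriv_right_continuous:
  fixes F :: "real \<Rightarrow> real" and u :: real
  defines "L \<equiv> lim (\<lambda>n. (F (u + 1 / real (Suc n)) - F u) * real (Suc n))"
  defines "P \<equiv> \<forall>k::nat. \<exists>m::nat. \<forall>q::rat. q \<noteq> 0 \<longrightarrow> \<bar>real_of_rat q\<bar> < 1 / real (Suc m) \<longrightarrow>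
      \<bar>F (u + real_of_rat q) - F u - L * real_of_rat q\<bar> \<le> \<bar>real_of_rat q\<bar> / real (Suc k)"
  assumes rc: "\<And>x. continuous (at_right x) F"
  shows "deriv F u = (if P then L else (SOME D::real. False))"
proof -
  have 1: "L = D \<and> P" if D: "DERIV F u :> D" for D
  proof -
    have lim0: "((\<lambda>h. (F (u + h) - F u) / h) \<longlongrightarrow> D) (at 0)" using D by (simp add: DERIV_def)
    have "filterlim (\<lambda>n. 1 / real (Suc n)) (at 0) sequentially"
      unfolding filterlim_at using LIMSEQ_inverse_real_of_nat by (auto simp: inverse_eq_divide)
    from filterlim_compose[OF lim0 this]
    have "(\<lambda>n. (F (u + 1 / real (Suc n)) - F u) * real (Suc n)) \<longlonglongrightarrow> D" by simp
    then have L: "L = D" unfolding L_def by (rule limI)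
    have P
      unfolding P_def
    proof
      fix k :: nat
      obtain s where s: "0 < s" "\<And>h. h \<noteq> 0 \<Longrightarrow> \<bar>h\<bar> < s \<Longrightarrow> \<bar>(F (u + h) - F u) / h - D\<bar> < 1 / real (Suc k)"
        using LIM_D[OF lim0, of "1 / real (Suc k)"] by auto
      obtain m where m: "1 / real (Suc m) < s" using reals_Archimedean[OF s(1)] by (auto simp: inverse_eq_divide)
      show "\<exists>m::nat. \<forall>q::rat. q \<noteq> 0 \<longrightarrow> \<bar>real_of_rat q\<bar> < 1 / real (Suc m) \<longrightarrow>
        \<bar>F (u + real_of_rat q) - F u - L * real_of_rat q\<bar> \<le> \<bar>real_of_rat q\<bar> / real (Suc k)"
      proof (intro exI[of _ m] allI impI)
        fix q :: rat assume q: "q \<noteq> 0" "\<bar>real_of_rat q\<bar> < 1 / real (Suc m)"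
        define h where "h = real_of_rat q"
        have h: "h \<noteq> 0" "\<bar>h\<bar> < s" using q m by (auto simp: h_def)
        have "F (u + h) - F u - D * h = h * ((F (u + h) - F u) / h - D)" using h by (simp add: field_simps)
        then have "\<bar>F (u + h) - F u - D * h\<bar> = \<bar>h\<bar> * \<bar>(F (u + h) - F u) / h - D\<bar>" by (simp add: abs_mult)
        also have "\<dots> \<le> \<bar>h\<bar> * (1 / real (Suc k))" using s(2)[OF h] by (intro mult_left_mono) auto
        finally show "\<bar>F (u + real_of_rat q) - F u - L * real_of_rat q\<bar> \<le> \<bar>real_of_rat q\<bar> / real (Suc k)"
          by (simp add: h_def L)
      qed
    qed
    with L show ?thesis by simp
  qed
  have 2: "DERIV F u :> L" if P: P
    unfolding DERIV_def
  proof (rule LIM_I)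
    fix r :: real assume r: "0 < r"
    obtain k where k: "1 / real (Suc k) < r" using reals_Archimedean[OF r] by (auto simp: inverse_eq_divide)
    obtain m where m: "\<And>q::rat. q \<noteq> 0 \<Longrightarrow> \<bar>real_of_rat q\<bar> < 1 / real (Suc m) \<Longrightarrow>
        \<bar>F (u + real_of_rat q) - F u - L * real_of_rat q\<bar> \<le> \<bar>real_of_rat q\<bar> / real (Suc k)"
      using P unfolding P_def by blast
    show "\<exists>s>0. \<forall>h. h \<noteq> 0 \<and> norm (h - 0) < s \<longrightarrow> norm ((F (u + h) - F u) / h - L) < r"
    proof (intro exI[of _ "1 / real (Suc m)"] conjI allI impI)
      fix h :: real assume h: "h \<noteq> 0 \<and> norm (h - 0) < 1 / real (Suc m)"
      define \<phi> where "\<phi> y = \<bar>F (u + y) - F u - L * y\<bar> - \<bar>y\<bar> / real (Suc k)" for y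
      have "\<phi> h \<le> 0"
      proof (rule ccontr)
        assume "\<not> \<phi> h \<le> 0"
        then have pos: "0 < \<phi> h" by simp
        have "(F \<longlongrightarrow> F (u + h)) (at_right (u + h))" using rc[of "u + h"] by (simp add: continuous_within)
        then have "((\<lambda>y. F (u + y)) \<longlongrightarrow> F (u + h)) (at_right h)"
          by (subst filterlim_at_right_to_0, subst (asm) filterlim_at_right_to_0) (simp add: add_ac)
        then have "(\<phi> \<longlongrightarrow> \<phi> h) (at_right h)" unfolding \<phi>_def by (intro tendsto_intros) auto
        then have "eventually (\<lambda>y. 0 < \<phi> y) (at_right h)" using pos by (rule order_tendstoD)
        then obtain b where b: "h < b" "\<And>y. h < y \<Longrightarrow> y < b \<Longrightarrow> 0 < \<phi> y" by (auto simp: eventually_at_right_field)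
        \<comment> \<open>The rational q found to the right of h has to stay where \<phi> is
          positive, on the same side of zero as h, and inside the window of size 1 / (m +
          1).\<close>
        define b' where "b' = min b (if h < 0 then min 0 (h + (1 / real (Suc m) - \<bar>h\<bar>)) else h + (1 / real (Suc m) - \<bar>h\<bar>))"
        have "h < b'" using b h by (auto simp: b'_def)
        then obtain q where q: "h < real_of_rat q" "real_of_rat q < b'" using of_rat_dense by blast
        have "q \<noteq> 0"
        proof
          assume "q = 0"
          then show False using q h by (auto simp: b'_def split: if_splits)
        qed
        moreover define y where "y = real_of_rat q"
        have "\<bar>y\<bar> < 1 / real (Suc m)" using q h unfolding y_def[symmetric] by (auto simp: b'_def split: if_splits)
        then have "\<bar>real_of_rat q\<bar> < 1 / real (Suc m)" by (simp only: y_def)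
        ultimately have "\<phi> (real_of_rat q) \<le> 0" using m[of q] by (simp add: \<phi>_def)
        moreover have "0 < \<phi> (real_of_rat q)" using b(2) q by (simp add: b'_def)
        ultimately show False by simp
      qed
      then have le: "\<bar>F (u + h) - F u - L * h\<bar> \<le> \<bar>h\<bar> / real (Suc k)" by (simp add: \<phi>_def)
      have "(F (u + h) - F u) / h - L = (F (u + h) - F u - L * h) / h" using h by (simp add: field_simps)
      then have "\<bar>(F (u + h) - F u) / h - L\<bar> = \<bar>F (u + h) - F u - L * h\<bar> / \<bar>h\<bar>" by (simp add: abs_divide)
      also have "\<dots> \<le> 1 / real (Suc k)" using le h by (simp add: field_simps)
      finally show "norm ((F (u + h) - F u) / h - L) < r" using k by simp
    qed simp
  qed
  show ?thesis
  proof (cases P)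
    case True
    then show ?thesis using DERIV_imp_deriv[OF 2] by simp
  next
    case False
    \<comment> \<open>At a point without derivative \<open>deriv\<close> chooses from an empty
      predicate, which is one fixed real and so does no harm to measurability.\<close>
    then have "\<not> DERIV F u :> D" for D using 1 by blast
    then show ?thesis using False by (simp add: deriv_def)
  qed
qed

lemma deriv_measurable:
  fixes F :: "'a \<Rightarrow> real \<Rightarrow> real"
  assumes F: "(\<lambda>(\<omega>, u). F \<omega> u) \<in> borel_measurable (M \<Otimes>\<^sub>M borel)"
    and rc: "\<And>\<omega> x. \<omega> \<in> space M \<Longrightarrow> continuous (at_right x) (F \<omega>)"
  shows "(\<lambda>(\<omega>, u). deriv (F \<omega>) u) \<in> borel_measurable (M \<Otimes>\<^sub>M borel)"
proof -
  have [measurable (raw)]: "(\<lambda>x. F (f x) (g x)) \<in> borel_measurable N"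
    if "f \<in> measurable N M" "g \<in> borel_measurable N" for f g and N :: "'b measure"
    using measurable_compose[OF measurable_Pair[OF that] F] by simp
  define L where "L x = lim (\<lambda>n. (F (fst x) (snd x + 1 / real (Suc n)) - F (fst x) (snd x)) * real (Suc n))" for x
  have [measurable]: "L \<in> borel_measurable (M \<Otimes>\<^sub>M borel)"
    unfolding L_def by (intro borel_measurable_lim_metric) measurable
  have "(\<lambda>x. if \<forall>k::nat. \<exists>m::nat. \<forall>q::rat. q \<noteq> 0 \<longrightarrow> \<bar>real_of_rat q\<bar> < 1 / real (Suc m) \<longrightarrow>
      \<bar>F (fst x) (snd x + real_of_rat q) - F (fst x) (snd x) - L x * real_of_rat q\<bar> \<le> \<bar>real_of_rat q\<bar> / real (Suc k)
      then L x else (SOME D::real. False)) \<in> borel_measurable (M \<Otimes>\<^sub>M borel)"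
    by measurable
  moreover have "(case x of (\<omega>, u) \<Rightarrow> deriv (F \<omega>) u) = (if \<forall>k::nat. \<exists>m::nat. \<forall>q::rat. q \<noteq> 0 \<longrightarrow> \<bar>real_of_rat q\<bar> < 1 / real (Suc m) \<longrightarrow>
      \<bar>F (fst x) (snd x + real_of_rat q) - F (fst x) (snd x) - L x * real_of_rat q\<bar> \<le> \<bar>real_of_rat q\<bar> / real (Suc k)
      then L x else (SOME D::real. False))" if "x \<in> space (M \<Otimes>\<^sub>M borel)" for x
    using that unfolding L_def split_beta' by (intro deriv_right_continuous rc) (auto simp: space_pair_measure)
  ultimately show ?thesis by (subst measurable_cong)
qed

lemma
  fixes Q :: "int \<Rightarrow> 'a \<Rightarrow> real \<Rightarrow> real"
  assumes Q: "\<And>t. (\<lambda>(\<omega>, p). Q t \<omega> p) \<in> borel_measurable (M \<Otimes>\<^sub>M borel)"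
    and mono: "\<And>t \<omega>. \<omega> \<in> space M \<Longrightarrow> mono_on {0<..<1} (Q t \<omega>)"
  shows etahat_measurable: "(\<lambda>x. etahat (\<lambda>t. Q t (fst x)) n h (snd x)) \<in> borel_measurable (M \<Otimes>\<^sub>M borel)"
    and fhat_measurable: "(\<lambda>x. fhat (\<lambda>t. Q t (fst x)) n (snd x)) \<in> borel_measurable (M \<Otimes>\<^sub>M borel)"
proof -
  have Qm: "(\<lambda>x. Q t (f x) (g x)) \<in> borel_measurable N"
    if "f \<in> measurable N M" "g \<in> borel_measurable N" for t f g and N :: "'c measure"
    using measurable_compose[OF measurable_Pair[OF that] Q[of t]] by simp
  define R where "R \<omega> p = (1 / real n) * (\<Sum>t\<in>{1..int n}. Q t \<omega> p)" for \<omega> p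
  have Rmono: "mono_on {0<..<1} (R \<omega>)" if "\<omega> \<in> space M" for \<omega>
    unfolding R_def by (intro mono_onI mult_left_mono sum_mono mono_onD[OF mono[OF that]]) auto
  have Rm: "(\<lambda>\<omega>. R \<omega> p) \<in> borel_measurable M" for p
    unfolding R_def using measurable_compose[OF measurable_Pair[OF measurable_ident_sets[OF refl] measurable_const[of p borel]] Q] by simp
  have Fh: "Fhat (\<lambda>t. Q t \<omega>) n = cdf_of_quantile (R \<omega>)" for \<omega> by (simp add: Fhat_def R_def[abs_def])
  have F: "(\<lambda>(\<omega>, u). Fhat (\<lambda>t. Q t \<omega>) n u) \<in> borel_measurable (M \<Otimes>\<^sub>M borel)"
    unfolding Fh by (rule cdf_of_quantile_measurable[OF Rmono Rm])
  have "(\<lambda>(\<omega>, u). fhat (\<lambda>t. Q t \<omega>) n u) \<in> borel_measurable (M \<Otimes>\<^sub>M borel)"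
    unfolding fhat_def by (rule deriv_measurable[OF F]) (simp add: Fh cdf_of_quantile_right_continuous Rmono)
  then show "(\<lambda>x. fhat (\<lambda>t. Q t (fst x)) n (snd x)) \<in> borel_measurable (M \<Otimes>\<^sub>M borel)"
    by (simp add: split_beta')
  have That: "(\<lambda>x. That (\<lambda>t. Q t (fst x)) n t (snd x)) \<in> borel_measurable (M \<Otimes>\<^sub>M borel)" for t
    unfolding That_def using F
    by (intro Qm measurable_fst) (simp add: split_beta')
  show "(\<lambda>x. etahat (\<lambda>t. Q t (fst x)) n h (snd x)) \<in> borel_measurable (M \<Otimes>\<^sub>M borel)"
    unfolding etahat_def using That by measurable
qed

text \<open>Joint measurability in (\<omega>, u) passes to the integrals over u. This is proved for
  every \<omega>, not just almost surely, because the laws in the limit theorem are image measures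
  of \<open>betahat\<close> itself.\<close>

lemma betahat_measurable:
  fixes Q :: "int \<Rightarrow> 'a \<Rightarrow> real \<Rightarrow> real"
  assumes Q: "\<And>t. (\<lambda>(\<omega>, p). Q t \<omega> p) \<in> borel_measurable (M \<Otimes>\<^sub>M borel)"
    and mono: "\<And>t \<omega>. \<omega> \<in> space M \<Longrightarrow> mono_on {0<..<1} (Q t \<omega>)"
  shows "(\<lambda>\<omega>. betahat (\<lambda>t. Q t \<omega>) n) \<in> borel_measurable M"
proof -
  have "(\<lambda>x. etahat (\<lambda>t. Q t (fst x)) n h (snd x) * fhat (\<lambda>t. Q t (fst x)) n (snd x)) \<in> borel_measurable (M \<Otimes>\<^sub>M lborel)" for h
  proof -
    have "(\<lambda>x. etahat (\<lambda>t. Q t (fst x)) n h (snd x)) \<in> borel_measurable (M \<Otimes>\<^sub>M borel)"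
      by (rule etahat_measurable[OF Q]) (rule mono)
    moreover have "(\<lambda>x. fhat (\<lambda>t. Q t (fst x)) n (snd x)) \<in> borel_measurable (M \<Otimes>\<^sub>M borel)"
      by (rule fhat_measurable[OF Q]) (rule mono)
    ultimately show ?thesis
      unfolding measurable_cong_sets[OF sets_pair_measure_cong[OF refl sets_lborel] refl] by measurable
  qed
  then have "(\<lambda>\<omega>. \<integral>u. etahat (\<lambda>t. Q t \<omega>) n h u * fhat (\<lambda>t. Q t \<omega>) n u \<partial>lborel) \<in> borel_measurable M" for h
    using lborel.borel_measurable_lebesgue_integral[of "\<lambda>\<omega> u. etahat (\<lambda>t. Q t \<omega>) n h u * fhat (\<lambda>t. Q t \<omega>) n u" M]
    by (simp add: split_beta')
  then show ?thesis unfolding betahat_def by measurable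
qed

section \<open>Pulling the estimator back to the base measure\<close>

text \<open>Lebesgue differentiation is applied over intervals [x, x + h] with h > 0, giving the
  right difference quotient; the left one comes from the same result for the reflected
  density.\<close>

lemma AE_cdf_has_derivative:
  fixes g :: "real \<Rightarrow> real"
  assumes [measurable]: "g \<in> borel_measurable borel" and g0: "\<And>x. 0 \<le> g x"
    and prob: "prob_space (density lborel g)"
  shows "AE x in lborel. DERIV (cdf (density lborel g)) x :> g x"
proof -
  let ?\<nu> = "density lborel g"
  interpret prob_space ?\<nu> by fact
  interpret finite_borel_measure ?\<nu> by unfold_locales simp
  have int: "integrable lborel g"
    using emeasure_space_1 g0 by (intro integrableI_nonneg) (auto simp: emeasure_density)
  have setint: "set_integrable lborel {a..b} g" for a b
    unfolding set_integrable_def by (rule integrable_mult_indicator) (use int in auto)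
  have io: "g integrable_on cbox a b" for a b
    using set_borel_integral_eq_integral(1)[OF setint[of a b]] by simp
  have io': "(\<lambda>x. g (- x)) integrable_on cbox a b" for a b
    using integrable_reflect[where f=g and a="- b" and b="- a"] io[of "-b" "-a"] by simp
  have meas: "cdf ?\<nu> b - cdf ?\<nu> a = Henstock_Kurzweil_Integration.integral (cbox a b) g" if "a < b" for a b
  proof -
    have "cdf ?\<nu> b - cdf ?\<nu> a = measure ?\<nu> {a<..b}" by (rule cdf_diff_eq[OF that])
    also have "\<dots> = (\<integral>x. indicator {a<..b} x \<partial>?\<nu>)" by simp
    also have "\<dots> = (\<integral>x. g x * indicator {a<..b} x \<partial>lborel)"
      by (subst integral_density) (auto simp: g0)
    also have "\<dots> = (\<integral>x. indicator {a..b} x * g x \<partial>lborel)"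
      by (rule integral_cong_AE) (use AE_lborel_singleton[of a] in \<open>auto elim!: eventually_mono simp: indicator_def\<close>)
    also have "\<dots> = Henstock_Kurzweil_Integration.integral {a..b} g"
      using set_borel_integral_eq_integral(2)[OF setint[of a b]] by (simp add: set_lebesgue_integral_def)
    finally show ?thesis by simp
  qed
  obtain N1 where N1: "negligible N1" "\<And>x e. x \<notin> N1 \<Longrightarrow> 0 < e \<Longrightarrow> \<exists>d>0. \<forall>h. 0 < h \<and> h < d \<longrightarrow>
      norm (Henstock_Kurzweil_Integration.integral (cbox x (x + h *\<^sub>R One)) g /\<^sub>R h ^ DIM(real) - g x) < e"
    using integrable_ccontinuous_explicit[OF io] by blast
  obtain N2 where N2: "negligible N2" "\<And>x e. x \<notin> N2 \<Longrightarrow> 0 < e \<Longrightarrow> \<exists>d>0. \<forall>h. 0 < h \<and> h < d \<longrightarrow>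
      norm (Henstock_Kurzweil_Integration.integral (cbox x (x + h *\<^sub>R One)) (\<lambda>x. g (- x)) /\<^sub>R h ^ DIM(real) - g (- x)) < e"
    using integrable_ccontinuous_explicit[OF io'] by blast
  have "negligible (uminus ` N2)"
    by (rule negligible_differentiable_image_negligible[OF _ N2(1)]) (auto intro!: derivative_intros simp: differentiable_on_def)
  then have "N1 \<union> uminus ` N2 \<in> null_sets lebesgue" using N1(1) by (simp add: negligible_iff_null_sets[symmetric])
  then have "AE x in lebesgue. x \<notin> N1 \<union> uminus ` N2" by (rule AE_not_in)
  then have "AE x in lborel. x \<notin> N1 \<union> uminus ` N2" by (simp add: AE_completion_iff)
  then show ?thesis
  proof eventually_elim
    case (elim x)
    then have x: "x \<notin> N1" "- x \<notin> N2" by (auto intro: image_eqI[of _ _ "- x"])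
    show ?case unfolding DERIV_def
    proof (rule LIM_I)
      fix e :: real assume e: "0 < e"
      obtain d1 where d1: "0 < d1" "\<And>h. 0 < h \<Longrightarrow> h < d1 \<Longrightarrow> \<bar>Henstock_Kurzweil_Integration.integral (cbox x (x + h)) g / h - g x\<bar> < e"
        using N1(2)[OF x(1) e] by (auto simp: divide_inverse mult.commute)
      obtain d2 where d2: "0 < d2" "\<And>h. 0 < h \<Longrightarrow> h < d2 \<Longrightarrow> \<bar>Henstock_Kurzweil_Integration.integral (cbox (- x) (- x + h)) (\<lambda>x. g (- x)) / h - g x\<bar> < e"
        using N2(2)[OF x(2) e] by (auto simp: divide_inverse mult.commute)
      show "\<exists>s>0. \<forall>h. h \<noteq> 0 \<and> norm (h - 0) < s \<longrightarrow> norm ((cdf ?\<nu> (x + h) - cdf ?\<nu> x) / h - g x) < e"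
      proof (intro exI[of _ "min d1 d2"] conjI allI impI)
        fix h :: real assume h: "h \<noteq> 0 \<and> norm (h - 0) < min d1 d2"
        show "norm ((cdf ?\<nu> (x + h) - cdf ?\<nu> x) / h - g x) < e"
        proof (cases "0 < h")
          case True
          then show ?thesis using d1(2)[of h] h meas[of x "x + h"] by simp
        next
          case False
          define k where "k = - h"
          have k: "0 < k" "k < d2" using False h by (auto simp: k_def)
          have "Henstock_Kurzweil_Integration.integral (cbox (- x) (- x + k)) (\<lambda>x. g (- x)) = Henstock_Kurzweil_Integration.integral (cbox (x - k) x) g"
            using integral_reflect[where f=g and a="x - k" and b=x] by (simp add: algebra_simps)
          also have "\<dots> = cdf ?\<nu> x - cdf ?\<nu> (x - k)" using meas[of "x - k" x] k by simp
          finally have "\<bar>(cdf ?\<nu> x - cdf ?\<nu> (x - k)) / k - g x\<bar> < e" using d2(2)[OF k] by simp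
          moreover have "(cdf ?\<nu> (x + h) - cdf ?\<nu> x) / h = (cdf ?\<nu> x - cdf ?\<nu> (x - k)) / k"
            using h by (simp add: k_def field_simps)
          ultimately show ?thesis by simp
        qed
      qed (use d1 d2 in auto)
    qed
  qed
qed

text \<open>By the Galois connection Q p \<le> y iff p \<le> F y for levels inside (0, 1), the
  supremum runs over the levels up to F y; the added 0 settles the case F y = 0.\<close>

lemma cdf_of_quantile_eq_cdf:
  assumes \<nu>: "real_distribution \<nu>" and Q: "\<And>p. 0 < p \<Longrightarrow> p < 1 \<Longrightarrow> Q p = quantile (cdf \<nu>) p"
  shows "cdf_of_quantile Q = cdf \<nu>"
proof
  fix y
  interpret real_distribution \<nu> by fact
  interpret cdf_distribution \<nu> by unfold_locales
  have "Q p \<le> y \<longleftrightarrow> p \<le> cdf \<nu> y" if "0 < p" "p < 1" for p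
    unfolding Q[OF that] quantile_def by (rule pseudoinverse[OF that, symmetric])
  then have "{0} \<union> {p \<in> {0<..<1}. Q p \<le> y} = {0} \<union> {p \<in> {0<..<1}. p \<le> cdf \<nu> y}" by auto
  also have "Sup \<dots> = cdf \<nu> y"
  proof (rule antisym)
    show "Sup ({0} \<union> {p \<in> {0<..<1}. p \<le> cdf \<nu> y}) \<le> cdf \<nu> y"
      by (rule cSup_least) (auto simp: cdf_nonneg)
    show "cdf \<nu> y \<le> Sup ({0} \<union> {p \<in> {0<..<1}. p \<le> cdf \<nu> y})"
    proof (rule dense_le)
      fix z assume z: "z < cdf \<nu> y"
      have bdd: "bdd_above ({0} \<union> {p \<in> {0<..<1}. p \<le> cdf \<nu> y})" by (auto intro!: bdd_aboveI[of _ 1])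
      show "z \<le> Sup ({0} \<union> {p \<in> {0<..<1}. p \<le> cdf \<nu> y})"
      proof (cases "z \<le> 0")
        case True
        also have "0 \<le> Sup ({0} \<union> {p \<in> {0<..<1}. p \<le> cdf \<nu> y})" by (rule cSup_upper[OF _ bdd]) auto
        finally show ?thesis .
      next
        case False
        then show ?thesis using z cdf_bounded_prob[of y] by (intro cSup_upper bdd) auto
      qed
    qed
  qed
  finally show "cdf_of_quantile Q y = cdf \<nu> y" by (simp add: cdf_of_quantile_def)
qed

section \<open>Increasing images of a measure supported on an interval\<close>

locale interval_density =
  fixes f :: "real \<Rightarrow> real" and D :: "real set" and \<mu> :: "real measure"
  defines "\<mu> \<equiv> density lborel f"
  assumes f_meas: "f \<in> borel_measurable borel" and f_nonneg: "\<And>x. 0 \<le> f x" and f_prob: "prob_space \<mu>"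
    and D_supp: "measure_support \<mu> = D" and D_int: "is_interval D"
begin

sublocale prob_space \<mu> by (rule f_prob)

lemma sets_mu[simp]: "sets \<mu> = sets borel" and space_mu[simp]: "space \<mu> = UNIV"
  by (simp_all add: \<mu>_def)

lemma real_distribution_mu: "real_distribution \<mu>"
  by unfold_locales simp_all

lemma null_lborel_imp_null: "N \<in> null_sets lborel \<Longrightarrow> N \<in> null_sets \<mu>"
proof -
  assume N: "N \<in> null_sets lborel"
  then have "AE x in lborel. x \<in> N \<longrightarrow> ennreal (f x) = 0"
    using AE_not_in[OF N] by (auto elim!: eventually_mono)
  then show ?thesis using null_setsD2[OF N] f_meas by (simp add: \<mu>_def null_sets_density_iff)
qed

lemma open_compl_D: "open (- D)"
  unfolding open_contains_ball
proof
  fix x assume "x \<in> - D"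
  then obtain e where e: "0 < e" "emeasure \<mu> (ball x e) = 0"
    using D_supp by (auto simp: measure_support_def zero_less_iff_neq_zero)
  have "y \<notin> D" if y: "y \<in> ball x e" for y
  proof -
    obtain r where r: "0 < r" "ball y r \<subseteq> ball x e" using openE[OF open_ball y] by blast
    have "emeasure \<mu> (ball y r) \<le> emeasure \<mu> (ball x e)" using r by (intro emeasure_mono) auto
    then show ?thesis using e r D_supp by (auto simp: measure_support_def intro!: exI[of _ r])
  qed
  then show "\<exists>e>0. ball x e \<subseteq> - D" using e by auto
qed

text \<open>Each point outside the support has a null ball around it, and by Lindelof countably many
  of these balls suffice.\<close>

lemma null_compl_D: "emeasure \<mu> (- D) = 0"
proof -
  define \<F> where "\<F> = {ball x e | x e. emeasure \<mu> (ball x e) = 0}"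
  have "\<Union>\<F> \<supseteq> - D" using D_supp by (force simp: \<F>_def measure_support_def)
  moreover obtain \<F>' where F': "\<F>' \<subseteq> \<F>" "countable \<F>'" "\<Union>\<F>' = \<Union>\<F>"
    using Lindelof[of \<F>] by (auto simp: \<F>_def)
  moreover have "(\<Union>S\<in>\<F>'. S) \<in> null_sets \<mu>"
    using F' by (intro null_sets_UN') (auto simp: \<F>_def null_sets_def)
  ultimately have "- D \<subseteq> (\<Union>S\<in>\<F>'. S)" "(\<Union>S\<in>\<F>'. S) \<in> null_sets \<mu>" by auto
  then show ?thesis using emeasure_mono[of "- D" "\<Union>S\<in>\<F>'. S" \<mu>] by (auto simp: null_sets_def)
qed

text \<open>On the interior a derivative within D is a two-sided one, and by \<open>AE_I\<close> no
  mass is lost by staying there.\<close>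

definition I :: "real set" where "I = interior D"

lemma open_I: "open I" by (simp add: I_def)

lemma I_sub_D: "I \<subseteq> D" by (simp add: I_def interior_subset)

lemma I_interval: "a \<in> I \<Longrightarrow> b \<in> I \<Longrightarrow> a \<le> x \<Longrightarrow> x \<le> b \<Longrightarrow> x \<in> I"
proof -
  have "convex I" unfolding I_def using D_int by (intro convex_interior) (simp add: is_interval_convex_1)
  then have "is_interval I" by (simp add: is_interval_convex_1)
  then show "a \<in> I \<Longrightarrow> b \<in> I \<Longrightarrow> a \<le> x \<Longrightarrow> x \<le> b \<Longrightarrow> x \<in> I" unfolding is_interval_1 by blast
qed

text \<open>The frontier of a convex set is Lebesgue null, hence null for a measure with a
  density.\<close>

lemma AE_I: "AE x in \<mu>. x \<in> I"
proof -
  have cl: "closed D" using open_compl_D by (simp add: closed_def)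
  have "convex D" using D_int by (simp add: is_interval_convex_1)
  then have "frontier D \<in> null_sets lebesgue" using negligible_convex_frontier negligible_iff_null_sets by blast
  then have "frontier D \<in> null_sets lborel" by (simp add: null_sets_completion_iff)
  then have "AE x in \<mu>. x \<notin> frontier D" by (intro AE_not_in null_lborel_imp_null)
  moreover have "- D \<in> null_sets \<mu>" using null_compl_D open_compl_D by (auto simp: null_sets_def)
  then have "AE x in \<mu>. x \<notin> - D" by (rule AE_not_in)
  ultimately show ?thesis
    by eventually_elim (auto simp: I_def frontier_def closure_closed[OF cl])
qed

text \<open>The midpoint of a and b lies in the support, so the ball of radius (b - a) / 2 around it
  carries mass.\<close>

lemma cdf_strict_mono_I:
  assumes "a \<in> I" "b \<in> I" "a < b"
  shows "cdf \<mu> a < cdf \<mu> b"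
proof -
  interpret real_distribution \<mu> by (rule real_distribution_mu)
  define c where "c = (a + b) / 2"
  have "c \<in> I" using I_interval[OF assms(1,2), of c] assms by (simp add: c_def)
  then have "0 < emeasure \<mu> (ball c ((b - a) / 2))"
    using D_supp I_sub_D assms by (auto simp: measure_support_def)
  also have "\<dots> \<le> emeasure \<mu> {a<..b}" by (intro emeasure_mono) (auto simp: c_def dist_real_def abs_less_iff field_simps)
  finally have "0 < measure \<mu> {a<..b}" by (simp add: emeasure_eq_measure)
  then show ?thesis using cdf_diff_eq[OF assms(3)] by simp
qed

lemma I_neighbours:
  assumes "x \<in> I"
  obtains a b where "a \<in> I" "b \<in> I" "a < x" "x < b"
proof -
  obtain e where e: "0 < e" "ball x e \<subseteq> I" using assms open_I by (auto simp: open_contains_ball)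
  then have "x - e / 2 \<in> I" "x + e / 2 \<in> I" by (auto simp: subset_iff dist_real_def)
  then show ?thesis using e that[of "x - e / 2" "x + e / 2"] by auto
qed

text \<open>Without atoms the cdf is continuous and takes the value p; as 0 < p < 1, there is mass
  on both sides of such a point, and the interval property puts it into I.\<close>

lemma cdf_surj_I:
  assumes p: "0 < p" "p < 1"
  obtains x where "x \<in> I" "cdf \<mu> x = p"
proof -
  interpret real_distribution \<mu> by (rule real_distribution_mu)
  have "{x} \<in> null_sets \<mu>" for x by (rule null_lborel_imp_null[OF finite_imp_null_set_lborel]) simp
  then have cont: "isCont (cdf \<mu>) x" for x by (simp add: isCont_cdf null_sets_def measure_def)
  have "eventually (\<lambda>x. p < cdf \<mu> x) at_top" using cdf_lim_at_top_prob p by (auto intro: order_tendstoD)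
  then obtain b where b: "\<And>x. b \<le> x \<Longrightarrow> p < cdf \<mu> x" by (auto simp: eventually_at_top_linorder)
  have "eventually (\<lambda>x. cdf \<mu> x < p) at_bot" using cdf_lim_at_bot p by (auto intro: order_tendstoD)
  then obtain a where a: "\<And>x. x \<le> a \<Longrightarrow> cdf \<mu> x < p" by (auto simp: eventually_at_bot_linorder)
  have "\<exists>x\<ge>min a b. x \<le> max a b \<and> cdf \<mu> x = p"
    using a[of "min a b"] b[of "max a b"] cont by (intro IVT) auto
  then obtain x where x: "cdf \<mu> x = p" by auto
  have "\<exists>y\<in>I. y \<le> x"
  proof (rule ccontr)
    assume "\<not> (\<exists>y\<in>I. y \<le> x)"
    then have "measure \<mu> {..x} = measure \<mu> {}" using AE_I by (intro measure_eq_AE) (auto elim: eventually_mono)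
    then show False using x p by (simp add: cdf_def)
  qed
  moreover have "\<exists>y\<in>I. x \<le> y"
  proof (rule ccontr)
    assume "\<not> (\<exists>y\<in>I. x \<le> y)"
    then have "measure \<mu> {..x} = measure \<mu> UNIV" using AE_I by (intro measure_eq_AE) (auto elim!: eventually_mono)
    then show False using x p prob_space by (simp add: cdf_def)
  qed
  ultimately have "x \<in> I" using I_interval by blast
  then show ?thesis using x that by blast
qed

lemma cdf_distr_strict_mono:
  assumes [measurable]: "S \<in> borel_measurable borel" and inc: "\<And>x y. x \<in> I \<Longrightarrow> y \<in> I \<Longrightarrow> x < y \<Longrightarrow> S x < S y"
    and x: "x \<in> I"
  shows "cdf (distr \<mu> borel S) (S x) = cdf \<mu> x"
proof -
  have [measurable]: "S \<in> borel_measurable \<mu>" by (simp cong: measurable_cong_sets)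
  have "AE u in \<mu>. S u \<le> S x \<longleftrightarrow> u \<le> x"
    using AE_I
  proof eventually_elim
    case (elim u)
    then show ?case using inc[of u x] inc[of x u] x by (cases u x rule: linorder_cases) auto
  qed
  then have "measure \<mu> (S -` {..S x} \<inter> space \<mu>) = measure \<mu> {..x}"
    by (intro measure_eq_AE) (auto elim!: eventually_mono simp: measurable_sets_borel[OF assms(1)])
  then show ?thesis by (simp add: cdf_def measure_distr)
qed

text \<open>\<open>S x\<close> reaches the level. Below it nothing does: for y < S x, continuity
  gives some z < x in I with y < S z, and the cdf of \<mu> is strictly smaller at z than at
  x.\<close>

lemma quantile_distr_strict_mono:
  assumes S[measurable]: "S \<in> borel_measurable borel" and inc: "\<And>x y. x \<in> I \<Longrightarrow> y \<in> I \<Longrightarrow> x < y \<Longrightarrow> S x < S y"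
    and cont: "\<And>x. x \<in> I \<Longrightarrow> isCont S x" and x: "x \<in> I"
  shows "quantile (cdf (distr \<mu> borel S)) (cdf \<mu> x) = S x"
proof -
  have [measurable]: "S \<in> borel_measurable \<mu>" by (simp cong: measurable_cong_sets)
  interpret \<nu>: real_distribution "distr \<mu> borel S" by (rule real_distribution_distr) simp
  have cdf: "cdf (distr \<mu> borel S) (S z) = cdf \<mu> z" if "z \<in> I" for z
    by (rule cdf_distr_strict_mono[OF S _ that]) (rule inc)
  show ?thesis unfolding quantile_def
  proof (rule cInf_eq_minimum)
    show "S x \<in> {y. cdf \<mu> x \<le> cdf (distr \<mu> borel S) y}" using cdf[OF x] by simp
    fix y assume y: "y \<in> {y. cdf \<mu> x \<le> cdf (distr \<mu> borel S) y}"
    show "S x \<le> y"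
    proof (rule ccontr)
      assume "\<not> S x \<le> y"
      then have "eventually (\<lambda>z. y < S z) (at x)" using cont[OF x] by (intro order_tendstoD) (auto simp: isCont_def)
      moreover have "eventually (\<lambda>z. z \<in> I) (at x)" by (rule eventually_at_in_open'[OF open_I x])
      ultimately have "eventually (\<lambda>z. y < S z \<and> z \<in> I) (at_left x)" by (auto simp: eventually_at_split eventually_conj)
      then obtain b where b: "b < x" "\<And>z. b < z \<Longrightarrow> z < x \<Longrightarrow> y < S z \<and> z \<in> I"
        by (auto simp: eventually_at_left_field)
      obtain z where z: "b < z" "z < x" using dense[OF b(1)] by blast
      then have zI: "y < S z" "z \<in> I" using b by auto
      have "cdf (distr \<mu> borel S) y \<le> cdf (distr \<mu> borel S) (S z)" using zI by (intro \<nu>.cdf_nondecreasing) auto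
      also have "\<dots> = cdf \<mu> z" by (rule cdf[OF zI(2)])
      also have "\<dots> < cdf \<mu> x" by (rule cdf_strict_mono_I[OF zI(2) x z(2)])
      finally show False using y by simp
    qed
  qed
qed

text \<open>Only a positive derivative at each point is at hand, with no continuity of that
  derivative. The inverse of S is then differentiable on the image, and differentiable images of
  null sets are null; so the preimage of a null set is null for \<mu>.\<close>

lemma absolutely_continuous_distr:
  assumes S[measurable]: "S \<in> borel_measurable borel" and inc: "\<And>x y. x \<in> I \<Longrightarrow> y \<in> I \<Longrightarrow> x < y \<Longrightarrow> S x < S y"
    and der: "\<And>x. x \<in> I \<Longrightarrow> \<exists>d>0. DERIV S x :> d"
  shows "absolutely_continuous lborel (distr \<mu> borel S)"
  unfolding absolutely_continuous_def
proof
  fix N :: "real set" assume N: "N \<in> null_sets lborel"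
  then have NB[measurable]: "N \<in> sets borel" by auto
  have Sm: "S \<in> borel_measurable \<mu>" using S by (simp cong: measurable_cong_sets)
  define G where "G = the_inv_into I S"
  have inj: "inj_on S I" by (rule inj_onI) (metis inc less_irrefl linorder_neqE)
  have GS: "G (S x) = x" if "x \<in> I" for x using that inj by (simp add: G_def the_inv_into_f_f)
  have cont: "isCont S x" if "x \<in> I" for x using der[OF that] DERIV_isCont by blast
  define A where "A = {x \<in> I. S x \<in> N}"
  have "A = I \<inter> S -` N" by (auto simp: A_def)
  then have A[measurable]: "A \<in> sets borel" using measurable_sets_borel[OF S NB] open_I by auto
  have dG: "\<exists>d. DERIV G (S x) :> d" if x: "x \<in> I" for x
  proof -
    obtain a b where ab: "a \<in> I" "b \<in> I" "a < x" "x < b" using I_neighbours[OF x] .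
    have abI: "z \<in> I" if "a \<le> z" "z \<le> b" for z using I_interval[OF ab(1,2) that] .
    obtain d where d: "0 < d" "DERIV S x :> d" using der[OF x] by blast
    have "DERIV G (S x) :> inverse d"
    proof (rule DERIV_inverse_function[where f=S and a="S a" and b="S b"])
      show "DERIV S (G (S x)) :> d" using d GS[OF x] by simp
      show "S a < S x" "S x < S b" using ab x inc by auto
      show "isCont G (S x)" by (rule isCont_inverse_function2[of a x b]) (use ab GS cont abI in auto)
      fix y assume y: "S a < y" "y < S b"
      have "\<exists>z\<ge>a. z \<le> b \<and> S z = y" using y ab cont abI by (intro IVT) auto
      then show "S (G y) = y" using GS abI by auto
    qed (use d in simp)
    then show ?thesis by blast
  qed
  have "negligible (G ` (N \<inter> S ` I))"
  proof (rule negligible_differentiable_image_negligible)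
    show "negligible (N \<inter> S ` I)"
      by (rule negligible_subset[of N]) (simp_all add: negligible_iff_null_sets null_sets_completionI[OF N])
    show "G differentiable_on N \<inter> S ` I"
      unfolding differentiable_on_def
    proof
      fix y assume "y \<in> N \<inter> S ` I"
      then obtain x where x: "x \<in> I" "y = S x" by auto
      have "G differentiable at y" using dG[OF x(1)] by (simp add: x real_differentiable_def)
      then show "G differentiable at y within N \<inter> S ` I" by (rule differentiable_at_withinI)
    qed
  qed simp
  moreover have "A \<subseteq> G ` (N \<inter> S ` I)"
  proof
    fix x assume "x \<in> A"
    then have "x \<in> I" "S x \<in> N \<inter> S ` I" by (auto simp: A_def)
    then show "x \<in> G ` (N \<inter> S ` I)" by (intro image_eqI[where x="S x"]) (simp_all only: GS)
  qed
  ultimately have "negligible A" by (rule negligible_subset)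
  then have "A \<in> null_sets lborel" by (simp add: negligible_iff_null_sets null_sets_completion_iff)
  then have "A \<in> null_sets \<mu>" by (rule null_lborel_imp_null)
  then have "AE x in \<mu>. x \<notin> A" by (rule AE_not_in)
  with AE_I have "AE x in \<mu>. S x \<notin> N" by eventually_elim (auto simp: A_def)
  then have "S -` N \<inter> space \<mu> \<in> null_sets \<mu>"
    using measurable_sets_borel[OF S NB] by (subst AE_iff_null_sets) (auto simp: AE_iff_null_sets)
  then have "emeasure \<mu> (S -` N \<inter> space \<mu>) = 0" by (rule null_setsD1)
  then show "N \<in> null_sets (distr \<mu> borel S)"
    using NB Sm by (simp add: null_sets_def emeasure_distr)
qed

lemma distr_real_density:
  assumes S[measurable]: "S \<in> borel_measurable borel" and ac: "absolutely_continuous lborel (distr \<mu> borel S)"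
  obtains g where "g \<in> borel_measurable borel" "\<And>x. 0 \<le> g x" "distr \<mu> borel S = density lborel (\<lambda>x. ennreal (g x))"
proof -
  have Sm: "S \<in> borel_measurable \<mu>" using S by (simp cong: measurable_cong_sets)
  obtain h where h: "h \<in> borel_measurable lborel" "density lborel h = distr \<mu> borel S"
    using sigma_finite_measure.Radon_Nikodym[OF sigma_finite_lborel ac] by auto
  interpret N: prob_space "distr \<mu> borel S" by (rule prob_space_distr[OF Sm])
  have "(\<integral>\<^sup>+x. h x \<partial>lborel) = emeasure (density lborel h) UNIV" using h(1) by (simp add: emeasure_density)
  also have "\<dots> = 1" unfolding h(2) using N.emeasure_space_1 by simp
  finally have "AE x in lborel. h x \<noteq> \<infinity>" using h(1) by (intro nn_integral_noteq_infinite) auto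
  then have "density lborel h = density lborel (\<lambda>x. ennreal (enn2real (h x)))"
    using h(1) by (intro density_cong) (auto elim!: eventually_mono simp: top.not_eq_extremum)
  then show ?thesis using that[of "\<lambda>x. enn2real (h x)"] h by simp
qed

lemma integral_etahat_fhat:
  fixes W :: "int \<Rightarrow> real \<Rightarrow> real" and n h :: nat
  assumes n: "0 < n" and W: "\<And>t. W t \<in> borel_measurable borel"
    and der: "\<And>t u. t \<in> {1..int n} \<Longrightarrow> u \<in> D \<Longrightarrow> \<exists>d. (W t has_real_derivative d) (at u within D) \<and> d > -1"
    and Q: "Q = (\<lambda>t. quantile (cdf (Exp_map \<mu> (W t))))"
    and meas[measurable]: "etahat Q n h \<in> borel_measurable borel" "fhat Q n \<in> borel_measurable borel"
  defines "Wb \<equiv> \<lambda>x. (1 / real n) * (\<Sum>t\<in>{1..int n}. W t x)"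
  shows "(\<integral>u. etahat Q n h u * fhat Q n u \<partial>lborel) =
    (\<integral>x. (1 / real n) * (\<Sum>t\<in>{1..int n - int h}. (W t x - Wb x) * (W (t + int h) x - Wb x)) \<partial>\<mu>)"
proof -
  define T where "T t x = W t x + x" for t x
  define Tb where "Tb x = (1 / real n) * (\<Sum>t\<in>{1..int n}. T t x)" for x
  have Tb: "Tb x = Wb x + x" for x
    using n by (simp add: Tb_def T_def Wb_def sum.distrib algebra_simps)
  note [measurable] = W
  have Tm[measurable]: "T t \<in> borel_measurable borel" for t unfolding T_def by measurable
  have Tbm[measurable]: "Tb \<in> borel_measurable borel" unfolding Tb_def by measurable
  have Tbm': "Tb \<in> borel_measurable \<mu>" by (simp cong: measurable_cong_sets)
  have derT: "\<exists>d>0. DERIV (T t) x :> d" if t: "t \<in> {1..int n}" and x: "x \<in> I" for t x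
  proof -
    obtain d where d: "(W t has_real_derivative d) (at x within D)" "d > -1" using der[OF t] x I_sub_D by blast
    moreover have "at x within D = at x" using x unfolding I_def by (rule at_within_interior)
    ultimately have "DERIV (W t) x :> d" by simp
    then have "DERIV (T t) x :> d + 1" unfolding T_def by (intro derivative_intros)
    then show ?thesis using d by (intro exI[of _ "d + 1"]) auto
  qed
  have incT: "T t x < T t y" if t: "t \<in> {1..int n}" and xy: "x \<in> I" "y \<in> I" "x < y" for t x y
    by (rule DERIV_pos_imp_increasing[OF xy(3)]) (use derT[OF t] I_interval[OF xy(1,2)] in blast)
  have derTb: "\<exists>d>0. DERIV Tb x :> d" if x: "x \<in> I" for x
  proof -
    have "\<exists>d. \<forall>t\<in>{1..int n}. 0 < d t \<and> DERIV (T t) x :> d t" using derT[OF _ x] by (intro bchoice) blast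
    then obtain d where d: "\<And>t. t \<in> {1..int n} \<Longrightarrow> 0 < d t \<and> DERIV (T t) x :> d t" by blast
    have "DERIV Tb x :> (1 / real n) * (\<Sum>t\<in>{1..int n}. d t)"
      unfolding Tb_def using d by (intro DERIV_cmult DERIV_sum) auto
    moreover have "0 < (1 / real n) * (\<Sum>t\<in>{1..int n}. d t)" using d n by (intro mult_pos_pos sum_pos) auto
    ultimately show ?thesis by blast
  qed
  have incTb: "Tb x < Tb y" if "x \<in> I" "y \<in> I" "x < y" for x y
    unfolding Tb_def using n incT that by (intro mult_strict_left_mono sum_strict_mono) auto
  define \<nu> where "\<nu> = distr \<mu> borel Tb"
  have rd: "real_distribution \<nu>" unfolding \<nu>_def by (rule real_distribution_distr[OF Tbm'])
  have QT: "Q t (cdf \<mu> x) = T t x" if t: "t \<in> {1..int n}" and x: "x \<in> I" for t x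
  proof -
    have "Exp_map \<mu> (W t) = distr \<mu> borel (T t)" by (simp add: Exp_map_def T_def[abs_def])
    moreover have "quantile (cdf (distr \<mu> borel (T t))) (cdf \<mu> x) = T t x"
      by (rule quantile_distr_strict_mono[OF Tm _ _ x]) (use incT[OF t] derT[OF t] DERIV_isCont in blast)+
    ultimately show ?thesis by (simp add: Q)
  qed
  \<comment> \<open>At level \<open>cdf \<mu> x\<close> every quantile function takes the value of
    its own map, so their average is \<open>Tb x\<close>, the quantile of the image under
    \<open>Tb\<close>; every level in (0, 1) is of this form by \<open>cdf_surj_I\<close>.\<close>
  have F: "Fhat Q n = cdf \<nu>"
    unfolding Fhat_def
  proof (rule cdf_of_quantile_eq_cdf[OF rd])
    fix p :: real assume "0 < p" "p < 1"
    then obtain x where x: "x \<in> I" "cdf \<mu> x = p" by (rule cdf_surj_I)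
    have "(1 / real n) * (\<Sum>t\<in>{1..int n}. Q t p) = Tb x"
      unfolding Tb_def using QT[OF _ x(1)] by (simp add: x(2))
    moreover have "quantile (cdf \<nu>) (cdf \<mu> x) = Tb x"
      unfolding \<nu>_def by (rule quantile_distr_strict_mono[OF Tbm _ _ x(1)]) (use incTb derTb DERIV_isCont in blast)+
    ultimately show "(1 / real n) * (\<Sum>t\<in>{1..int n}. Q t p) = quantile (cdf \<nu>) p" by (simp add: x(2))
  qed
  have That: "That Q n t (Tb x) = T t x" if "t \<in> {1..int n}" "x \<in> I" for t x
  proof -
    have "cdf \<nu> (Tb x) = cdf \<mu> x" unfolding \<nu>_def by (rule cdf_distr_strict_mono[OF Tbm _ that(2)]) (rule incTb)
    then show ?thesis using QT[OF that] by (simp add: That_def F)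
  qed
  have ac: "absolutely_continuous lborel \<nu>"
    unfolding \<nu>_def by (rule absolutely_continuous_distr[OF Tbm]) (use incTb derTb in blast)+
  obtain g where g[measurable]: "g \<in> borel_measurable borel" and g0: "\<And>x. 0 \<le> g x" and \<nu>g: "\<nu> = density lborel (\<lambda>x. ennreal (g x))"
    using distr_real_density[OF Tbm ac[unfolded \<nu>_def]] unfolding \<nu>_def by blast
  have "prob_space \<nu>" using rd by (simp add: real_distribution_def)
  then have "AE x in lborel. DERIV (cdf \<nu>) x :> g x" unfolding \<nu>g by (rule AE_cdf_has_derivative[OF g g0])
  \<comment> \<open>The estimated density is a pointwise derivative and agrees with the
    Radon-Nikodym density only almost everywhere, which suffices under the integral.\<close>
  then have fg: "AE x in lborel. fhat Q n x = g x"
    by eventually_elim (simp add: fhat_def F DERIV_imp_deriv)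
  have "(\<integral>u. etahat Q n h u * fhat Q n u \<partial>lborel) = (\<integral>u. g u *\<^sub>R etahat Q n h u \<partial>lborel)"
    by (rule integral_cong_AE) (use fg in \<open>auto elim!: eventually_mono\<close>)
  also have "\<dots> = (\<integral>u. etahat Q n h u \<partial>\<nu>)"
    unfolding \<nu>g by (rule integral_density[symmetric]) (auto simp: g0)
  also have "\<dots> = (\<integral>x. etahat Q n h (Tb x) \<partial>\<mu>)"
    unfolding \<nu>_def by (rule integral_distr[OF Tbm' meas(1)])
  also have "\<dots> = (\<integral>x. (1 / real n) * (\<Sum>t\<in>{1..int n - int h}. (W t x - Wb x) * (W (t + int h) x - Wb x)) \<partial>\<mu>)"
  proof (rule integral_cong_AE)
    have "(\<lambda>x. etahat Q n h (Tb x)) \<in> borel_measurable borel" by measurable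
    then show "(\<lambda>x. etahat Q n h (Tb x)) \<in> borel_measurable \<mu>" by (simp cong: measurable_cong_sets)
    have "(\<lambda>x. (1 / real n) * (\<Sum>t\<in>{1..int n - int h}. (W t x - Wb x) * (W (t + int h) x - Wb x))) \<in> borel_measurable borel"
      unfolding Wb_def by measurable
    then show "(\<lambda>x. (1 / real n) * (\<Sum>t\<in>{1..int n - int h}. (W t x - Wb x) * (W (t + int h) x - Wb x))) \<in> borel_measurable \<mu>"
      by (simp cong: measurable_cong_sets)
    show "AE x in \<mu>. etahat Q n h (Tb x) = (1 / real n) * (\<Sum>t\<in>{1..int n - int h}. (W t x - Wb x) * (W (t + int h) x - Wb x))"
      using AE_I
    proof eventually_elim
      case (elim x)
      \<comment> \<open>The identity contained in each transport map cancels, leaving deviations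
        from the sample mean; for the lagged sum both t and t + h stay in {1..n}.\<close>
      have "That Q n t (Tb x) - Tb x = W t x - Wb x" if "t \<in> {1..int n}" for t
        using That[OF that elim] by (simp add: Tb T_def)
      then show ?case unfolding etahat_def by (intro arg_cong2[where f="(*)"] sum.cong refl) auto
    qed
  qed
  finally show ?thesis .
qed

end

section \<open>Asymptotic normality\<close>

lemma sum_int_interval: "(\<Sum>t\<in>{1..int n}. g t) = (\<Sum>j<n. g (int (Suc j)))"
proof (induction n)
  case (Suc n)
  have "{1..int (Suc n)} = insert (int (Suc n)) {1..int n}" by auto
  then show ?case using Suc by (simp add: add.commute)
qed simp

lemma quantile_Exp_map_measurable:
  fixes W :: "'a \<Rightarrow> real \<Rightarrow> real" and \<mu> :: "real measure"
  assumes "prob_space \<mu>" and sets: "sets \<mu> = sets borel"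
    and W: "(\<lambda>(\<omega>, u). W \<omega> u) \<in> borel_measurable (M \<Otimes>\<^sub>M borel)"
  shows "(\<lambda>(\<omega>, p). quantile (cdf (Exp_map \<mu> (W \<omega>))) p) \<in> borel_measurable (M \<Otimes>\<^sub>M borel)"
    and "\<And>\<omega>. \<omega> \<in> space M \<Longrightarrow> mono_on {0<..<1} (quantile (cdf (Exp_map \<mu> (W \<omega>))))"
proof -
  interpret prob_space \<mu> by fact
  have W2[measurable (raw)]: "(\<lambda>x. W (p x) (q x)) \<in> borel_measurable N"
    if "p \<in> measurable N M" "q \<in> borel_measurable N" for p q and N :: "'c measure"
    using measurable_compose[OF measurable_Pair[OF that] W] by simp
  have Wm: "W \<omega> \<in> borel_measurable borel" if "\<omega> \<in> space M" for \<omega>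
    using measurable_compose[OF measurable_Pair1'[OF that] W] by simp
  have WE: "(\<lambda>u. W \<omega> u + u) \<in> borel_measurable \<mu>" if "\<omega> \<in> space M" for \<omega>
  proof -
    have "(\<lambda>u. W \<omega> u + u) \<in> borel_measurable borel" using Wm[OF that] by measurable
    then show ?thesis by (simp add: sets cong: measurable_cong_sets)
  qed
  have rd: "real_distribution (Exp_map \<mu> (W \<omega>))" if "\<omega> \<in> space M" for \<omega>
    unfolding Exp_map_def by (rule real_distribution_distr[OF WE[OF that]])
  then show "\<omega> \<in> space M \<Longrightarrow> mono_on {0<..<1} (quantile (cdf (Exp_map \<mu> (W \<omega>))))" for \<omega>
    by (rule quantile_mono_on)
  show "(\<lambda>(\<omega>, p). quantile (cdf (Exp_map \<mu> (W \<omega>))) p) \<in> borel_measurable (M \<Otimes>\<^sub>M borel)"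
  proof (rule quantile_measurable)
    fix \<omega> x assume "\<omega> \<in> space M"
    then interpret E: real_distribution "Exp_map \<mu> (W \<omega>)" by (rule rd)
    show "mono (cdf (Exp_map \<mu> (W \<omega>)))" by (intro monoI E.cdf_nondecreasing)
    show "continuous (at_right x) (cdf (Exp_map \<mu> (W \<omega>)))" by (rule E.cdf_is_right_cont)
  next
    fix x
    have "(\<lambda>(\<omega>, u). indicator {..x} (W \<omega> u + u) :: real) \<in> borel_measurable (M \<Otimes>\<^sub>M borel)" by measurable
    then have m: "(\<lambda>(\<omega>, u). indicator {..x} (W \<omega> u + u) :: real) \<in> borel_measurable (M \<Otimes>\<^sub>M \<mu>)"
      by (simp add: sets cong: measurable_cong_sets sets_pair_measure_cong)
    have "(\<lambda>\<omega>. \<integral>u. indicator {..x} (W \<omega> u + u) \<partial>\<mu> :: real) \<in> borel_measurable M"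
      using borel_measurable_lebesgue_integral[OF m] by simp
    moreover have "cdf (Exp_map \<mu> (W \<omega>)) x = (\<integral>u. indicator {..x} (W \<omega> u + u) \<partial>\<mu>)" if "\<omega> \<in> space M" for \<omega>
    proof -
      have "(\<integral>y. indicator {..x} y \<partial>(Exp_map \<mu> (W \<omega>)) :: real) = (\<integral>u. indicator {..x} (W \<omega> u + u) \<partial>\<mu>)"
        unfolding Exp_map_def by (rule integral_distr[OF WE[OF that]]) simp
      then show ?thesis by (simp add: cdf_def Exp_map_def)
    qed
    ultimately show "(\<lambda>\<omega>. cdf (Exp_map \<mu> (W \<omega>)) x) \<in> borel_measurable M" by (simp cong: measurable_cong)
  qed
qed

theorem theorem2:
  fixes M :: "'a measure" and \<epsilon> :: "int \<Rightarrow> 'a \<Rightarrow> real \<Rightarrow> real"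
    and f :: "real \<Rightarrow> real" and D :: "real set" and \<beta> :: real
  assumes P: "prob_space M"
    and f_meas: "f \<in> borel_measurable borel"
    and f_nonneg: "\<And>x. f x \<ge> 0"
    and f_prob: "prob_space (density lborel f)"
    and f_mom2: "integrable (density lborel f) (\<lambda>x. x\<^sup>2)"
    and D_supp: "measure_support (density lborel f) = D"
    and D_int: "is_interval D"
    and eps_meas: "\<And>t. \<epsilon> t \<in> measurable M (Pi\<^sub>M UNIV (\<lambda>_. borel))"
    and eps_joint: "\<And>t. (\<lambda>(\<omega>, u). \<epsilon> t \<omega> u) \<in> borel_measurable (M \<Otimes>\<^sub>M lborel)"
    and eps_tan: "\<And>t \<omega>. \<omega> \<in> space M \<Longrightarrow> \<epsilon> t \<omega> \<in> tangent_space (density lborel f)"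
    and A1: "\<bar>\<beta>\<bar> < 1"
    and A2_indep: "prob_space.indep_vars M (\<lambda>_. Pi\<^sub>M UNIV (\<lambda>_. borel)) \<epsilon> UNIV"
    and A2_ident: "\<And>t. distr M (Pi\<^sub>M UNIV (\<lambda>_. borel)) (\<epsilon> t) = distr M (Pi\<^sub>M UNIV (\<lambda>_. borel)) (\<epsilon> 0)"
    and A2_mean: "\<And>t u. u \<in> D \<Longrightarrow> integrable M (\<lambda>\<omega>. \<epsilon> t \<omega> u) \<and> (\<integral>\<omega>. \<epsilon> t \<omega> u \<partial>M) = 0"
    and A2_var: "(\<integral>\<^sup>+u. (\<integral>\<^sup>+\<omega>. ennreal ((\<epsilon> 0 \<omega> u)\<^sup>2) \<partial>M) * ennreal (f u) \<partial>lborel) < \<infinity>"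
    and A3: "\<And>t. AE \<omega> in M. \<forall>u\<in>D. summable (\<lambda>i. \<beta> ^ i * \<epsilon> (t - int i) \<omega> u) \<and>
                 (\<exists>d. (Vproc \<beta> \<epsilon> t \<omega> has_real_derivative d) (at u within D) \<and> d > -1)"
    and A4: "(\<integral>\<^sup>+u. (\<integral>\<^sup>+\<omega>. ennreal ((\<epsilon> 0 \<omega> u) ^ 4) \<partial>M) * ennreal (f u) \<partial>lborel) < \<infinity>"
    and nondeg: "(\<integral>u. cov_kernel M \<epsilon> u u * f u \<partial>lborel) \<noteq> 0"
  shows "integrable (lborel \<Otimes>\<^sub>M lborel)
           (\<lambda>uv. (cov_kernel M \<epsilon> (fst uv) (snd uv))\<^sup>2 * f (fst uv) * f (snd uv))
       \<and> weak_conv_m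
           (\<lambda>n. distr M borel (\<lambda>\<omega>. sqrt (real n) * (betahat (\<lambda>t. Qobs f \<beta> \<epsilon> t \<omega>) n - \<beta>)))
           (density lborel (normal_density 0 (sqrt (sigma_eps_sq M \<epsilon> f * (1 - \<beta>\<^sup>2)))))"
proof -
  define \<mu> where "\<mu> = density lborel (\<lambda>x. ennreal (f x))"
  interpret M: prob_space M by (rule P)
  interpret U: prob_space "density lborel (\<lambda>x. ennreal (f x))" by (rule f_prob)
  interpret ID: interval_density f D \<mu>
    by unfold_locales (simp_all only: \<mu>_def f_meas f_nonneg f_prob D_supp D_int)
  have [measurable]: "f \<in> borel_measurable borel" by (rule f_meas)
  have eps2[measurable (raw)]: "(\<lambda>x. \<epsilon> t (p x) (q x)) \<in> borel_measurable N"
    if "p \<in> measurable N M" "q \<in> borel_measurable N" for t p q and N :: "'c measure"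
  proof -
    have "q \<in> measurable N lborel" using that(2) by simp
    from measurable_compose[OF measurable_Pair[OF that(1) this] eps_joint[of t]] show ?thesis by simp
  qed
  have sets_mu: "sets \<mu> = sets lborel" by simp
  have [measurable]: "fst \<in> borel_measurable (lborel \<Otimes>\<^sub>M lborel)" "snd \<in> borel_measurable (lborel \<Otimes>\<^sub>M lborel)"
    using measurable_fst[of lborel lborel] measurable_snd[of lborel lborel] by simp_all
  have ckm[measurable]: "(\<lambda>x. cov_kernel M \<epsilon> (fst x) (snd x)) \<in> borel_measurable (lborel \<Otimes>\<^sub>M lborel)"
    unfolding cov_kernel_def by measurable
  have ckm1[measurable]: "(\<lambda>u. cov_kernel M \<epsilon> u u) \<in> borel_measurable lborel"
    unfolding cov_kernel_def by measurable
  have Vm: "(\<lambda>(\<omega>, u). Vproc \<beta> \<epsilon> t \<omega> u) \<in> borel_measurable (M \<Otimes>\<^sub>M borel)" for t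
    unfolding Vproc_def by measurable
  have m4: "(\<lambda>u. \<integral>\<^sup>+\<omega>. ennreal (\<epsilon> 0 \<omega> u ^ 4) \<partial>M) \<in> borel_measurable lborel" by measurable
  have AE_D: "AE u in \<mu>. u \<in> D" using ID.AE_I by eventually_elim (use ID.I_sub_D in auto)
  interpret AR: functional_ar1 M \<mu> \<epsilon> \<beta>
  proof
    show "(\<lambda>(\<omega>, u). \<epsilon> t \<omega> u) \<in> borel_measurable (M \<Otimes>\<^sub>M \<mu>)" for t
      unfolding measurable_cong_sets[OF sets_pair_measure_cong[OF refl sets_mu] refl] by (rule eps_joint)
    show "AE u in \<mu>. \<forall>t. M.expectation (\<lambda>\<omega>. \<epsilon> t \<omega> u) = 0"
      using AE_D A2_mean by (auto elim: eventually_mono)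
    have "(\<integral>\<^sup>+u. (\<integral>\<^sup>+\<omega>. ennreal (\<epsilon> 0 \<omega> u ^ 4) \<partial>M) \<partial>\<mu>) = (\<integral>\<^sup>+u. ennreal (f u) * (\<integral>\<^sup>+\<omega>. ennreal (\<epsilon> 0 \<omega> u ^ 4) \<partial>M) \<partial>lborel)"
      unfolding \<mu>_def by (rule nn_integral_density[OF _ m4]) simp
    then show "(\<integral>\<^sup>+u. (\<integral>\<^sup>+\<omega>. ennreal (\<epsilon> 0 \<omega> u ^ 4) \<partial>M) \<partial>\<mu>) < \<infinity>"
      using A4 by (simp add: mult.commute)
  qed (use A2_indep A2_ident A1 in auto)
  have V: "AR.V = Vproc \<beta> \<epsilon>" by (intro ext) (simp add: AR.V_def Vproc_def)

  \<comment> \<open>The subtracted product of means vanishes as soon as one factor is centred, so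
    only u has to lie in D.\<close>
  have ck: "cov_kernel M \<epsilon> u v = AR.cov u v" if "u \<in> D" for u v
    using A2_mean[OF that, of 0] by (simp add: cov_kernel_def AR.cov_def)
  have dens2: "\<mu> \<Otimes>\<^sub>M \<mu> = density (lborel \<Otimes>\<^sub>M lborel) (\<lambda>x. ennreal (f (fst x) * f (snd x)))"
  proof -
    have "\<mu> \<Otimes>\<^sub>M \<mu> = density (lborel \<Otimes>\<^sub>M lborel) (\<lambda>(x, y). ennreal (f x) * ennreal (f y))"
      unfolding \<mu>_def
      by (rule pair_measure_density) (simp_all add: sigma_finite_lborel U.sigma_finite_measure_axioms)
    then show ?thesis by (simp add: ennreal_mult f_nonneg split_beta')
  qed
  have AE2: "AE x in \<mu> \<Otimes>\<^sub>M \<mu>. (cov_kernel M \<epsilon> (fst x) (snd x))\<^sup>2 = (AR.cov (fst x) (snd x))\<^sup>2"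
    using AR.AE_pair_components[OF AE_D] by eventually_elim (simp add: ck)
  have ckm': "(\<lambda>x. (cov_kernel M \<epsilon> (fst x) (snd x))\<^sup>2) \<in> borel_measurable (\<mu> \<Otimes>\<^sub>M \<mu>)"
  proof -
    show ?thesis unfolding measurable_cong_sets[OF sets_pair_measure_cong[OF sets_mu sets_mu] refl] by measurable
  qed
  have ckm2: "(\<lambda>x. (cov_kernel M \<epsilon> (fst x) (snd x))\<^sup>2) \<in> borel_measurable (lborel \<Otimes>\<^sub>M lborel)" by measurable
  have ff: "(\<lambda>x. f (fst x) * f (snd x)) \<in> borel_measurable (lborel \<Otimes>\<^sub>M lborel)" by measurable
  have int2: "integrable (\<mu> \<Otimes>\<^sub>M \<mu>) (\<lambda>x. (cov_kernel M \<epsilon> (fst x) (snd x))\<^sup>2)"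
    by (rule integrable_cong_AE_imp[OF AR.integrable_cov_square ckm']) (use AE2 in \<open>auto elim: eventually_mono\<close>)
  have eq2: "(f (fst x) * f (snd x)) *\<^sub>R (cov_kernel M \<epsilon> (fst x) (snd x))\<^sup>2 = (cov_kernel M \<epsilon> (fst x) (snd x))\<^sup>2 * f (fst x) * f (snd x)" for x
    by (simp add: mult_ac)
  have part1: "integrable (lborel \<Otimes>\<^sub>M lborel) (\<lambda>x. (cov_kernel M \<epsilon> (fst x) (snd x))\<^sup>2 * f (fst x) * f (snd x))"
  proof -
    have "integrable (density (lborel \<Otimes>\<^sub>M lborel) (\<lambda>x. ennreal (f (fst x) * f (snd x)))) (\<lambda>x. (cov_kernel M \<epsilon> (fst x) (snd x))\<^sup>2)"
      using int2 unfolding dens2 .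
    from integrable_density[THEN iffD1, OF ckm2 ff _ this] f_nonneg show ?thesis unfolding eq2 by simp
  qed
  have C2: "AR.C2 = (\<integral>x. (cov_kernel M \<epsilon> (fst x) (snd x))\<^sup>2 * f (fst x) * f (snd x) \<partial>(lborel \<Otimes>\<^sub>M lborel))"
  proof -
    have "AR.C2 = (\<integral>x. (cov_kernel M \<epsilon> (fst x) (snd x))\<^sup>2 \<partial>(\<mu> \<Otimes>\<^sub>M \<mu>))"
      unfolding AR.C2_def by (rule integral_cong_AE) (use AE2 ckm' AR.integrable_cov_square in \<open>auto elim: eventually_mono\<close>)
    also have "\<dots> = (\<integral>x. (f (fst x) * f (snd x)) *\<^sub>R (cov_kernel M \<epsilon> (fst x) (snd x))\<^sup>2 \<partial>(lborel \<Otimes>\<^sub>M lborel))"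
      unfolding dens2 by (rule integral_density[OF ckm2 ff]) (simp add: f_nonneg)
    finally show ?thesis unfolding eq2 .
  qed
  have \<kappa>: "AR.\<kappa> = (\<integral>u. cov_kernel M \<epsilon> u u * f u \<partial>lborel)"
  proof -
    have m: "(\<lambda>u. cov_kernel M \<epsilon> u u) \<in> borel_measurable \<mu>" using ckm1 by (simp add: \<mu>_def)
    have "AR.\<kappa> = (\<integral>u. cov_kernel M \<epsilon> u u \<partial>\<mu>)"
      unfolding AR.\<kappa>_def
    proof (rule integral_cong_AE[OF _ m])
      show "(\<lambda>u. AR.cov u u) \<in> borel_measurable \<mu>"
        using measurable_compose[OF measurable_Pair[OF measurable_ident_sets[OF refl] measurable_ident_sets[OF refl]] AR.cov_measurable]
        by simp
      show "AE u in \<mu>. AR.cov u u = cov_kernel M \<epsilon> u u" using AE_D by eventually_elim (simp add: ck)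
    qed
    also have "\<dots> = (\<integral>u. f u *\<^sub>R cov_kernel M \<epsilon> u u \<partial>lborel)"
      unfolding \<mu>_def by (rule integral_density[OF ckm1]) (simp_all add: f_nonneg)
    finally show ?thesis by (simp add: mult.commute)
  qed

  have Vs: "Vproc \<beta> \<epsilon> t \<omega> \<in> borel_measurable borel" if "\<omega> \<in> space M" for t \<omega>
    using measurable_compose[OF measurable_Pair1'[OF that] Vm[of t]] by simp
  note Qm = quantile_Exp_map_measurable[OF f_prob[folded \<mu>_def] ID.sets_mu Vm]
  have Q: "Qobs f \<beta> \<epsilon> t \<omega> = quantile (cdf (Exp_map \<mu> (Vproc \<beta> \<epsilon> t \<omega>)))" for t \<omega>
    by (simp add: Qobs_def \<mu>_def)
  have Qj: "(\<lambda>(\<omega>, p). Qobs f \<beta> \<epsilon> t \<omega> p) \<in> borel_measurable (M \<Otimes>\<^sub>M borel)" for t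
    unfolding Q by (rule Qm(1))
  have Qmono: "mono_on {0<..<1} (Qobs f \<beta> \<epsilon> t \<omega>)" if "\<omega> \<in> space M" for t \<omega>
    unfolding Q by (rule Qm(2)[OF that])
  \<comment> \<open>The differentiability hypothesis holds almost surely for each t; over the
    countably many t it holds simultaneously, and on that event the estimator is the ratio in
    L^2(\<mu>).\<close>
  have beta_eq: "AE \<omega> in M. betahat (\<lambda>t. Qobs f \<beta> \<epsilon> t \<omega>) n = AR.num n \<omega> / AR.den n \<omega>" if n: "0 < n" for n
  proof -
    have "AE \<omega> in M. \<forall>t. \<forall>u\<in>D. summable (\<lambda>i. \<beta> ^ i * \<epsilon> (t - int i) \<omega> u) \<and>
                 (\<exists>d. (Vproc \<beta> \<epsilon> t \<omega> has_real_derivative d) (at u within D) \<and> d > -1)"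
      by (subst AE_all_countable) (use A3 in blast)
    then show ?thesis
      using AE_space
    proof eventually_elim
      case (elim \<omega>)
      define W where "W t = Vproc \<beta> \<epsilon> t \<omega>" for t
      have eta_j: "(\<lambda>x. etahat (\<lambda>t. Qobs f \<beta> \<epsilon> t (fst x)) n h (snd x)) \<in> borel_measurable (M \<Otimes>\<^sub>M borel)" for h
        by (rule etahat_measurable[OF Qj]) (rule Qmono)
      have f_j: "(\<lambda>x. fhat (\<lambda>t. Qobs f \<beta> \<epsilon> t (fst x)) n (snd x)) \<in> borel_measurable (M \<Otimes>\<^sub>M borel)"
        by (rule fhat_measurable[OF Qj]) (rule Qmono)
      have "etahat (\<lambda>t. Qobs f \<beta> \<epsilon> t \<omega>) n h \<in> borel_measurable borel" "fhat (\<lambda>t. Qobs f \<beta> \<epsilon> t \<omega>) n \<in> borel_measurable borel" for h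
        using measurable_compose[OF measurable_Pair1'[OF elim(2)] eta_j]
          measurable_compose[OF measurable_Pair1'[OF elim(2)] f_j] by simp_all
      note sec = this
      have I: "(\<integral>u. etahat (\<lambda>t. Qobs f \<beta> \<epsilon> t \<omega>) n h u * fhat (\<lambda>t. Qobs f \<beta> \<epsilon> t \<omega>) n u \<partial>lborel) =
         (\<integral>x. (1 / real n) * (\<Sum>t\<in>{1..int n - int h}. (W t x - (1 / real n) * (\<Sum>t\<in>{1..int n}. W t x)) *
            (W (t + int h) x - (1 / real n) * (\<Sum>t\<in>{1..int n}. W t x))) \<partial>\<mu>)" for h
      proof (rule ID.integral_etahat_fhat[OF n, where W=W])
        show "W t \<in> borel_measurable borel" for t unfolding W_def by (rule Vs[OF elim(2)])
        show "\<exists>d. (W t has_real_derivative d) (at u within D) \<and> d > -1" if "u \<in> D" for t u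
          unfolding W_def using elim(1) that by blast
      qed (simp_all only: Q W_def sec[unfolded Q])
      have vb: "(1 / real n) * (\<Sum>t\<in>{1..int n}. W t x) = AR.vb n \<omega> x" for x
        by (simp add: sum_int_interval AR.vb_def W_def V)
      \<comment> \<open>The truncated subtraction in \<open>num\<close> agrees with the integer
        range of the lagged sum because n is positive.\<close>
      have n1: "int n - int 1 = int (n - 1)" using n by simp
      have num: "(\<integral>u. etahat (\<lambda>t. Qobs f \<beta> \<epsilon> t \<omega>) n 1 u * fhat (\<lambda>t. Qobs f \<beta> \<epsilon> t \<omega>) n u \<partial>lborel) = (1 / real n) * AR.num n \<omega>"
      proof -
        have SS: "int (Suc j) + int 1 = int (Suc (Suc j))" for j by simp
        show ?thesis unfolding I[of 1, unfolded vb] n1 sum_int_interval AR.num_def V W_def integral_mult_right_zero SS ..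
      qed
      have den: "(\<integral>u. etahat (\<lambda>t. Qobs f \<beta> \<epsilon> t \<omega>) n 0 u * fhat (\<lambda>t. Qobs f \<beta> \<epsilon> t \<omega>) n u \<partial>lborel) = (1 / real n) * AR.den n \<omega>"
        unfolding I[of 0, unfolded vb] of_nat_0 diff_zero add_0_right sum_int_interval AR.den_def V W_def integral_mult_right_zero
        power2_eq_square ..
      show ?case unfolding betahat_def num den using n by simp
    qed
  qed
  have "weak_conv_m (\<lambda>n. distr M borel (\<lambda>\<omega>. sqrt (real n) * (betahat (\<lambda>t. Qobs f \<beta> \<epsilon> t \<omega>) n - \<beta>)))
           (density lborel (normal_density 0 (sqrt (AR.C2 / AR.\<kappa>\<^sup>2 * (1 - \<beta>\<^sup>2)))))"
  proof (rule AR.ratio_weak_conv_normal[OF _ _ beta_eq])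
    show "(\<lambda>\<omega>. betahat (\<lambda>t. Qobs f \<beta> \<epsilon> t \<omega>) n) \<in> borel_measurable M" for n
      by (rule betahat_measurable[OF Qj]) (rule Qmono)
    show "AR.\<kappa> \<noteq> 0" using nondeg by (simp add: \<kappa>)
  qed
  then show ?thesis using part1 unfolding sigma_eps_sq_def C2 \<kappa> by blast
qed

end
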